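(* Consider the planar $8$-body problem and the family of central configurations $w:(0,r_0)\to\Omega$ of two nested squares with masses $m(r)=(M_r,M_r,M_r,M_r,1,1,1,1)$, and the associated $SO(2)$-invariant potential $\varphi:\Omega\times(0,r_0)\to\mathbb{R}$, $\varphi(q,r)=U(q,m(r))+\lambda(r)I(q,m(r))$, all as defined in the context. Put $r_1=\frac{\sqrt2}{7}$, $r_2=\frac{\sqrt2}{6}$, $r_3=\frac{\sqrt2}{5}$. Then: (1) there exists a local bifurcation parameter in $(r_1,r_2)$, that is, $(r_1,r_2)\cap\mathcal{BIF}\neq\emptyset$; (2) there exists a global bifurcation parameter in $(r_2,r_3)$, that is, $(r_2,r_3)\cap\mathcal{GLOB}\neq\emptyset$.
   Context: $\Omega=\{q=(q_1,\dots,q_8)\in(\mathbb{R}^2)^8: q_i\neq q_j\text{ for }i\neq j\}$, with $SO(2)$ acting diagonally, $g\cdot q=(gq_1,\dots,gq_8)$. For $m\in(0,\infty)^8$: $U(q,m)=\sum_{1\le i<j\le 8}\frac{m_im_j}{|q_i-q_j|}$ and $I(q,m)=\frac12\sum_{j=1}^8 m_j|q_j|^2$. Family. For $0<r<r_0=0.37602\ldots$, $w(r)=(q_1,\dots,q_8)$ with $q_1=(-\frac12,-\frac12)$, $q_2=(\frac12,-\frac12)$, $q_3=(\frac12,\frac12)$, $q_4=(-\frac12,\frac12)$, $q_5=(-\frac{\sqrt2}2r,-\frac{\sqrt2}2r)$, $q_6=(\frac{\sqrt2}2r,-\frac{\sqrt2}2r)$, $q_7=(\frac{\sqrt2}2r,\frac{\sqrt2}2r)$,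 $q_8=(-\frac{\sqrt2}2r,\frac{\sqrt2}2r)$. With $R_{i,j}=|q_i-q_j|^{-3}$ and $\Delta_{i,j,k}=(q_i-q_j)\wedge(q_i-q_k)$ evaluated at $w(r)$, let $A(r)=(R_{1,2}-R_{1,5})\Delta_{1,5,2}+(R_{1,3}-R_{1,6})\Delta_{1,6,3}+(R_{1,7}-R_{1,2})\Delta_{1,7,2}$, $B(r)=(R_{6,7}-R_{1,5})\Delta_{1,5,6}+(R_{1,7}-R_{6,7})\Delta_{5,6,3}+(R_{1,6}-R_{5,7})\Delta_{1,6,8}$, and $M_r=-B(r)/A(r)$, which is positive on $(0,r_0)$; $m(r)=(M_r,M_r,M_r,M_r,1,1,1,1)$ (it is known that $w(r)$ is then a central configuration). Let $\lambda(r)=\frac{U(w(r),m(r))}{2I(w(r),m(r))}$. Then $\nabla_q\varphi(w(r),r)=0$ for all $r\in(0,r_0)$. Bifurcation. For $X\subset(0,r_0)$ let $\mathcal{F}_X=\bigcup_{r\in X}SO(2)(w(r))\times\{r\}$, where $SO(2)(q)$ is the orbit of $q$, and $\mathcal{F}=\mathcal{F}_{(0,r_0)}$. Let $\mathcal{N}=\{(q,r)\in(\Omega\times(0,r_0))\setminus\mathcal{F}:\nabla_q\varphi(q,r)=0\}$, and let closures be taken in $\Omega\times(0,r_0)$. $\mathcal{BIF}$ is the set of $\rho_0\in(0,r_0)$ such that $(w(\rho_0),\rho_0)$ is an accumulation point of $\mathcal{N}$. For $\rho_0$ in a segment $[\rho^-,\rho^+]$, let $C(\rho_0)$ be the connected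 component of $\mathrm{cl}(\mathcal{N})\cup\mathcal{F}_{\{\rho_0\}}$ containing $\mathcal{F}_{\{\rho_0\}}$; $\rho_0$ is a parameter of global bifurcation, $\rho_0\in\mathcal{GLOB}$, if $C(\rho_0)$ is not compact or $(C(\rho_0)\setminus\mathcal{F}_{[\rho^-,\rho^+]})\cap\mathcal{F}\neq\emptyset$. In (2) the segment is $[\rho^-,\rho^+]=[r_2,r_3]$. *)

theory Defs
  imports "HOL-Analysis.Analysis"
begin

text \<open>
  A configuration of eight planar bodies is a \<^typ>\<open>real^2^8\<close>. The index type \<^typ>\<open>8\<close> has the elements
  1, ..., 8 with \<open>8 = 0\<close>, so 8 is its least element. This is harmless in \<open>potential\<close>, whose
  summand is symmetric: \<open>i < j\<close> still selects every unordered pair exactly once.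
\<close>

lemma exhaust_8:
  fixes x :: 8
  shows "x = 1 \<or> x = 2 \<or> x = 3 \<or> x = 4 \<or> x = 5 \<or> x = 6 \<or> x = 7 \<or> x = 8"
proof (induct x)
  case (of_int z)
  then have "z = 0 \<or> z = 1 \<or> z = 2 \<or> z = 3 \<or> z = 4 \<or> z = 5 \<or> z = 6 \<or> z = 7"
    by auto
  then show ?case by auto
qed

lemma vector_8:
  "(vector [a,b,c,d,e,f,g,h] :: ('a::zero)^8) $ 1 = a"
  "(vector [a,b,c,d,e,f,g,h] :: ('a::zero)^8) $ 2 = b"
  "(vector [a,b,c,d,e,f,g,h] :: ('a::zero)^8) $ 3 = c"
  "(vector [a,b,c,d,e,f,g,h] :: ('a::zero)^8) $ 4 = d"
  "(vector [a,b,c,d,e,f,g,h] :: ('a::zero)^8) $ 5 = e"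
  "(vector [a,b,c,d,e,f,g,h] :: ('a::zero)^8) $ 6 = f"
  "(vector [a,b,c,d,e,f,g,h] :: ('a::zero)^8) $ 7 = g"
  "(vector [a,b,c,d,e,f,g,h] :: ('a::zero)^8) $ 8 = h"
  unfolding vector_def by simp_all

definition Omega :: "(real^2^8) set" where
  "Omega = {q. \<forall>i j. i \<noteq> j \<longrightarrow> q $ i \<noteq> q $ j}"

definition SO2_orbit :: "real^2^8 \<Rightarrow> (real^2^8) set" where
  "SO2_orbit q = {(\<chi> i. g *v (q $ i)) |g::real^2^2. rotation_matrix g}"

definition potential :: "real^2^8 \<Rightarrow> real^8 \<Rightarrow> real" where
  "potential q m = (\<Sum>(i, j) | i < j. m $ i * m $ j / norm (q $ i - q $ j))"

definition inertia :: "real^2^8 \<Rightarrow> real^8 \<Rightarrow> real" where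
  "inertia q m = 1 / 2 * (\<Sum>j\<in>UNIV. m $ j * (norm (q $ j))\<^sup>2)"

definition nested_squares :: "real \<Rightarrow> real^2^8" where
  "nested_squares r = vector [
     vector [- 1/2, - 1/2], vector [1/2, - 1/2], vector [1/2, 1/2], vector [- 1/2, 1/2],
     vector [- (sqrt 2 / 2 * r), - (sqrt 2 / 2 * r)], vector [sqrt 2 / 2 * r, - (sqrt 2 / 2 * r)],
     vector [sqrt 2 / 2 * r, sqrt 2 / 2 * r], vector [- (sqrt 2 / 2 * r), sqrt 2 / 2 * r]]"

definition wedge :: "real^2 \<Rightarrow> real^2 \<Rightarrow> real" where
  "wedge u v = u $ 1 * v $ 2 - u $ 2 * v $ 1"

definition inv_cube_dist :: "real^2^8 \<Rightarrow> 8 \<Rightarrow> 8 \<Rightarrow> real" where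
  "inv_cube_dist q i j = 1 / norm (q $ i - q $ j) ^ 3"

definition area :: "real^2^8 \<Rightarrow> 8 \<Rightarrow> 8 \<Rightarrow> 8 \<Rightarrow> real" where
  "area q i j k = wedge (q $ i - q $ j) (q $ i - q $ k)"

definition coeff_A :: "real \<Rightarrow> real" where
  "coeff_A r = (let R = inv_cube_dist (nested_squares r); \<Delta> = area (nested_squares r) in
     (R 1 2 - R 1 5) * \<Delta> 1 5 2 + (R 1 3 - R 1 6) * \<Delta> 1 6 3 + (R 1 7 - R 1 2) * \<Delta> 1 7 2)"

definition coeff_B :: "real \<Rightarrow> real" where
  "coeff_B r = (let R = inv_cube_dist (nested_squares r); \<Delta> = area (nested_squares r) in
     (R 6 7 - R 1 5) * \<Delta> 1 5 6 + (R 1 7 - R 6 7) * \<Delta> 5 6 3 + (R 1 6 - R 5 7) * \<Delta> 1 6 8)"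

definition outer_mass :: "real \<Rightarrow> real" where
  "outer_mass r = - coeff_B r / coeff_A r"

text \<open>
  The right end \<open>r\<^sub>0 = 0.37602...\<close> of the parameter interval is the end of the maximal interval
  \<open>(0, s)\<close> on which \<open>M\<^sub>r\<close> is positive; there \<open>B\<close> changes sign, while \<open>A > 0\<close>.
\<close>

definition r0 :: real where
  "r0 = Sup {s. 0 < s \<and> (\<forall>r\<in>{0<..<s}. 0 < outer_mass r)}"

definition masses :: "real \<Rightarrow> real^8" where
  "masses r = vector [outer_mass r, outer_mass r, outer_mass r, outer_mass r, 1, 1, 1, 1]"

definition lam :: "real \<Rightarrow> real" where
  "lam r = potential (nested_squares r) (masses r) / (2 * inertia (nested_squares r) (masses r))"

definition phi :: "real^2^8 \<Rightarrow> real \<Rightarrow> real" where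
  "phi q r = potential q (masses r) + lam r * inertia q (masses r)"

definition trivial_family :: "real set \<Rightarrow> ((real^2^8) \<times> real) set" where
  "trivial_family X = (\<Union>r\<in>X. SO2_orbit (nested_squares r) \<times> {r})"

definition nontrivial :: "((real^2^8) \<times> real) set" where
  "nontrivial = {(q, r). (q, r) \<in> (Omega \<times> {0<..<r0}) - trivial_family {0<..<r0} \<and>
                         GDERIV (\<lambda>q. phi q r) q :> 0}"

text \<open>The closure relative to \<open>\<Omega> \<times> (0, r\<^sub>0)\<close>.\<close>

definition nontrivial_closure :: "((real^2^8) \<times> real) set" where
  "nontrivial_closure = closure nontrivial \<inter> (Omega \<times> {0<..<r0})"

definition BIF :: "real set" where
  "BIF = {\<rho>. \<rho> \<in> {0<..<r0} \<and> (nested_squares \<rho>, \<rho>) islimpt nontrivial}"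

text \<open>
  The component \<open>C\<close> below is unique, since components are disjoint and \<open>trivial_family {\<rho>}\<close> is
  nonempty; it exists because this set, a single orbit, is connected.
\<close>

definition GLOB :: "real \<Rightarrow> real \<Rightarrow> real set" where
  "GLOB \<rho>m \<rho>p = {\<rho>. \<rho> \<in> {\<rho>m..\<rho>p} \<and>
     (\<exists>C\<in>components (nontrivial_closure \<union> trivial_family {\<rho>}). trivial_family {\<rho>} \<subseteq> C \<and>
        (\<not> compact C \<or> (C - trivial_family {\<rho>m..\<rho>p}) \<inter> trivial_family {0<..<r0} \<noteq> {}))}"

end

theory Submission
  imports Defs "HOL-Homology.Homology"
begin

text \<open>
  The configurations invariant under the reflection \<open>y \<mapsto> - y\<close> combined with the relabelling
  \<open>i \<mapsto> 5 - i\<close> form an 8-dimensional space. By symmetric criticality the equation restricted to it is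
  \<open>F(x, r) = 0\<close>, where \<open>F(\<cdot>, r)\<close> is the gradient of the restricted potential. If the second coordinate
  of the first body is required to be negative, then the orbit of \<open>w(r)\<close> meets this space only in
  \<open>w(r)\<close>, so the rotational degeneracy is gone. The Hessian at \<open>w(r)\<close> is nondegenerate with 0, 1 and 2
  negative directions for \<open>r = r\<^sub>1, r\<^sub>2, r\<^sub>3\<close>, so the index of \<open>w(r)\<close> as a zero of \<open>F(\<cdot>, r)\<close> changes
  sign on both intervals.

  Suppose that the zeros of \<open>F\<close> off the branch which accumulate on the branch over an interval \<open>[a, b]\<close>
  can be enclosed in a compact and relatively clopen set that meets the branch only over \<open>(a, b)\<close>. Then
  the total index of \<open>(x, t) \<mapsto> (F(x, t), t - s)\<close> on a neighbourhood of this set and the branch does not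
  depend on \<open>s\<close>. For \<open>s = a\<close> and \<open>s = b\<close> it is the index of the branch alone, because the set is pushed
  away by moving \<open>s\<close> to infinity, so the index cannot change. Without a local bifurcation parameter the
  empty set encloses; without a global one every component that meets the branch is compact and meets it
  only over the interval, and the Sura-Bura theorem gives the enclosing set.
\<close>

section \<open>The index of a map along a compact set of zeros\<close>

text \<open>Besides removing the rotation, the mirror symmetry makes the sign changes odd. The
  nested squares also have a quarter-turn symmetry, which gives the mode that turns negative between
  \<open>r1\<close> and \<open>r2\<close> (shifts of the squares mixed with trapezoidal
  deformations) an independent partner: in the full space two directions would change sign together
  and leave an index unchanged. Only one of the two is mirror symmetric. The mode that turns
  negative between \<open>r2\<close> and \<open>r3\<close> stretches the squares into rectangles and
  lies in another block of the Hessian.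

  No determinant or eigenvalue is computed. A derivative \<open>L\<close> is certified by a linear
  involution \<open>D\<close> with \<open>L v \<bullet> D v > 0\<close> for
  \<open>v \<noteq> 0\<close>; then the segment from \<open>L\<close> to \<open>D\<close> consists
  of invertible maps. For a symmetric form that is positive on one subspace and negative on a
  complement, the map that fixes the first and negates the second is such a \<open>D\<close>, even
  if the two subspaces are not orthogonal for the form. So rational directions and rational bounds
  suffice, and certificates that differ by one coordinate reflection have opposite indices.\<close>

definition sphere_set :: "nat \<Rightarrow> (nat \<Rightarrow> real) set" where
  "sphere_set m = {x. (\<Sum>i\<le>m. (x i)\<^sup>2) = 1 \<and> (\<forall>i>m. x i = 0)}"

lemma nsphere_eq: "nsphere m = top_of_set (sphere_set m)"
  by (simp add: nsphere euclidean_product_topology sphere_set_def)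

definition refl0 :: "(nat \<Rightarrow> real) \<Rightarrow> nat \<Rightarrow> real" where
  "refl0 = (\<lambda>x i. if i = 0 then - x i else x i)"

text \<open>The reduced homology is infinite cyclic and a coordinate reflection has degree -1, so it
  sends a generator to its inverse, which is a different element. Reduced homology also covers the
  0-sphere.\<close>

lemma nsphere_generator:
  obtains g where "g \<in> carrier (reduced_homology_group (int m) (nsphere m))"
    "hom_induced (int m) (nsphere m) {} (nsphere m) {} refl0 g \<noteq> g"
proof -
  let ?G = "reduced_homology_group (int m) (nsphere m)"
  interpret G: group ?G by simp
  obtain f where f: "f \<in> iso integer_group ?G"
    using reduced_homology_group_nsphere(1)[of m] group.iso_sym[of ?G integer_group]
    unfolding is_iso_def by auto
  then have hom: "f \<in> hom integer_group ?G" and bij: "bij_betw f UNIV (carrier ?G)"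
    by (auto simp: iso_def)
  define g where "g = f 1"
  have gc: "g \<in> carrier ?G" using bij by (auto simp: g_def bij_betw_def)
  have inv: "inv\<^bsub>?G\<^esub> g = f (- 1)"
  proof -
    have "f (-1) \<otimes>\<^bsub>?G\<^esub> f 1 = f ((-1) + 1)"
      using hom_mult[OF hom, of "-1" 1] by simp
    also have "\<dots> = \<one>\<^bsub>?G\<^esub>"
      using hom_one[OF hom group_integer_group G.is_group] by simp
    finally have "f (-1) \<otimes>\<^bsub>?G\<^esub> g = \<one>\<^bsub>?G\<^esub>" by (simp add: g_def)
    moreover have "f (-1) \<in> carrier ?G" using bij by (auto simp: bij_betw_def)
    ultimately show ?thesis using gc G.inv_equality by metis
  qed
  have "hom_induced (int m) (nsphere m) {} (nsphere m) {} refl0 g = g [^]\<^bsub>?G\<^esub> (-1::int)"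
    using Brouwer_degree2[OF gc, of refl0] Brouwer_degree2_reflection[of m]
    by (simp add: refl0_def)
  also have "\<dots> = f (-1)"
    using inv gc G.int_pow_neg[of g 1] by simp
  also have "\<dots> \<noteq> g"
    using bij inj_onD[of f UNIV "-1" 1] by (auto simp: g_def bij_betw_def)
  finally show ?thesis using that gc by blast
qed

definition reflect :: "'a::real_inner \<Rightarrow> 'a \<Rightarrow> 'a" where
  "reflect u x = x - (2 * (x \<bullet> u)) *\<^sub>R u"

lemma linear_reflect: "linear (reflect u)"
  unfolding reflect_def by (rule linearI) (simp_all add: algebra_simps inner_add_left)

text \<open>
  \<open>oc Z\<close> is an orientation class of the whole space relative to the complement of \<open>Z\<close>. It is the
  preimage, under the connecting map, of a generator of the homology of a sphere around \<open>Z\<close>.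
\<close>

lemma fundamental_classes:
  fixes u :: "'a::euclidean_space"
  assumes u: "u \<in> Basis"
  obtains p :: int and oc :: "'a set \<Rightarrow> 'a chain set" where
    "\<And>Z. bounded Z \<Longrightarrow> oc Z \<in> carrier (relative_homology_group p euclidean (- Z))"
    "\<And>Z Z'. \<lbrakk>bounded Z; Z' \<subseteq> Z\<rbrakk> \<Longrightarrow> hom_induced p euclidean (- Z) euclidean (- Z') id (oc Z) = oc Z'"
    "hom_induced p euclidean (- {0}) euclidean (- {0}) (reflect u) (oc {0}) \<noteq> oc {0}"
proof -
  define m where "m = DIM('a) - 1"
  have card: "card (Basis - {u} :: 'a set) = m"
    using u by (simp add: m_def)
  obtain b0 where b0: "bij_betw b0 {1..m} (Basis - {u} :: 'a set)"
    using card finite_same_card_bij[of "{1..m}" "Basis - {u} :: 'a set"] by auto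
  define b where "b = (\<lambda>i. if i = 0 then u else b0 i)"
  have b: "bij_betw b {..m} (Basis :: 'a set)"
  proof -
    have "bij_betw b {1..m} (Basis - {u})"
      using b0 by (rule bij_betw_cong[THEN iffD1, rotated]) (auto simp: b_def)
    moreover have "bij_betw b {0} {u}" by (simp add: b_def)
    ultimately have "bij_betw b ({1..m} \<union> {0}) ((Basis - {u}) \<union> {u})"
      by (rule bij_betw_combine) auto
    moreover have "{1..m} \<union> {0} = {..m}" by auto
    moreover have "(Basis - {u}) \<union> {u} = (Basis :: 'a set)" using u by auto
    ultimately show ?thesis by simp
  qed
  have bB: "b i \<in> Basis" if "i \<le> m" for i using b that by (auto simp: bij_betw_def)
  have bb: "b i \<bullet> b j = (if i = j then 1 else 0)" if "i \<le> m" "j \<le> m" for i j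
    using bB that b inner_Basis[of "b i" "b j"] by (auto simp: bij_betw_def inj_on_def)
  have b0u: "b 0 = u" by (simp add: b_def)
  define p where "p = int m + 1"
  obtain g where g: "g \<in> carrier (reduced_homology_group (int m) (nsphere m))"
    and gr: "hom_induced (int m) (nsphere m) {} (nsphere m) {} refl0 g \<noteq> g"
    using nsphere_generator by blast
  \<comment> \<open>\<open>e r\<close> embeds the standard sphere as the sphere of radius
    \<open>r\<close>. Since \<open>b 0 = u\<close>, it turns \<open>refl0\<close> into
    \<open>reflect u\<close>. The normalisation \<open>q\<close> is a left inverse of
    \<open>e r\<close> on the sphere.\<close>
  define e where "e r x = (\<Sum>i\<le>m. (r * x i) *\<^sub>R b i)" for r :: real and x
  define q where "q v = (\<lambda>i. if i \<le> m then (v \<bullet> b i) / norm v else 0)" for v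
  have norm_e: "norm (e r x) = r" if "r \<ge> 0" "x \<in> sphere_set m" for r x
  proof -
    have "(norm (e r x))\<^sup>2 = (\<Sum>i\<le>m. (r * x i)\<^sup>2)"
      unfolding power2_norm_eq_inner e_def
      by (simp add: inner_sum_left inner_sum_right bb if_distrib power2_eq_square cong: if_cong)
    also have "\<dots> = r\<^sup>2"
      using that(2) by (simp add: power_mult_distrib sphere_set_def flip: sum_distrib_left)
    finally show ?thesis using that(1) by (simp add: power2_eq_iff_nonneg)
  qed
  have cont_e: "continuous_on S (e r)" for r S
    unfolding e_def
    by (intro continuous_intros continuous_on_product_coordinates[THEN continuous_on_subset]) auto
  have e_in: "e r x \<in> - Z" if "r > 0" "x \<in> sphere_set m" "\<And>z. z \<in> Z \<Longrightarrow> norm z < r" for r x Z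
    using norm_e[of r x] that by force
  define cl where "cl r Z = hom_induced (int m) (nsphere m) {} (top_of_set (- Z)) {} (e r) g" for r Z
  define ok where "ok r Z \<longleftrightarrow> 0 < r \<and> (\<forall>z\<in>Z. norm z < r)" for r :: real and Z :: "'a set"
  have cm_e: "continuous_map (nsphere m) (top_of_set (- Z)) (e r)" if "ok r Z" for r Z
    using that e_in[of r _ Z] by (auto simp: nsphere_eq cont_e ok_def simp del: Compl_iff)
  have cl_carr: "cl r Z \<in> carrier (reduced_homology_group (int m) (top_of_set (- Z)))" for r Z
    unfolding cl_def by (rule hom_induced_reduced[OF g])
  \<comment> \<open>Two radii that enclose \<open>Z\<close> are joined through the radii between
    them, all of which enclose \<open>Z\<close>.\<close>
  have cl_indep: "cl r Z = cl r' Z" if "ok r Z" "ok r' Z" for r r' Z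
  proof -
    have "homotopic_with (\<lambda>h. True) (nsphere m) (top_of_set (- Z)) (e r) (e r')"
      unfolding nsphere_eq
    proof (rule homotopic_with_linear)
      fix x assume x: "x \<in> sphere_set m"
      have "(1 - t) *\<^sub>R e r x + t *\<^sub>R e r' x \<in> - Z" if t: "0 \<le> t" "t \<le> 1" for t
      proof -
        have "(1 - t) *\<^sub>R e r x + t *\<^sub>R e r' x = e ((1 - t) * r + t * r') x"
          by (simp add: e_def scaleR_sum_right distrib_right scaleR_add_left mult.assoc flip: sum.distrib)
        moreover have "ok ((1 - t) * r + t * r') Z"
        proof -
          define M where "M = min r r'"
          have "M \<le> (1 - t) * r + t * r'"
          proof -
            have "(1 - t) * M + t * M \<le> (1 - t) * r + t * r'"
              using t by (intro add_mono mult_left_mono) (auto simp: M_def)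
            then show ?thesis by (simp add: algebra_simps)
          qed
          moreover have "ok M Z" using \<open>ok r Z\<close> \<open>ok r' Z\<close> by (auto simp: ok_def M_def)
          ultimately show ?thesis by (force simp: ok_def)
        qed
        ultimately show ?thesis using e_in[OF _ x] by (auto simp: ok_def)
      qed
      then show "closed_segment (e r x) (e r' x) \<subseteq> - Z"
        by (auto simp: closed_segment_def)
    qed (auto intro: cont_e)
    then show ?thesis unfolding cl_def
      using homology_homotopy_empty by metis
  qed
  define bd where "bd Z = hom_boundary p (euclidean :: 'a topology) (- Z)" for Z
  \<comment> \<open>The whole space is contractible, so the connecting map of the pair is bijective.
    Boundedness of \<open>Z\<close> keeps the complement nonempty.\<close>
  have bd_iso: "bd Z \<in> iso (relative_homology_group p euclidean (- Z))
                     (reduced_homology_group (int m) (top_of_set (- Z)))" if "bounded Z" for Z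
  proof -
    have "- Z \<noteq> {}"
      using that not_bounded_UNIV[where 'a='a] by (metis Compl_empty_eq double_complement)
    then show ?thesis
      unfolding bd_def
      using iso_relative_homology_of_contractible[of "euclidean :: 'a topology" "- Z" p]
        contractible_space_top_of_set[of "UNIV :: 'a set"] contractible_UNIV
      by (simp add: p_def)
  qed
  have ex_ok: "\<exists>r. ok r Z" if "bounded Z" for Z
    using that unfolding ok_def bounded_pos_less by auto
  define rr where "rr Z = (SOME r. ok r Z)" for Z
  have rr: "ok (rr Z) Z" if "bounded Z" for Z
    unfolding rr_def using ex_ok[OF that] by (rule someI_ex)
  define oc where "oc Z = inv_into (carrier (relative_homology_group p euclidean (- Z))) (bd Z) (cl (rr Z) Z)" for Z
  have oc: "oc Z \<in> carrier (relative_homology_group p euclidean (- Z))" "bd Z (oc Z) = cl (rr Z) Z"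
    if "bounded Z" for Z
  proof -
    have "cl (rr Z) Z \<in> bd Z ` carrier (relative_homology_group p euclidean (- Z))"
      using bd_iso[OF that] cl_carr[of "rr Z" Z] by (auto simp: iso_def bij_betw_def)
    then show "oc Z \<in> carrier (relative_homology_group p euclidean (- Z))" "bd Z (oc Z) = cl (rr Z) Z"
      unfolding oc_def by (rule inv_into_into, rule f_inv_into_f)
  qed
  have nat: "bd Z' (hom_induced p euclidean (- Z) euclidean (- Z') f c)
    = hom_induced (int m) (top_of_set (- Z)) {} (top_of_set (- Z')) {} f (bd Z c)"
    if "continuous_on UNIV f" "f \<in> (- Z) \<rightarrow> (- Z')" for f Z Z' c
    using naturality_hom_induced[of euclidean euclidean f "- Z" "- Z'" p] that
    by (simp add: bd_def p_def fun_eq_iff)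
  have bd_inj: "x = y" if "bd Z x = bd Z y" "x \<in> carrier (relative_homology_group p euclidean (- Z))"
      "y \<in> carrier (relative_homology_group p euclidean (- Z))" "bounded Z" for x y Z
    using bd_iso[OF that(4)] that by (auto simp: iso_def bij_betw_def inj_on_def)
  show thesis
  proof
    show "oc Z \<in> carrier (relative_homology_group p euclidean (- Z))" if "bounded Z" for Z
      using oc that by blast
    show "hom_induced p euclidean (- Z) euclidean (- Z') id (oc Z) = oc Z'" if "bounded Z" "Z' \<subseteq> Z" for Z Z'
    proof (rule bd_inj)
      have bZ': "bounded Z'" using that bounded_subset by blast
      show "bounded Z'" by fact
      show "oc Z' \<in> carrier (relative_homology_group p euclidean (- Z'))" using oc bZ' by blast
      show "hom_induced p euclidean (- Z) euclidean (- Z') id (oc Z) \<in> carrier (relative_homology_group p euclidean (- Z'))"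
        by (rule hom_induced_carrier)
      \<comment> \<open>The radius chosen for \<open>Z\<close> also encloses \<open>Z'\<close>, and
        the class of the sphere does not depend on the radius.\<close>
      have okZ: "ok (rr Z) Z'" using rr[OF that(1)] that(2) by (auto simp: ok_def)
      have "bd Z' (hom_induced p euclidean (- Z) euclidean (- Z') id (oc Z))
          = hom_induced (int m) (top_of_set (- Z)) {} (top_of_set (- Z')) {} id (cl (rr Z) Z)"
        using that by (subst nat) (auto simp: oc)
      also have "\<dots> = cl (rr Z) Z'"
        unfolding cl_def using that
        by (subst hom_induced_compose') (auto intro: cm_e rr)
      also have "\<dots> = cl (rr Z') Z'" using okZ rr[OF bZ'] by (rule cl_indep)
      also have "\<dots> = bd Z' (oc Z')" using oc bZ' by simp
      finally show "bd Z' (hom_induced p euclidean (- Z) euclidean (- Z') id (oc Z)) = bd Z' (oc Z')" .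
    qed
    \<comment> \<open>A fixed class at the origin would give a fixed class of the sphere around it;
      applying \<open>q\<close> would carry this back to the generator \<open>g\<close>, which the
      reflection moves.\<close>
    show "hom_induced p euclidean (- {0}) euclidean (- {0}) (reflect u) (oc {0}) \<noteq> oc {0}"
    proof
      assume eq: "hom_induced p euclidean (- {0}) euclidean (- {0}) (reflect u) (oc {0}) = oc {0}"
      define r where "r = rr ({0}::'a set)"
      have okr: "ok r {0}" using rr[of "{0}"] by (simp add: r_def)
      then have r: "r > 0" by (simp add: ok_def)
      have uu: "u \<bullet> u = 1" using u by simp
      have cr: "continuous_on S (reflect u)" for S
        unfolding reflect_def by (intro continuous_intros)
      have refl0: "reflect u x = 0 \<longleftrightarrow> x = 0" for x
      proof
        assume "reflect u x = 0"
        then have x: "x = (2 * (x \<bullet> u)) *\<^sub>R u" by (simp add: reflect_def)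
        then have "x \<bullet> u = 2 * (x \<bullet> u)" by (metis inner_scaleR_left uu mult.right_neutral)
        then show "x = 0" using x by simp
      qed (simp add: reflect_def)
      have rm: "reflect u \<in> - {0} \<rightarrow> - {0}" using refl0 by auto
      have comm: "(reflect u \<circ> e r) x = (e r \<circ> refl0) x" for x
      proof -
        have "e r x \<bullet> u = r * x 0"
          unfolding e_def b0u[symmetric]
          by (simp add: inner_sum_left bb if_distrib cong: if_cong)
        moreover have "e r (refl0 x) = e r x - (2 * r * x 0) *\<^sub>R u"
        proof -
          have "e r x - e r (refl0 x) = (\<Sum>i\<le>m. (if i = 0 then (2 * r * x 0) *\<^sub>R u else 0))"
            unfolding e_def sum_subtractf[symmetric]
            by (rule sum.cong) (auto simp: refl0_def b0u simp flip: scaleR_add_left)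
          also have "\<dots> = (2 * r * x 0) *\<^sub>R u" by simp
          finally show ?thesis by (simp add: algebra_simps)
        qed
        ultimately show ?thesis by (simp add: reflect_def)
      qed
      have qe: "q (e r x) = x" if x: "x \<in> sphere_set m" for x
      proof
        fix i
        have "e r x \<bullet> b i = r * x i" if "i \<le> m"
          unfolding e_def using that
          by (simp add: inner_sum_left bb if_distrib cong: if_cong)
        then show "q (e r x) i = x i"
          using norm_e[OF less_imp_le[OF r] x] r x by (auto simp: q_def sphere_set_def)
      qed
      have q_in: "q v \<in> sphere_set m" if "v \<noteq> 0" for v
      proof -
        have "(\<Sum>i\<le>m. (v \<bullet> b i)\<^sup>2) = (\<Sum>c\<in>Basis. (v \<bullet> c)\<^sup>2)"
          using sum.reindex_bij_betw[OF b, of "\<lambda>c. (v \<bullet> c)\<^sup>2"] by simp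
        also have "\<dots> = (norm v)\<^sup>2"
          unfolding power2_norm_eq_inner euclidean_inner[of v v] by (simp add: power2_eq_square)
        finally show ?thesis
          using that by (simp add: sphere_set_def q_def power_divide flip: sum_divide_distrib)
      qed
      have cm_q: "continuous_map (top_of_set (- {0})) (nsphere m) q"
      proof -
        have "continuous_on (- {0}) q"
          unfolding q_def
        proof (rule continuous_on_coordinatewise_then_product)
          fix i
          show "continuous_on (- {0::'a}) (\<lambda>v. if i \<le> m then v \<bullet> b i / norm v else 0)"
            by (cases "i \<le> m") (auto intro!: continuous_intros)
        qed
        then show ?thesis using q_in by (auto simp: nsphere_eq)
      qed
      have cm_r0: "continuous_map (nsphere m) (nsphere m) refl0"
        unfolding refl0_def by (rule continuous_map_nsphere_reflection)
      let ?q = "hom_induced (int m) (top_of_set (- {0})) {} (nsphere m) {} q"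
      have gcar: "g \<in> carrier (homology_group (int m) (nsphere m))"
        using g carrier_reduced_homology_group_subset by blast
      have qe_id: "hom_induced (int m) (nsphere m) {} (nsphere m) {} (q \<circ> e r) c = c"
        if "c \<in> carrier (homology_group (int m) (nsphere m))" for c
        using that cm_e[OF okr] cm_q
        by (intro hom_induced_id_gen) (auto simp: qe nsphere_eq intro: continuous_map_compose)
      have "cl r {0} = bd {0} (hom_induced p euclidean (- {0}) euclidean (- {0}) (reflect u) (oc {0}))"
        using eq oc[of "{0}"] by (simp add: r_def)
      also have "\<dots> = hom_induced (int m) (top_of_set (- {0})) {} (top_of_set (- {0})) {} (reflect u) (cl r {0})"
        using cr rm by (subst nat) (auto simp: oc r_def)
      also have "\<dots> = hom_induced (int m) (nsphere m) {} (top_of_set (- {0})) {} (reflect u \<circ> e r) g"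
        unfolding cl_def using cm_e[OF okr] rm cr
        by (subst hom_induced_compose') auto
      also have "reflect u \<circ> e r = e r \<circ> refl0" using comm by (rule ext)
      also have "hom_induced (int m) (nsphere m) {} (top_of_set (- {0})) {} (e r \<circ> refl0) g
        = hom_induced (int m) (nsphere m) {} (top_of_set (- {0})) {} (e r)
           (hom_induced (int m) (nsphere m) {} (nsphere m) {} refl0 g)"
        using cm_e[OF okr] cm_r0 by (subst hom_induced_compose') auto
      finally have "?q (cl r {0}) = ?q \<dots>" by simp
      then have "g = hom_induced (int m) (nsphere m) {} (nsphere m) {} refl0 g"
        unfolding cl_def using cm_e[OF okr] cm_q
        by (simp add: hom_induced_compose' qe_id gcar hom_induced_carrier)
      then show False using gr by simp
    qed
  qed
qed

section \<open>Local orientation classes of compact sets and the properties of the index\<close>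

locale fundamental =
  fixes p :: int and oc :: "'a::euclidean_space set \<Rightarrow> 'a chain set"
  assumes oc_carrier: "bounded Z \<Longrightarrow> oc Z \<in> carrier (relative_homology_group p euclidean (- Z))"
    and oc_mono: "\<lbrakk>bounded Z; Z' \<subseteq> Z\<rbrakk> \<Longrightarrow> hom_induced p euclidean (- Z) euclidean (- Z') id (oc Z) = oc Z'"
begin

abbreviation RH :: "'a set \<Rightarrow> 'a set \<Rightarrow> 'a chain set monoid" where
  "RH V S \<equiv> relative_homology_group p (top_of_set V) S"

abbreviation hi :: "'a set \<Rightarrow> 'a set \<Rightarrow> 'a set \<Rightarrow> 'a set \<Rightarrow> ('a \<Rightarrow> 'a)
      \<Rightarrow> 'a chain set \<Rightarrow> 'a chain set" where
  "hi V S W T \<equiv> hom_induced p (top_of_set V) S (top_of_set W) T"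

lemma hi_comp:
  assumes "continuous_on V f" "f \<in> V \<rightarrow> W" "f \<in> S \<rightarrow> T" "continuous_on W g" "g \<in> W \<rightarrow> X" "g \<in> T \<rightarrow> Q"
  shows "hi W T X Q g (hi V S W T f c) = hi V S X Q (g \<circ> f) c"
  using assms by (intro hom_induced_compose') auto

lemma hi_carrier: "hi V S W T f c \<in> carrier (RH W T)"
  by (rule hom_induced_carrier)

text \<open>The set \<open>W - V\<close> is excised: it is closed in \<open>W\<close> and contained
  in \<open>W - Z\<close>, which is open in \<open>W\<close>.\<close>

lemma excision:
  assumes "open V" "closed Z" "Z \<subseteq> V" "V \<subseteq> W" "open W"
  shows "hi V (V - Z) W (W - Z) id \<in> iso (RH V (V - Z)) (RH W (W - Z))"
proof -
  have "hom_induced p (subtopology (top_of_set W) (W - (W - V))) ((W - Z) - (W - V))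
          (subtopology (top_of_set W) W) (W - Z) id
    \<in> iso (relative_homology_group p (subtopology (top_of_set W) (W - (W - V))) ((W - Z) - (W - V)))
          (relative_homology_group p (subtopology (top_of_set W) W) (W - Z))"
  proof (rule homology_excision_axiom)
    have "closedin (top_of_set W) (W - V)"
      using assms by (metis closedin_diff closedin_topspace openin_open_eq openin_subtopology_Int2 topspace_euclidean_subtopology
            Int_absorb1 inf.orderE openin_subset_topspace_eq openin_subset open_subset closedin_def Diff_Diff_Int Diff_subset)
    moreover have "openin (top_of_set W) (W - Z)"
      using assms by (simp add: openin_open_eq open_Diff)
    ultimately show "top_of_set W closure_of (W - V) \<subseteq> top_of_set W interior_of (W - Z)"
      using assms by (auto simp: closure_of_closedin interior_of_openin)
  qed auto
  moreover have "W - (W - V) = V" "(W - Z) - (W - V) = V - Z" using assms by auto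
  ultimately show ?thesis using assms by (simp add: subtopology_subtopology Int_absorb1)
qed

definition local_class :: "'a set \<Rightarrow> 'a set \<Rightarrow> 'a chain set" where
  "local_class V Z = inv_into (carrier (RH V (V - Z))) (hi V (V - Z) UNIV (UNIV - Z) id) (oc Z)"

lemma local_class:
  assumes "open V" "compact Z" "Z \<subseteq> V"
  shows "local_class V Z \<in> carrier (RH V (V - Z))" "hi V (V - Z) UNIV (UNIV - Z) id (local_class V Z) = oc Z"
proof -
  have "hi V (V - Z) UNIV (UNIV - Z) id \<in> iso (RH V (V - Z)) (RH UNIV (UNIV - Z))"
    using assms by (intro excision) (auto simp: compact_imp_closed)
  then have "oc Z \<in> hi V (V - Z) UNIV (UNIV - Z) id ` carrier (RH V (V - Z))"
    using oc_carrier[of Z] compact_imp_bounded[of Z] assms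
    by (auto simp: iso_def bij_betw_def Compl_eq_Diff_UNIV)
  then show "local_class V Z \<in> carrier (RH V (V - Z))" "hi V (V - Z) UNIV (UNIV - Z) id (local_class V Z) = oc Z"
    unfolding local_class_def by (rule inv_into_into, rule f_inv_into_f)
qed

lemma excision_inj:
  assumes "open V" "compact Z" "Z \<subseteq> V" "x \<in> carrier (RH V (V - Z))" "y \<in> carrier (RH V (V - Z))"
    "hi V (V - Z) UNIV (UNIV - Z) id x = hi V (V - Z) UNIV (UNIV - Z) id y"
  shows "x = y"
proof -
  have "hi V (V - Z) UNIV (UNIV - Z) id \<in> iso (RH V (V - Z)) (RH UNIV (UNIV - Z))"
    using assms by (intro excision) (auto simp: compact_imp_closed)
  then show ?thesis using assms by (auto simp: iso_def bij_betw_def inj_on_def)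
qed

lemma local_class_unique:
  assumes "open V" "compact Z" "Z \<subseteq> V" "x \<in> carrier (RH V (V - Z))"
    "hi V (V - Z) UNIV (UNIV - Z) id x = oc Z"
  shows "x = local_class V Z"
  using excision_inj[OF assms(1-4)] local_class[OF assms(1-3)] assms(5) by metis

lemma oc_mono': "\<lbrakk>bounded Z; Z' \<subseteq> Z\<rbrakk> \<Longrightarrow> hi UNIV (UNIV - Z) UNIV (UNIV - Z') id (oc Z) = oc Z'"
  using oc_mono by (simp add: Compl_eq_Diff_UNIV)

lemma local_class_shrink:
  assumes "open V" "compact Z" "Z \<subseteq> V" "compact Z'" "Z' \<subseteq> Z"
  shows "hi V (V - Z) V (V - Z') id (local_class V Z) = local_class V Z'"
proof (rule local_class_unique)
  have "hi V (V - Z') UNIV (UNIV - Z') id (hi V (V - Z) V (V - Z') id (local_class V Z))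
    = hi UNIV (UNIV - Z) UNIV (UNIV - Z') id (hi V (V - Z) UNIV (UNIV - Z) id (local_class V Z))"
    using assms by (subst (1 2) hi_comp) auto
  also have "\<dots> = oc Z'"
    using assms local_class oc_mono' by (simp add: compact_imp_bounded)
  finally show "hi V (V - Z') UNIV (UNIV - Z') id (hi V (V - Z) V (V - Z') id (local_class V Z)) = oc Z'" .
qed (use assms in \<open>auto intro: hi_carrier\<close>)

lemma local_class_extend:
  assumes "open V" "open W" "compact Z" "Z \<subseteq> V" "V \<subseteq> W"
  shows "hi V (V - Z) W (W - Z) id (local_class V Z) = local_class W Z"
proof (rule local_class_unique)
  have "hi W (W - Z) UNIV (UNIV - Z) id (hi V (V - Z) W (W - Z) id (local_class V Z))
    = hi V (V - Z) UNIV (UNIV - Z) id (local_class V Z)"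
    using assms by (subst hi_comp) auto
  then show "hi W (W - Z) UNIV (UNIV - Z) id (hi V (V - Z) W (W - Z) id (local_class V Z)) = oc Z"
    using assms local_class by simp
qed (use assms in \<open>auto intro: hi_carrier\<close>)

text \<open>
  The index is kept as a homology class of the pair \<open>(UNIV, UNIV - {0})\<close> instead of an integer: only
  additivity and the effect of a reflection are needed.
\<close>

definition index :: "'a set \<Rightarrow> 'a set \<Rightarrow> ('a \<Rightarrow> 'a) \<Rightarrow> 'a chain set" where
  "index V Z f = hi V (V - Z) UNIV (UNIV - {0}) f (local_class V Z)"

lemma index_carrier: "index V Z f \<in> carrier (RH UNIV (UNIV - {0}))"
  unfolding index_def by (rule hi_carrier)

text \<open>The index depends only on the zeros: the compact set may shrink to any compact
  \<open>Z'\<close> that still contains them, and then the domain may shrink to a neighbourhood of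
  \<open>Z'\<close>. The first step uses \<open>local_class_shrink\<close>, the second
  \<open>local_class_extend\<close>.\<close>

lemma index_mono:
  assumes "open V" "open W" "compact Z" "compact Z'" "Z' \<subseteq> V" "V \<subseteq> W" "Z' \<subseteq> Z" "Z \<subseteq> W"
    "continuous_on W f" "\<And>x. x \<in> W - Z' \<Longrightarrow> f x \<noteq> 0"
  shows "index W Z f = index V Z' f"
proof -
  have "index W Z f = hi W (W - Z') UNIV (UNIV - {0}) f (hi W (W - Z) W (W - Z') id (local_class W Z))"
    unfolding index_def using assms by (subst hi_comp) auto
  also have "hi W (W - Z) W (W - Z') id (local_class W Z) = local_class W Z'"
    using assms by (intro local_class_shrink)
  also have "\<dots> = hi V (V - Z') W (W - Z') id (local_class V Z')"
    using assms by (intro local_class_extend[symmetric]) auto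
  also have "hi W (W - Z') UNIV (UNIV - {0}) f \<dots> = index V Z' f"
    unfolding index_def using assms by (subst hi_comp) (auto intro: continuous_on_subset)
  finally show ?thesis .
qed

lemma index_homotopy:
  fixes h :: "real \<times> 'a \<Rightarrow> 'a"
  assumes "continuous_on ({0..1} \<times> V) h" "\<And>s x. \<lbrakk>0 \<le> s; s \<le> 1; x \<in> V - Z\<rbrakk> \<Longrightarrow> h (s, x) \<noteq> 0"
  shows "index V Z (\<lambda>x. h (0, x)) = index V Z (\<lambda>x. h (1, x))"
proof -
  have "homotopic_with (\<lambda>k. k \<in> (V - Z) \<rightarrow> UNIV - {0}) (top_of_set V) (top_of_set UNIV)
      (\<lambda>x. h (0, x)) (\<lambda>x. h (1, x :: 'a))"
    unfolding homotopic_with_def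
    using assms by (intro exI[of _ h]) (auto simp: prod_topology_subtopology_eu)
  then show ?thesis unfolding index_def
    using homology_homotopy_axiom by metis
qed

lemma trivial_RH: "trivial_group (RH V V)"
  using trivial_relative_homology_group_topspace[of p "top_of_set V"] by simp

text \<open>Without zeros the compact set may be replaced by the empty set, and the pair
  \<open>(V, V)\<close> has trivial homology.\<close>

lemma index_no_zero:
  assumes "open V" "compact Z" "Z \<subseteq> V" "continuous_on V f" "\<And>x. x \<in> V \<Longrightarrow> f x \<noteq> 0"
  shows "index V Z f = \<one>\<^bsub>RH UNIV (UNIV - {0})\<^esub>"
proof -
  have "index V Z f = index V {} f"
    using assms by (intro index_mono) auto
  moreover have "local_class V {} = \<one>\<^bsub>RH V V\<^esub>"
    using local_class(1)[of V "{}"] trivial_RH[of V] assms by (auto simp: trivial_group_def)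
  moreover have "hi V V UNIV (UNIV - {0}) f (\<one>\<^bsub>RH V V\<^esub>) = \<one>\<^bsub>RH UNIV (UNIV - {0})\<^esub>"
    by (rule hom_one[OF hom_induced_hom]) auto
  ultimately show ?thesis by (simp add: index_def)
qed

lemma hi_through_trivial:
  assumes "continuous_on V f" "f \<in> V \<rightarrow> T" "T \<subseteq> W" "S \<subseteq> V"
  shows "hi V S W T f c = \<one>\<^bsub>RH W T\<^esub>"
proof -
  have "hi V S W T f c = hi T T W T id (hi V S T T f c)"
    using assms by (subst hi_comp) auto
  moreover have "hi V S T T f c = \<one>\<^bsub>RH T T\<^esub>"
    using trivial_RH[of T] hi_carrier[of V S T T f c] by (auto simp: trivial_group_def)
  moreover have "hi T T W T id (\<one>\<^bsub>RH T T\<^esub>) = \<one>\<^bsub>RH W T\<^esub>"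
    by (rule hom_one[OF hom_induced_hom]) auto
  ultimately show ?thesis by simp
qed

text \<open>The class of \<open>Z\<close> minus the contribution of \<open>Z1\<close> vanishes
  relative to \<open>V - Z1\<close>. By the exact sequence of the triple
  \<open>(V, V - Z1, V - Z)\<close> and by excision it therefore comes from a class \<open>z\<close>
  on \<open>V2\<close>, and mapping everything into the pair of the whole space and the complement
  of \<open>Z2\<close> identifies \<open>z\<close>.\<close>

lemma local_class_split:
  assumes "open V1" "open V2" "V1 \<inter> V2 = {}" "compact Z1" "compact Z2" "Z1 \<subseteq> V1" "Z2 \<subseteq> V2"
  defines "V \<equiv> V1 \<union> V2" and "Z \<equiv> Z1 \<union> Z2"
  shows "local_class V Z = hi V1 (V1 - Z1) V (V - Z) id (local_class V1 Z1) \<otimes>\<^bsub>RH V (V - Z)\<^esub> hi V2 (V2 - Z2) V (V - Z) id (local_class V2 Z2)"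
proof -
  let ?G = "RH V (V - Z)"
  interpret G: comm_group ?G by simp
  have oV: "open V" and cZ: "compact Z" and ZV: "Z \<subseteq> V"
    using assms by auto
  define i1 where "i1 = hi V1 (V1 - Z1) V (V - Z) id"
  define i2 where "i2 = hi V2 (V2 - Z2) V (V - Z) id"
  define x where "x = local_class V Z \<otimes>\<^bsub>?G\<^esub> inv\<^bsub>?G\<^esub> (i1 (local_class V1 Z1))"
  have i1c: "i1 c \<in> carrier ?G" and i2c: "i2 c \<in> carrier ?G" for c
    unfolding i1_def i2_def by (auto intro: hi_carrier)
  have lV: "local_class V Z \<in> carrier ?G" using local_class(1)[OF oV cZ ZV] .
  have xc: "x \<in> carrier ?G" using i1c lV by (simp add: x_def)
  define A where "A = V - Z1"
  have oA: "open A" unfolding A_def using oV assms(4) by (intro open_Diff compact_imp_closed)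
  have BA: "V - Z \<subseteq> A" by (auto simp: A_def Z_def)
  let ?k = "hi V (V - Z) V A id"
  have hk: "?k \<in> hom ?G (RH V A)" by (rule hom_induced_hom)
  interpret k: group_hom ?G "RH V A" ?k
    using hk by (simp add: group_hom_def group_hom_axioms_def)
  have k1: "?k (local_class V Z) = local_class V Z1"
    unfolding A_def using oV cZ ZV assms by (intro local_class_shrink) (auto simp: Z_def)
  have k2: "?k (i1 (local_class V1 Z1)) = local_class V Z1"
  proof -
    have "?k (i1 (local_class V1 Z1)) = hi V1 (V1 - Z1) V (V - Z1) id (local_class V1 Z1)"
      unfolding i1_def A_def using assms by (subst hi_comp) auto
    also have "\<dots> = local_class V Z1" using assms oV by (intro local_class_extend) auto
    finally show ?thesis .
  qed
  have "?k x = \<one>\<^bsub>RH V A\<^esub>"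
    using k1 k2 i1c lV local_class(1)[OF oV, of Z1] by (simp add: x_def k.hom_mult k.hom_inv flip: k1)
  then have "x \<in> kernel ?G (RH V A) ?k" using xc by (simp add: kernel_def)
  moreover have "exact_seq ([RH V A, ?G, relative_homology_group p (subtopology (top_of_set V) A) (V - Z)],
       [?k, hom_induced p (subtopology (top_of_set V) A) (V - Z) (top_of_set V) (V - Z) id])"
    by (rule homology_exactness_triple_3[OF BA])
  moreover have "subtopology (top_of_set V) A = top_of_set A"
    by (simp add: A_def subtopology_subtopology Int_absorb1)
  ultimately obtain y where y: "y \<in> carrier (RH A (V - Z))" "x = hi A (V - Z) V (V - Z) id y"
    by auto
  \<comment> \<open>Thus the remaining pair of the triple is \<open>(A, A - Z2)\<close>, which can
    be excised to \<open>(V2, V2 - Z2)\<close>.\<close>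
  have VZ: "V - Z = A - Z2" by (auto simp: A_def Z_def)
  have V2A: "V2 \<subseteq> A" using assms by (auto simp: A_def)
  have surj: "hi V2 (V2 - Z2) A (A - Z2) id \<in> iso (RH V2 (V2 - Z2)) (RH A (A - Z2))"
    using assms V2A oA compact_imp_closed by (intro excision) auto
  obtain z where z: "z \<in> carrier (RH V2 (V2 - Z2))" "y = hi V2 (V2 - Z2) A (A - Z2) id z"
  proof -
    have "y \<in> hi V2 (V2 - Z2) A (A - Z2) id ` carrier (RH V2 (V2 - Z2))"
      using surj y(1) by (auto simp: iso_def bij_betw_def VZ)
    then show thesis using that by auto
  qed
  have xz: "x = i2 z"
    unfolding y(2) z(2) i2_def using V2A by (subst VZ[symmetric], subst hi_comp) (auto simp: A_def VZ[symmetric] Z_def)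
  have eq: "local_class V Z = i1 (local_class V1 Z1) \<otimes>\<^bsub>?G\<^esub> i2 z"
    using xz lV i1c[of "local_class V1 Z1"] by (metis x_def G.inv_solve_right' G.m_comm xc)
  have "z = local_class V2 Z2"
  proof (rule local_class_unique)
    let ?l = "hi V (V - Z) UNIV (UNIV - Z2) id"
    have hl: "?l \<in> hom ?G (RH UNIV (UNIV - Z2))" by (rule hom_induced_hom)
    interpret l: group_hom ?G "RH UNIV (UNIV - Z2)" ?l
      using hl by (simp add: group_hom_def group_hom_axioms_def)
    have l1: "?l (local_class V Z) = oc Z2"
    proof -
      have "?l (local_class V Z) = hi UNIV (UNIV - Z) UNIV (UNIV - Z2) id (hi V (V - Z) UNIV (UNIV - Z) id (local_class V Z))"
        by (subst hi_comp) (auto simp: Z_def)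
      also have "\<dots> = oc Z2"
        using local_class(2)[OF oV cZ ZV] oc_mono'[OF compact_imp_bounded[OF cZ], of Z2] by (simp add: Z_def)
      finally show ?thesis .
    qed
    \<comment> \<open>\<open>V1\<close> is disjoint from \<open>Z2\<close>, so the contribution of
      \<open>Z1\<close> is invisible in this pair.\<close>
    have l2: "?l (i1 c) = \<one>\<^bsub>RH UNIV (UNIV - Z2)\<^esub>" for c
    proof -
      have "?l (i1 c) = hi V1 (V1 - Z1) UNIV (UNIV - Z2) id c"
        unfolding i1_def using assms by (subst hi_comp) auto
      also have "\<dots> = \<one>\<^bsub>RH UNIV (UNIV - Z2)\<^esub>"
        using assms by (intro hi_through_trivial) auto
      finally show ?thesis .
    qed
    have l3: "?l (i2 c) = hi V2 (V2 - Z2) UNIV (UNIV - Z2) id c" for c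
      unfolding i2_def using assms by (subst hi_comp) auto
    have "oc Z2 = ?l (i1 (local_class V1 Z1)) \<otimes>\<^bsub>RH UNIV (UNIV - Z2)\<^esub> ?l (i2 z)"
      unfolding l1[symmetric] eq by (rule l.hom_mult[OF i1c i2c])
    also have "\<dots> = ?l (i2 z)"
      unfolding l2 by (rule l.H.l_one[OF hi_carrier])
    finally have "oc Z2 = ?l (i2 z)" .
    then show "hi V2 (V2 - Z2) UNIV (UNIV - Z2) id z = oc Z2" by (metis l3)
  qed (use assms z in auto)
  then show ?thesis using eq by (simp add: i1_def i2_def)
qed

lemma index_add:
  assumes "open V1" "open V2" "V1 \<inter> V2 = {}" "compact Z1" "compact Z2" "Z1 \<subseteq> V1" "Z2 \<subseteq> V2"
    and f: "continuous_on (V1 \<union> V2) f" "\<And>x. x \<in> V1 \<union> V2 - (Z1 \<union> Z2) \<Longrightarrow> f x \<noteq> 0"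
  shows "index (V1 \<union> V2) (Z1 \<union> Z2) f = index V1 Z1 f \<otimes>\<^bsub>RH UNIV (UNIV - {0})\<^esub> index V2 Z2 f"
proof -
  let ?V = "V1 \<union> V2" and ?Z = "Z1 \<union> Z2"
  have "index ?V ?Z f = hi ?V (?V - ?Z) UNIV (UNIV - {0}) f (hi V1 (V1 - Z1) ?V (?V - ?Z) id (local_class V1 Z1))
     \<otimes>\<^bsub>RH UNIV (UNIV - {0})\<^esub> hi ?V (?V - ?Z) UNIV (UNIV - {0}) f (hi V2 (V2 - Z2) ?V (?V - ?Z) id (local_class V2 Z2))"
    unfolding index_def local_class_split[OF assms(1-7)]
    by (rule hom_mult[OF hom_induced_hom]) (auto intro: hi_carrier)
  also have "hi ?V (?V - ?Z) UNIV (UNIV - {0}) f (hi V1 (V1 - Z1) ?V (?V - ?Z) id (local_class V1 Z1)) = index V1 Z1 f"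
    unfolding index_def using assms by (subst hi_comp) auto
  also have "hi ?V (?V - ?Z) UNIV (UNIV - {0}) f (hi V2 (V2 - Z2) ?V (?V - ?Z) id (local_class V2 Z2)) = index V2 Z2 f"
    unfolding index_def using assms by (subst hi_comp) auto
  finally show ?thesis .
qed

text \<open>The closed ball of radius \<open>norm a\<close> contains the zeros of all translations
  between \<open>x - a\<close> and the identity. So the zero can be moved to the origin, and for the
  identity the index is the orientation class itself.\<close>

lemma index_translation:
  assumes "open V" "a \<in> V"
  shows "index V {a} (\<lambda>x. x - a) = oc {0}"
proof -
  let ?B = "cball (0::'a) (norm a)"
  have "index V {a} (\<lambda>x. x - a) = index UNIV ?B (\<lambda>x. x - a)"
    using assms by (intro index_mono[symmetric]) (auto intro!: continuous_intros)
  also have "\<dots> = index UNIV ?B (\<lambda>x. x)"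
  proof -
    have "index UNIV ?B (\<lambda>x. (\<lambda>(s, x). x - (1 - s) *\<^sub>R a) (0, x))
        = index UNIV ?B (\<lambda>x. (\<lambda>(s, x). x - (1 - s) *\<^sub>R a) (1, x))"
    proof (rule index_homotopy)
      show "continuous_on ({0..1} \<times> UNIV) (\<lambda>(s, x). x - (1 - s) *\<^sub>R a)"
        by (auto simp: case_prod_unfold intro!: continuous_intros)
      fix s :: real and x :: 'a
      assume s: "0 \<le> s" "s \<le> 1" and x: "x \<in> UNIV - ?B"
      have "norm ((1 - s) *\<^sub>R a) \<le> norm a" using s by (simp add: mult_left_le_one_le)
      then show "(\<lambda>(s, x). x - (1 - s) *\<^sub>R a) (s, x) \<noteq> 0" using x by auto
    qed
    then show ?thesis by simp
  qed
  also have "\<dots> = oc {0}"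
  proof -
    have "local_class UNIV ?B = oc ?B"
      using local_class_unique[of UNIV ?B "oc ?B"] oc_carrier[of ?B] oc_mono'[of ?B ?B]
      by (simp add: Compl_eq_Diff_UNIV)
    then show ?thesis
      using oc_mono'[of ?B "{0}"] by (simp add: index_def id_def)
  qed
  finally show ?thesis .
qed

lemma index_compose:
  assumes "continuous_on V f" "\<And>x. x \<in> V - Z \<Longrightarrow> f x \<noteq> 0"
    "continuous_on UNIV D" "\<And>x. x \<noteq> 0 \<Longrightarrow> D x \<noteq> 0"
  shows "index V Z (\<lambda>x. D (f x)) = hi UNIV (UNIV - {0}) UNIV (UNIV - {0}) D (index V Z f)"
  unfolding index_def using assms by (subst hi_comp) (auto simp: o_def)

end

text \<open>By compactness of the unit sphere the pairing has a quadratic lower bound, which beats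
  the error of linearisation. The conclusion says that near its zero \<open>f\<close> never points
  opposite to \<open>D (y - x)\<close>, so a linear homotopy joins the two without creating
  zeros.\<close>

lemma derivative_positive_pairing:
  fixes f :: "'b::euclidean_space \<Rightarrow> 'b"
  assumes f: "(f has_derivative L) (at x)" and fx: "f x = 0" and D: "linear D"
    and pos: "\<And>v. v \<noteq> 0 \<Longrightarrow> 0 < L v \<bullet> D v"
  obtains \<delta> where "\<delta> > 0" "\<And>y. \<lbrakk>y \<noteq> x; norm (y - x) < \<delta>\<rbrakk> \<Longrightarrow> 0 < f y \<bullet> D (y - x)"
proof -
  have bL: "bounded_linear L" and bD: "bounded_linear D"
    using f D by (auto simp: has_derivative_def linear_conv_bounded_linear)
  have contLD: "continuous_on S (\<lambda>v. L v \<bullet> D v)" for S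
    using bL bD by (intro continuous_intros linear_continuous_on)
  have "\<exists>m>0. \<forall>v. m * (norm v)\<^sup>2 \<le> L v \<bullet> D v"
  proof -
    obtain v0 where v0: "v0 \<in> sphere (0::'b) 1" "\<And>v. v \<in> sphere 0 1 \<Longrightarrow> L v0 \<bullet> D v0 \<le> L v \<bullet> D v"
    proof -
      have "sphere (0::'b) 1 \<noteq> {}" by simp
      then show thesis
        using continuous_attains_inf[OF compact_sphere _ contLD, of "0::'b" 1] that by blast
    qed
    have "L v0 \<bullet> D v0 * (norm v)\<^sup>2 \<le> L v \<bullet> D v" for v
    proof (cases "v = 0")
      case True
      then show ?thesis using bL bD by (simp add: linear_simps)
    next
      case False
      then have "L v0 \<bullet> D v0 \<le> L (v /\<^sub>R norm v) \<bullet> D (v /\<^sub>R norm v)" by (intro v0) simp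
      also have "\<dots> = (L v \<bullet> D v) / (norm v)\<^sup>2"
        using bL bD by (simp add: linear_simps power2_eq_square divide_inverse)
      finally show ?thesis using False by (simp add: field_simps)
    qed
    moreover have "0 < L v0 \<bullet> D v0" using v0(1) by (intro pos) auto
    ultimately show ?thesis by blast
  qed
  then obtain m where m: "m > 0" "\<And>v. m * (norm v)\<^sup>2 \<le> L v \<bullet> D v" by blast
  obtain B where B: "B > 0" "\<And>v. norm (D v) \<le> norm v * B"
    using bounded_linear.pos_bounded[OF bD] by blast
  \<comment> \<open>With this tolerance the error, paired with \<open>D\<close>, costs at most half
    of the lower bound \<open>m\<close>.\<close>
  have "m / (2 * B) > 0" using m B by simp
  then obtain \<delta> where \<delta>: "\<delta> > 0"
    "\<And>y. norm (y - x) < \<delta> \<Longrightarrow> norm (f y - f x - L (y - x)) \<le> m / (2 * B) * norm (y - x)"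
    using f unfolding has_derivative_at_alt by blast
  show thesis
  proof (rule that[OF \<delta>(1)])
    fix y assume y: "y \<noteq> x" "norm (y - x) < \<delta>"
    let ?v = "y - x"
    have "\<bar>(f y - L ?v) \<bullet> D ?v\<bar> \<le> norm (f y - L ?v) * norm (D ?v)" by (rule Cauchy_Schwarz_ineq2)
    also have "\<dots> \<le> (m / (2 * B) * norm ?v) * (norm ?v * B)"
      using \<delta>(2)[OF y(2)] B(2)[of ?v] fx m(1) B(1) by (intro mult_mono) auto
    also have "\<dots> = m / 2 * (norm ?v)\<^sup>2" using B by (simp add: power2_eq_square)
    finally have "f y \<bullet> D ?v \<ge> L ?v \<bullet> D ?v - m / 2 * (norm ?v)\<^sup>2"
      unfolding inner_diff_left by linarith
    moreover have "m / 2 * (norm ?v)\<^sup>2 < m * (norm ?v)\<^sup>2" using m y by simp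
    ultimately show "0 < f y \<bullet> D ?v" using m(2)[of ?v] by linarith
  qed
qed

section \<open>Index change along a branch of zeros\<close>

text \<open>\<open>K\<close> is the enclosing set and \<open>R\<close> holds the zeros that are to
  be ignored; \<open>R\<close> is relatively closed, so that it can be removed from the domain.
  \<open>K\<close> may contain points of the branch, but only over the open interval.\<close>

locale isolated_branch = fundamental p oc
  for p :: int and oc :: "('b::euclidean_space \<times> real) set \<Rightarrow> ('b \<times> real) chain set" +
  fixes F :: "'b \<times> real \<Rightarrow> 'b" and w :: "real \<Rightarrow> 'b" and U :: "('b \<times> real) set"
    and I :: "real set" and K R :: "('b \<times> real) set" and a b :: real
  assumes openU: "open U" and contF: "continuous_on U F" and UI: "U \<subseteq> UNIV \<times> I"
    and contw: "continuous_on I w" and wU: "t \<in> I \<Longrightarrow> (w t, t) \<in> U" and Fw: "t \<in> I \<Longrightarrow> F (w t, t) = 0"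
    and ab: "a < b" "{a..b} \<subseteq> I"
    and K: "compact K" "K \<subseteq> U" and R: "closedin (top_of_set U) R" and KR: "K \<inter> R = {}"
    and zeros: "\<lbrakk>z \<in> U; F z = 0\<rbrakk> \<Longrightarrow> z \<in> K \<union> R \<or> fst z = w (snd z)"
    and Kw: "\<lbrakk>t \<in> I; (w t, t) \<in> K\<rbrakk> \<Longrightarrow> a < t \<and> t < b"
    and Rw: "t \<in> {a..b} \<Longrightarrow> (w t, t) \<notin> R"
begin

definition "N = U - R"
definition "zero_set = K \<union> (\<lambda>t. (w t, t)) ` {a..b}"
definition "G s z = (F z, snd z - s)"

lemma openN: "open N"
proof -
  obtain C where "closed C" "R = U \<inter> C" using R by (auto simp: closedin_closed)
  then have "N = U - C" unfolding N_def by blast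
  then show ?thesis using openU \<open>closed C\<close> by auto
qed

lemma compact_zero_set: "compact zero_set"
  unfolding zero_set_def using K contw ab
  by (intro compact_Un compact_continuous_image continuous_intros) (auto intro: continuous_on_subset)

lemma zero_set_sub: "zero_set \<subseteq> N"
  using K KR wU ab Rw by (auto simp: zero_set_def N_def)

lemma contG: "V \<subseteq> U \<Longrightarrow> continuous_on V (G s)"
  unfolding G_def by (intro continuous_intros continuous_on_subset[OF contF])

lemma cont_hom:
  assumes "V \<subseteq> U"
  shows "continuous_on ({0..1} \<times> V) (\<lambda>x. G ((1 - fst x) * c + fst x * d) (snd x))"
  unfolding G_def using assms
  by (intro continuous_intros continuous_on_compose2[OF contF]) auto

lemma G_zero:
  assumes "z \<in> N" "G s z = 0"
  shows "F z = 0" "snd z = s" "z \<in> K \<or> z = (w s, s)"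
  using assms zeros[of z] by (auto simp: G_def N_def zero_prod_def prod_eq_iff)

text \<open>At every level between \<open>a\<close> and \<open>b\<close> the zeros of
  \<open>G\<close> in \<open>N\<close> lie in \<open>zero_set\<close>, so moving the level is an
  admissible homotopy.\<close>

lemma index_const: "index N zero_set (G a) = index N zero_set (G b)"
proof -
  let ?h = "\<lambda>x. G ((1 - fst x) * a + fst x * b) (snd x)"
  have "index N zero_set (\<lambda>x. ?h (0, x)) = index N zero_set (\<lambda>x. ?h (1, x))"
  proof (rule index_homotopy)
    show "continuous_on ({0..1} \<times> N) ?h"
      by (rule cont_hom) (auto simp: N_def)
    fix s :: real and z :: "'b \<times> real" assume s: "0 \<le> s" "s \<le> 1" and z: "z \<in> N - zero_set"
    define t where "t = (1 - s) * a + s * b"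
    have "t \<in> closed_segment a b" using s by (auto simp: t_def closed_segment_def)
    then have "t \<in> {a..b}" using ab by (simp add: closed_segment_eq_real_ivl)
    then show "?h (s, z) \<noteq> 0" using G_zero[of z t] z by (auto simp: zero_set_def t_def)
  qed
  then show ?thesis by simp
qed

text \<open>For \<open>\<sigma>\<close> equal to 1 or -1 this is the part of the branch on one side
  of level \<open>c\<close>. Its closedness allows \<open>index_end\<close> to delete it from the
  domain.\<close>

lemma closedin_half_branch:
  "closedin (top_of_set U) {z \<in> U. fst z = w (snd z) \<and> 0 \<le> \<sigma> * (snd z - c)}"
proof -
  have cw: "continuous_on U (\<lambda>z. fst z - w (snd z))"
    using UI by (intro continuous_intros continuous_on_compose2[OF contw]) auto
  have "closedin (top_of_set U) (U \<inter> (\<lambda>z. fst z - w (snd z)) -` {0})"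
    using cw by (intro continuous_closedin_preimage) auto
  moreover have "closedin (top_of_set U) (U \<inter> (\<lambda>z. \<sigma> * (snd z - c)) -` {0..})"
    by (intro continuous_closedin_preimage continuous_intros closed_atLeast)
  ultimately have "closedin (top_of_set U)
      ((U \<inter> (\<lambda>z. fst z - w (snd z)) -` {0}) \<inter> (U \<inter> (\<lambda>z. \<sigma> * (snd z - c)) -` {0..}))"
    by (rule closedin_Int)
  also have "(U \<inter> (\<lambda>z. fst z - w (snd z)) -` {0}) \<inter> (U \<inter> (\<lambda>z. \<sigma> * (snd z - c)) -` {0..})
     = {z \<in> U. fst z = w (snd z) \<and> 0 \<le> \<sigma> * (snd z - c)}" by auto
  finally show ?thesis .
qed

text \<open>At an end level the zeros are the branch point \<open>zc\<close> and some points of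
  \<open>K\<close> off the branch. The latter contribute nothing: once the outer half of the branch
  is cut away, the level can be moved outward, in direction \<open>\<sigma>\<close>, past all of
  \<open>K\<close>. At \<open>zc\<close> the index is that of the linear map.\<close>

lemma index_end:
  assumes c: "c \<in> {a..b}" and \<sigma>: "\<bar>\<sigma>\<bar> = 1"
    and side: "\<And>t. \<lbrakk>t \<in> I; (w t, t) \<in> K\<rbrakk> \<Longrightarrow> \<sigma> * (t - c) < 0"
    and L: "((\<lambda>x. F (x, c)) has_derivative L) (at (w c))" and D: "linear D"
    and pos: "\<And>v. v \<noteq> 0 \<Longrightarrow> 0 < L v \<bullet> D v"
  shows "index N zero_set (G c) = hi UNIV (UNIV - {0}) UNIV (UNIV - {0}) (map_prod D id) (oc {0})"
proof -
  define zc where "zc = (w c, c)"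
  have cI: "c \<in> I" using c ab by auto
  have zcN: "zc \<in> N" and zcK: "zc \<notin> K"
    using wU[OF cI] Rw[OF c] side[OF cI] by (auto simp: zc_def N_def)
  obtain \<delta> where \<delta>: "\<delta> > 0" "\<And>y. \<lbrakk>y \<noteq> w c; norm (y - w c) < \<delta>\<rbrakk> \<Longrightarrow> 0 < F (y, c) \<bullet> D (y - w c)"
    using derivative_positive_pairing[OF L _ D pos] Fw[OF cI] by auto
  have "open (N - K)" using openN K compact_imp_closed by (intro open_Diff) auto
  then obtain \<epsilon>0 where \<epsilon>0: "\<epsilon>0 > 0" "cball zc \<epsilon>0 \<subseteq> N - K"
    using zcN zcK open_contains_cball by (metis DiffI)
  define \<epsilon> where "\<epsilon> = min \<epsilon>0 \<delta>"
  have \<epsilon>: "\<epsilon> > 0" "\<epsilon> \<le> \<delta>" and ball: "cball zc \<epsilon> \<subseteq> N - K"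
    using \<epsilon>0 \<delta>(1) by (auto simp: \<epsilon>_def intro: order_trans[OF subset_cball])
  define V1 where "V1 = ball zc \<epsilon>"
  \<comment> \<open>Deleting \<open>T2\<close> ensures that a level moving outward from
    \<open>c\<close> meets no branch point in \<open>V2\<close>; deleting the closed ball separates
    \<open>V2\<close> from \<open>V1\<close>.\<close>
  define T2 where "T2 = {z \<in> U. fst z = w (snd z) \<and> 0 \<le> \<sigma> * (snd z - c)}"
  define K2 where "K2 = K \<inter> {z. 0 \<le> \<sigma> * (snd z - c)}"
  define V2 where "V2 = N - cball zc \<epsilon> - T2"
  have cK2: "compact K2" unfolding K2_def
    by (intro compact_Int_closed K closed_Collect_le continuous_intros)
  have oV1: "open V1" by (simp add: V1_def)
  have oV2: "open V2"
  proof -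
    obtain C where "closed C" "T2 = U \<inter> C"
      using closedin_half_branch[of \<sigma> c] by (auto simp: closedin_closed T2_def)
    then have "V2 = N - cball zc \<epsilon> - C" unfolding V2_def N_def by blast
    then show ?thesis using openN \<open>closed C\<close> by (auto intro!: open_Diff)
  qed
  have K2V2: "K2 \<subseteq> V2"
  proof
    fix z assume z: "z \<in> K2"
    then have zK: "z \<in> K" "0 \<le> \<sigma> * (snd z - c)" by (auto simp: K2_def)
    then have "z \<in> N" using K KR by (auto simp: N_def)
    moreover have "z \<notin> cball zc \<epsilon>" using ball zK by auto
    moreover have "z \<notin> T2"
    proof
      assume "z \<in> T2"
      then have "z = (w (snd z), snd z)" "snd z \<in> I" using UI by (auto simp: T2_def prod_eq_iff)
      then show False using side[of "snd z"] zK by auto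
    qed
    ultimately show "z \<in> V2" by (auto simp: V2_def)
  qed
  have V2N: "V2 \<subseteq> N" and NU: "N \<subseteq> U" by (auto simp: V2_def N_def)
  have V1N: "V1 \<subseteq> N" using ball ball_subset_cball[of zc \<epsilon>] unfolding V1_def by blast
  have V12: "V1 \<inter> V2 = {}" by (auto simp: V1_def V2_def)
  have zcV1: "zc \<in> V1" using \<epsilon> by (simp add: V1_def)
  have Gz: "z = zc \<or> z \<in> K2" if "z \<in> N" "G c z = 0" for z
    using G_zero[OF that] by (auto simp: K2_def zc_def)
  have "index N zero_set (G c) = index (V1 \<union> V2) ({zc} \<union> K2) (G c)"
  proof (rule index_mono)
    show "open (V1 \<union> V2)" using oV1 oV2 by (rule open_Un)
    show "compact ({zc} \<union> K2)" using cK2 by auto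
    show "{zc} \<union> K2 \<subseteq> V1 \<union> V2" "V1 \<union> V2 \<subseteq> N" using zcV1 K2V2 V1N V2N by auto
    show "{zc} \<union> K2 \<subseteq> zero_set" using c by (auto simp: zero_set_def K2_def zc_def)
    show "G c z \<noteq> 0" if "z \<in> N - ({zc} \<union> K2)" for z using Gz that by blast
  qed (use openN compact_zero_set zero_set_sub NU in \<open>auto intro: contG\<close>)
  also have "\<dots> = index V1 {zc} (G c) \<otimes>\<^bsub>RH UNIV (UNIV - {0})\<^esub> index V2 K2 (G c)"
  proof (rule index_add)
    show "G c z \<noteq> 0" if "z \<in> V1 \<union> V2 - ({zc} \<union> K2)" for z using Gz that V1N V2N by blast
    show "continuous_on (V1 \<union> V2) (G c)" using V1N V2N NU by (intro contG) auto
  qed (use oV1 oV2 V12 cK2 zcV1 K2V2 in auto)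
  also have "index V2 K2 (G c) = \<one>\<^bsub>RH UNIV (UNIV - {0})\<^esub>"
  proof -
    obtain M where M: "M > 0" "\<And>z. z \<in> K \<Longrightarrow> norm (snd z) \<le> M"
    proof -
      have "bounded (snd ` K)" using K compact_imp_bounded bounded_snd by blast
      then show thesis using that by (auto simp: bounded_pos)
    qed
    \<comment> \<open>A level on the outer side of \<open>c\<close> whose absolute value exceeds
      every parameter that occurs in \<open>K\<close>.\<close>
    define d where "d = c + \<sigma> * (M + \<bar>c\<bar> + 1)"
    have d: "\<bar>d\<bar> > M" using \<sigma> M by (auto simp: d_def abs_if split: if_splits)
    have key: "z \<in> K2" if z: "z \<in> V2" "G ((1 - s) * c + s * d) z = 0" "0 \<le> s" for z s
    proof -
      define t where "t = (1 - s) * c + s * d"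
      have "\<sigma> * (t - c) = s * (M + \<bar>c\<bar> + 1) * (\<sigma> * \<sigma>)" by (simp add: t_def d_def algebra_simps)
      also have "\<sigma> * \<sigma> = 1" using \<sigma> by (auto simp: abs_if split: if_splits)
      finally have st: "0 \<le> \<sigma> * (t - c)" using M z by simp
      have zN: "z \<in> N" and zT: "z \<notin> T2" using z by (auto simp: V2_def)
      have *: "snd z = t" "z \<in> K \<or> z = (w t, t)" using G_zero[OF zN, of t] z by (auto simp: t_def)
      have "z \<noteq> (w t, t)" using zT zN NU st by (auto simp: T2_def)
      then show ?thesis using * st by (auto simp: K2_def)
    qed
    let ?h = "\<lambda>x. G ((1 - fst x) * c + fst x * d) (snd x)"
    have "index V2 K2 (\<lambda>x. ?h (0, x)) = index V2 K2 (\<lambda>x. ?h (1, x))"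
    proof (rule index_homotopy)
      show "continuous_on ({0..1} \<times> V2) ?h" using V2N NU by (intro cont_hom) auto
    qed (use key in auto)
    then have "index V2 K2 (G c) = index V2 K2 (G d)" by simp
    also have "\<dots> = \<one>\<^bsub>RH UNIV (UNIV - {0})\<^esub>"
    proof (rule index_no_zero[OF oV2 cK2 K2V2])
      show "continuous_on V2 (G d)" using V2N NU by (intro contG) auto
      fix z assume z: "z \<in> V2"
      show "G d z \<noteq> 0"
      proof
        assume G: "G d z = 0"
        then have "z \<in> K" "snd z = d" using key[OF z, of 1] by (auto simp: K2_def G_def zero_prod_def)
        then show False using M(2)[of z] d by auto
      qed
    qed
    finally show ?thesis .
  qed
  also have "index V1 {zc} (G c) \<otimes>\<^bsub>RH UNIV (UNIV - {0})\<^esub> \<one>\<^bsub>RH UNIV (UNIV - {0})\<^esub> = index V1 {zc} (G c)"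
    by (rule monoid.r_one[OF group.is_monoid[OF group_relative_homology_group] index_carrier])
  also have "\<dots> = index V1 {zc} (\<lambda>z. map_prod D id (z - zc))"
  proof -
    \<comment> \<open>A zero of the homotopy must have parameter \<open>c\<close>; there both of its
      ends have positive inner product with \<open>D (x - w c)\<close>.\<close>
    let ?h = "\<lambda>x. ((1 - fst x) *\<^sub>R F (snd x) + fst x *\<^sub>R D (fst (snd x) - w c), snd (snd x) - c)"
    have contD: "continuous_on S D" for S
      using D linear_continuous_on linear_conv_bounded_linear by blast
    have "index V1 {zc} (\<lambda>x. ?h (0, x)) = index V1 {zc} (\<lambda>x. ?h (1, x))"
    proof (rule index_homotopy)
      show "continuous_on ({0..1} \<times> V1) ?h"
        using V1N NU by (intro continuous_intros continuous_on_compose2[OF contF] continuous_on_compose2[OF contD]) auto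
      fix s :: real and z :: "'b \<times> real" assume s: "0 \<le> s" "s \<le> 1" and z: "z \<in> V1 - {zc}"
      show "?h (s, z) \<noteq> 0"
      proof
        assume h: "?h (s, z) = 0"
        define x where "x = fst z"
        have zx: "z = (x, c)" using h by (auto simp: zero_prod_def x_def prod_eq_iff)
        then have xw: "x \<noteq> w c" using z by (auto simp: zc_def)
        have "norm (x - w c) < \<epsilon>"
          using z zx by (auto simp: V1_def zc_def dist_Pair_Pair dist_norm norm_minus_commute)
        then have p1: "0 < F z \<bullet> D (x - w c)" using \<delta>(2)[OF xw] \<epsilon> zx by auto
        then have p2: "0 < D (x - w c) \<bullet> D (x - w c)" by auto
        have "0 = ((1 - s) *\<^sub>R F z + s *\<^sub>R D (x - w c)) \<bullet> D (x - w c)"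
          using h by (simp add: zero_prod_def x_def)
        also have "\<dots> = (1 - s) * (F z \<bullet> D (x - w c)) + s * (D (x - w c) \<bullet> D (x - w c))"
          by (simp add: inner_add_left)
        also have "\<dots> > 0"
        proof (cases "s = 0")
          case False
          then show ?thesis using s p1 p2 by (intro add_nonneg_pos mult_nonneg_nonneg mult_pos_pos) auto
        qed (use p1 in simp)
        finally show False by simp
      qed
    qed
    moreover have "(\<lambda>x. ?h (0, x)) = G c" by (auto simp: G_def)
    moreover have "(\<lambda>x. ?h (1, x)) = (\<lambda>z. map_prod D id (z - zc))" by (auto simp: zc_def map_prod_def case_prod_unfold)
    ultimately show ?thesis by simp
  qed
  also have "\<dots> = hi UNIV (UNIV - {0}) UNIV (UNIV - {0}) (map_prod D id) (index V1 {zc} (\<lambda>z. z - zc))"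
  proof (rule index_compose)
    have "D v \<noteq> 0" if "v \<noteq> 0" for v using pos[OF that] by auto
    then show "map_prod D id z \<noteq> 0" if "z \<noteq> 0" for z
      using that D by (cases z) (auto simp: zero_prod_def linear_0)
    show "continuous_on UNIV (map_prod D id)"
      unfolding map_prod_def case_prod_unfold id_def using D linear_conv_bounded_linear
      by (intro continuous_intros continuous_on_compose2[OF linear_continuous_on[of D]]) auto
  qed (auto intro!: continuous_intros)
  also have "index V1 {zc} (\<lambda>z. z - zc) = oc {0}" by (rule index_translation[OF oV1 zcV1])
  finally show ?thesis .
qed

lemma index_at_ends:
  assumes "((\<lambda>x. F (x, a)) has_derivative La) (at (w a))" "linear Da" "\<And>v. v \<noteq> 0 \<Longrightarrow> 0 < La v \<bullet> Da v"
    and "((\<lambda>x. F (x, b)) has_derivative Lb) (at (w b))" "linear Db" "\<And>v. v \<noteq> 0 \<Longrightarrow> 0 < Lb v \<bullet> Db v"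
  shows "hi UNIV (UNIV - {0}) UNIV (UNIV - {0}) (map_prod Da id) (oc {0})
       = hi UNIV (UNIV - {0}) UNIV (UNIV - {0}) (map_prod Db id) (oc {0})"
proof -
  have "index N zero_set (G a) = hi UNIV (UNIV - {0}) UNIV (UNIV - {0}) (map_prod Da id) (oc {0})"
  proof (rule index_end[where \<sigma> = "-1" and c = a and L = La and D = Da])
    show "- 1 * (t - a) < 0" if "t \<in> I" "(w t, t) \<in> K" for t using Kw[OF that] by simp
    show "a \<in> {a..b}" using ab by simp
  qed (use assms in simp_all)
  moreover have "index N zero_set (G b) = hi UNIV (UNIV - {0}) UNIV (UNIV - {0}) (map_prod Db id) (oc {0})"
  proof (rule index_end[where \<sigma> = 1 and c = b and L = Lb and D = Db])
    show "1 * (t - b) < 0" if "t \<in> I" "(w t, t) \<in> K" for t using Kw[OF that] by simp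
    show "b \<in> {a..b}" using ab by simp
  qed (use assms in simp_all)
  ultimately show ?thesis using index_const by simp
qed

end

text \<open>Equality of the two end indices says that \<open>D\<close> and \<open>D\<close> after
  \<open>reflect u\<close> have the same effect on the orientation class. \<open>D\<close> is its
  own inverse and can be cancelled, so the reflection would fix that class.\<close>

theorem branch_index_change:
  fixes F :: "'b::euclidean_space \<times> real \<Rightarrow> 'b"
  assumes U: "open U" "continuous_on U F" "U \<subseteq> UNIV \<times> I"
    and w: "continuous_on I w" "\<And>t. t \<in> I \<Longrightarrow> (w t, t) \<in> U" "\<And>t. t \<in> I \<Longrightarrow> F (w t, t) = 0"
    and ab: "a < b" "{a..b} \<subseteq> I"
    and K: "compact K" "K \<subseteq> U" and R: "closedin (top_of_set U) R" and KR: "K \<inter> R = {}"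
    and zeros: "\<And>z. \<lbrakk>z \<in> U; F z = 0\<rbrakk> \<Longrightarrow> z \<in> K \<union> R \<or> fst z = w (snd z)"
    and Kw: "\<And>t. \<lbrakk>t \<in> I; (w t, t) \<in> K\<rbrakk> \<Longrightarrow> a < t \<and> t < b"
    and Rw: "\<And>t. t \<in> {a..b} \<Longrightarrow> (w t, t) \<notin> R"
    and La: "((\<lambda>x. F (x, a)) has_derivative La) (at (w a))" "\<And>v. v \<noteq> 0 \<Longrightarrow> 0 < La v \<bullet> D v"
    and Lb: "((\<lambda>x. F (x, b)) has_derivative Lb) (at (w b))" "\<And>v. v \<noteq> 0 \<Longrightarrow> 0 < Lb v \<bullet> D (reflect u v)"
    and D: "linear D" "\<And>v. D (D v) = v" and u: "u \<in> Basis"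
  shows False
proof -
  have u': "(u, 0::real) \<in> Basis" using u by (auto simp: Basis_prod_def)
  obtain p :: int and oc :: "('b \<times> real) set \<Rightarrow> ('b \<times> real) chain set" where
    oc: "\<And>Z. bounded Z \<Longrightarrow> oc Z \<in> carrier (relative_homology_group p euclidean (- Z))"
    "\<And>Z Z'. \<lbrakk>bounded Z; Z' \<subseteq> Z\<rbrakk> \<Longrightarrow> hom_induced p euclidean (- Z) euclidean (- Z') id (oc Z) = oc Z'"
    and oc_refl: "hom_induced p euclidean (- {0}) euclidean (- {0}) (reflect (u, 0)) (oc {0}) \<noteq> oc {0}"
    by (rule fundamental_classes[OF u']) (rule that; assumption)
  interpret isolated_branch p oc F w U I K R a b
  proof unfold_locales
    show "oc Z \<in> carrier (relative_homology_group p euclidean (- Z))" if "bounded Z" for Z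
      using oc(1) that .
    show "hom_induced p euclidean (- Z) euclidean (- Z') id (oc Z) = oc Z'" if "bounded Z" "Z' \<subseteq> Z" for Z Z'
      using oc(2) that .
  qed (fact U w ab K R KR | erule (1) zeros Kw | erule Rw w(2) w(3))+
  have lin2: "linear (\<lambda>v. D (reflect u v))" using linear_compose[OF linear_reflect D(1)] by (simp add: o_def)
  let ?h = "hi UNIV (UNIV - {0}) UNIV (UNIV - {0})"
  let ?D = "map_prod D id :: 'b \<times> real \<Rightarrow> 'b \<times> real"
  have contD: "continuous_on UNIV ?D"
    unfolding map_prod_def case_prod_unfold id_def using D(1) linear_conv_bounded_linear
    by (intro continuous_intros continuous_on_compose2[OF linear_continuous_on[of D]]) auto
  have contr: "continuous_on UNIV (reflect (u, 0::real))"
    unfolding reflect_def by (intro continuous_intros)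
  have D0: "?D \<in> UNIV - {0} \<rightarrow> UNIV - {0}"
    using D(2) linear_0[OF D(1)] by (auto simp: zero_prod_def) metis
  have uu: "u \<bullet> u = 1" using u by simp
  have r0: "reflect (u, 0::real) \<in> UNIV - {0} \<rightarrow> UNIV - {0}"
  proof -
    have rr: "reflect (u, 0::real) (reflect (u, 0) z) = z" for z
      by (cases z) (simp add: reflect_def inner_diff_left uu algebra_simps)
    have "reflect (u, 0::real) 0 = 0" by (simp add: reflect_def zero_prod_def)
    then show ?thesis using rr by (auto; metis)
  qed
  have split: "map_prod (\<lambda>v. D (reflect u v)) id = ?D \<circ> reflect (u, 0::real)"
    by (rule ext) (auto simp: reflect_def)
  have DD: "?D \<circ> ?D = id" by (rule ext) (auto simp: D(2))
  have "?h ?D (oc {0}) = ?h (map_prod (\<lambda>v. D (reflect u v)) id) (oc {0})"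
    by (rule index_at_ends[OF La(1) D(1) La(2) Lb(1) lin2 Lb(2)])
  also have "\<dots> = ?h ?D (?h (reflect (u, 0)) (oc {0}))"
    unfolding split using contD contr D0 r0 by (subst hi_comp) auto
  finally have "?h ?D (?h ?D (oc {0})) = ?h ?D (?h ?D (?h (reflect (u, 0)) (oc {0})))" by simp
  moreover have "?h ?D (?h ?D c) = c" if "c \<in> carrier (RH UNIV (UNIV - {0}))" for c
  proof -
    have "?h ?D (?h ?D c) = ?h (?D \<circ> ?D) c"
      using contD D0 by (intro hi_comp) auto
    also have "\<dots> = c" unfolding DD by (rule hom_induced_id[OF that])
    finally show ?thesis .
  qed
  moreover have "oc {0} \<in> carrier (RH UNIV (UNIV - {0}))"
    using oc_carrier[of "{0}"] by (simp add: Compl_eq_Diff_UNIV)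
  ultimately have "oc {0} = ?h (reflect (u, 0)) (oc {0})" by (metis hi_carrier)
  then show False using oc_refl by (simp add: Compl_eq_Diff_UNIV)
qed

section \<open>Gradient and Hessian of the potential\<close>

lemma UNIV_8: "(UNIV :: 8 set) = {1, 2, 3, 4, 5, 6, 7, 8}"
  using exhaust_8 by auto

lemma sum_8: "sum f (UNIV :: 8 set) = f 1 + f 2 + f 3 + f 4 + f 5 + f 6 + f 7 + f 8"
  unfolding UNIV_8 by (simp add: ac_simps)

lemma forall_8: "(\<forall>i::8. P i) \<longleftrightarrow> P 1 \<and> P 2 \<and> P 3 \<and> P 4 \<and> P 5 \<and> P 6 \<and> P 7 \<and> P 8"
  by (metis exhaust_8)

text \<open>The Kepler force, minus the gradient of \<open>1 / norm x\<close>. It is 0 at the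
  origin, so the diagonal terms of the double sums below may stay.\<close>

definition kep :: "'a::real_inner \<Rightarrow> 'a" where
  "kep x = (1 / norm x ^ 3) *\<^sub>R x"

definition dkep :: "'a::real_inner \<Rightarrow> 'a \<Rightarrow> 'a" where
  "dkep x h = (1 / norm x ^ 3) *\<^sub>R h - (3 * (x \<bullet> h) / norm x ^ 5) *\<^sub>R x"

lemma has_derivative_inv_norm:
  fixes x :: "'a::real_inner"
  assumes "x \<noteq> 0"
  shows "((\<lambda>x. 1 / norm x) has_derivative (\<lambda>h. - (x \<bullet> h) / norm x ^ 3)) (at x)"
  apply (rule has_derivative_eq_rhs)
   apply (rule derivative_eq_intros refl has_derivative_norm assms | simp add: assms)+
  apply (auto simp: fun_eq_iff sgn_div_norm inner_commute divide_simps power3_eq_cube assms)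
  done

lemma has_derivative_kep:
  fixes x :: "'a::real_inner"
  assumes "x \<noteq> 0"
  shows "(kep has_derivative dkep x) (at x)"
proof -
  have "((\<lambda>x. ((1 / norm x) ^ 3) *\<^sub>R x) has_derivative
     (\<lambda>h. ((1 / norm x) ^ 3) *\<^sub>R h + (3 * (1 / norm x) ^ 2 * (- (x \<bullet> h) / norm x ^ 3)) *\<^sub>R x)) (at x)"
    by (rule has_derivative_eq_rhs[OF has_derivative_scaleR[OF has_derivative_power[OF
          has_derivative_inv_norm[OF assms], of 3] has_derivative_ident]]) (simp add: fun_eq_iff)
  moreover have "(\<lambda>h. ((1 / norm x) ^ 3) *\<^sub>R h + (3 * (1 / norm x) ^ 2 * (- (x \<bullet> h) / norm x ^ 3)) *\<^sub>R x) = dkep x"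
    using assms by (auto simp: fun_eq_iff dkep_def power_divide field_simps numeral_eq_Suc)
  moreover have "(\<lambda>x. ((1 / norm x) ^ 3) *\<^sub>R x) = kep"
    by (auto simp: fun_eq_iff kep_def power_divide)
  ultimately show ?thesis by metis
qed

lemma kep_minus: "kep (- x) = - kep x"
  by (simp add: kep_def)

definition grad :: "real^8 \<Rightarrow> real \<Rightarrow> real^2^8 \<Rightarrow> real^2^8" where
  "grad m l q = (\<chi> i. (l * m $ i) *\<^sub>R q $ i - (\<Sum>j\<in>UNIV. (m $ i * m $ j) *\<^sub>R kep (q $ i - q $ j)))"

definition hess :: "real^8 \<Rightarrow> real \<Rightarrow> real^2^8 \<Rightarrow> real^2^8 \<Rightarrow> real^2^8" where
  "hess m l q h = (\<chi> i. (l * m $ i) *\<^sub>R h $ i - (\<Sum>j\<in>UNIV. (m $ i * m $ j) *\<^sub>R dkep (q $ i - q $ j) (h $ i - h $ j)))"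

lemma OmegaD: "q \<in> Omega \<Longrightarrow> i \<noteq> j \<Longrightarrow> q $ i - q $ j \<noteq> 0"
  by (auto simp: Omega_def)

lemma has_derivative_grad:
  assumes "q \<in> Omega"
  shows "(grad m l has_derivative hess m l q) (at q)"
proof -
  have kd: "((\<lambda>q. kep (q $ i - q $ j)) has_derivative (\<lambda>h. dkep (q $ i - q $ j) (h $ i - h $ j))) (at q)" for i j
  proof (cases "i = j")
    case True
    then show ?thesis by (simp add: dkep_def)
  next
    case False
    have "((\<lambda>q. q $ i - q $ j) has_derivative (\<lambda>h. h $ i - h $ j)) (at q)"
      by (intro has_derivative_diff bounded_linear_imp_has_derivative bounded_linear_vec_nth)
    from diff_chain_at[OF this has_derivative_kep[OF OmegaD[OF assms False]]]
    show ?thesis by (simp add: o_def)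
  qed
  have vn: "((\<lambda>q. q $ i) has_derivative (\<lambda>h. h $ i)) (at q)" for i and q :: "real^2^8"
    by (rule bounded_linear_imp_has_derivative[OF bounded_linear_vec_nth])
  have vec: "((\<lambda>x. \<chi> i. f i x) has_derivative (\<lambda>h. \<chi> i. f' i h)) (at q)"
    if "\<And>i. (f i has_derivative f' i) (at q)" for f f' :: "8 \<Rightarrow> real^2^8 \<Rightarrow> real^2"
  proof -
    have eq: "(\<chi> i. g i) = (\<Sum>i\<in>UNIV. axis i (g i))" for g :: "8 \<Rightarrow> real^2"
      by (simp add: vec_eq_iff axis_def)
    have ax: "bounded_linear (axis i :: real^2 \<Rightarrow> real^2^8)" for i
      by (rule linear_conv_bounded_linear[THEN iffD1], rule linearI) (auto simp: axis_def vec_eq_iff)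
    show ?thesis
      unfolding eq by (intro has_derivative_sum bounded_linear.has_derivative[OF ax] that)
  qed
  show ?thesis
    unfolding grad_def[abs_def] hess_def[abs_def]
    by (rule vec) (intro has_derivative_diff has_derivative_sum has_derivative_scaleR_right kd vn)
qed

text \<open>The diagonal terms are divisions by zero and hence 0, and the two off-diagonal halves
  agree.\<close>

lemma potential_double_sum:
  "potential q m = 1 / 2 * (\<Sum>i\<in>UNIV. \<Sum>j\<in>UNIV. m $ i * m $ j * (1 / norm (q $ i - q $ j)))"
proof -
  let ?f = "\<lambda>p. m $ fst p * m $ snd p * (1 / norm (q $ fst p - q $ snd p))"
  let ?L = "{p :: 8 \<times> 8. fst p < snd p}" and ?G = "{p :: 8 \<times> 8. snd p < fst p}" and ?E = "{p :: 8 \<times> 8. fst p = snd p}"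
  have "(\<Sum>i\<in>UNIV. \<Sum>j\<in>UNIV. m $ i * m $ j * (1 / norm (q $ i - q $ j))) = sum ?f (UNIV \<times> UNIV)"
    by (simp add: sum.cartesian_product case_prod_unfold)
  also have "UNIV \<times> UNIV = (?L \<union> ?G) \<union> ?E" by auto
  also have "sum ?f \<dots> = sum ?f ?L + sum ?f ?G + sum ?f ?E"
    by (subst sum.union_disjoint; (subst sum.union_disjoint)?; auto)
  also have "sum ?f ?E = 0" by (rule sum.neutral) auto
  also have "sum ?f ?G = sum ?f ?L"
    by (rule sum.reindex_bij_witness[of _ prod.swap prod.swap]) (auto simp: norm_minus_commute mult.commute)
  also have "sum ?f ?L = potential q m"
    unfolding potential_def by (rule sum.cong) (auto simp: case_prod_unfold)
  finally show ?thesis by simp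
qed

text \<open>Action equals reaction: \<open>kep\<close> is odd, so exchanging \<open>i\<close> and
  \<open>j\<close> turns the one-sided sum into one over relative displacements, with a contribution
  from each pair that is symmetric in the pair.\<close>

lemma grad_inner:
  "h \<bullet> grad m l q = l * (\<Sum>j\<in>UNIV. m $ j * (q $ j \<bullet> h $ j))
     - (\<Sum>i\<in>UNIV. \<Sum>j\<in>UNIV. m $ i * m $ j * (kep (q $ i - q $ j) \<bullet> (h $ i - h $ j))) / 2"
proof -
  let ?g = "\<lambda>i j. m $ i * m $ j * (kep (q $ i - q $ j) \<bullet> h $ i)"
  have "(\<Sum>i\<in>UNIV. \<Sum>j\<in>UNIV. m $ i * m $ j * (kep (q $ i - q $ j) \<bullet> (h $ i - h $ j)))
      = (\<Sum>i\<in>UNIV. \<Sum>j\<in>UNIV. ?g i j + ?g j i)"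
  proof (intro sum.cong refl)
    fix i j
    have "kep (q $ j - q $ i) = - kep (q $ i - q $ j)" using kep_minus[of "q $ i - q $ j"] by simp
    then show "m $ i * m $ j * (kep (q $ i - q $ j) \<bullet> (h $ i - h $ j)) = ?g i j + ?g j i"
      by (simp add: inner_diff_right algebra_simps)
  qed
  also have "\<dots> = 2 * (\<Sum>i\<in>UNIV. \<Sum>j\<in>UNIV. ?g i j)"
    using sum.swap[of "\<lambda>i j. ?g j i" UNIV UNIV] by (simp add: sum.distrib)
  finally show ?thesis
    by (simp add: inner_vec_def[of h] grad_def inner_diff_right inner_sum_right sum_subtractf
        sum_distrib_left inner_commute mult_ac)
qed

lemma GDERIV_phi:
  assumes q: "q \<in> Omega"
  shows "GDERIV (\<lambda>q. phi q r) q :> grad (masses r) (lam r) q"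
proof -
  define m where "m = masses r"
  define l where "l = lam r"
  have vn: "((\<lambda>q. q $ i) has_derivative (\<lambda>h. h $ i)) (at q)" for i and q :: "real^2^8"
    by (rule bounded_linear_imp_has_derivative[OF bounded_linear_vec_nth])
  have d1: "((\<lambda>q. 1 / norm (q $ i - q $ j)) has_derivative (\<lambda>h. - (kep (q $ i - q $ j) \<bullet> (h $ i - h $ j)))) (at q)" for i j
  proof (cases "i = j")
    case False
    have "((\<lambda>q. q $ i - q $ j) has_derivative (\<lambda>h. h $ i - h $ j)) (at q)"
      by (intro has_derivative_diff vn)
    from diff_chain_at[OF this has_derivative_inv_norm[OF OmegaD[OF q False]]]
    show ?thesis by (simp add: o_def kep_def)
  qed simp
  have d2: "((\<lambda>q. (norm (q $ j))\<^sup>2) has_derivative (\<lambda>h. 2 * (q $ j \<bullet> h $ j))) (at q)" for j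
    unfolding power2_norm_eq_inner
    by (rule has_derivative_eq_rhs[OF has_derivative_inner[OF vn vn]]) (auto simp: inner_commute)
  have D: "((\<lambda>q. 1 / 2 * (\<Sum>i\<in>UNIV. \<Sum>j\<in>UNIV. m $ i * m $ j * (1 / norm (q $ i - q $ j)))
           + l * (1 / 2 * (\<Sum>j\<in>UNIV. m $ j * (norm (q $ j))\<^sup>2)))
      has_derivative (\<lambda>h. 1 / 2 * (\<Sum>i\<in>UNIV. \<Sum>j\<in>UNIV. m $ i * m $ j * (- (kep (q $ i - q $ j) \<bullet> (h $ i - h $ j))))
           + l * (1 / 2 * (\<Sum>j\<in>UNIV. m $ j * (2 * (q $ j \<bullet> h $ j)))))) (at q)"
    by (intro has_derivative_add has_derivative_sum has_derivative_mult_right d1 d2)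
  have eq: "1 / 2 * (\<Sum>i\<in>UNIV. \<Sum>j\<in>UNIV. m $ i * m $ j * (- (kep (q $ i - q $ j) \<bullet> (h $ i - h $ j))))
           + l * (1 / 2 * (\<Sum>j\<in>UNIV. m $ j * (2 * (q $ j \<bullet> h $ j)))) = h \<bullet> grad m l q" for h
    unfolding grad_inner by (simp add: sum_negf sum_distrib_left mult_ac)
  have "((\<lambda>q. phi q r) has_derivative (\<lambda>h. h \<bullet> grad m l q)) (at q)"
    using D[unfolded eq] unfolding phi_def potential_double_sum inertia_def m_def l_def .
  then show ?thesis by (simp add: gderiv_def m_def l_def)
qed

lemma GDERIV_phi_iff:
  assumes "q \<in> Omega"
  shows "GDERIV (\<lambda>q. phi q r) q :> 0 \<longleftrightarrow> grad (masses r) (lam r) q = 0"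
proof
  assume "GDERIV (\<lambda>q. phi q r) q :> 0"
  then have "(\<lambda>h. h \<bullet> (0::real^2^8)) = (\<lambda>h. h \<bullet> grad (masses r) (lam r) q)"
    using GDERIV_phi[OF assms, of r] unfolding gderiv_def by (rule has_derivative_unique)
  then have "grad (masses r) (lam r) q \<bullet> grad (masses r) (lam r) q = 0" by (metis inner_zero_right)
  then show "grad (masses r) (lam r) q = 0" by simp
qed (use GDERIV_phi[OF assms, of r] in simp)

lemma hess_inner:
  "hess m l q h \<bullet> h' = l * (\<Sum>i\<in>UNIV. m $ i * (h $ i \<bullet> h' $ i))
     - (\<Sum>i\<in>UNIV. \<Sum>j\<in>UNIV. m $ i * m $ j * (dkep (q $ i - q $ j) (h $ i - h $ j) \<bullet> (h' $ i - h' $ j))) / 2"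
proof -
  let ?g = "\<lambda>i j. m $ i * m $ j * (dkep (q $ i - q $ j) (h $ i - h $ j) \<bullet> h' $ i)"
  have "(\<Sum>i\<in>UNIV. \<Sum>j\<in>UNIV. m $ i * m $ j * (dkep (q $ i - q $ j) (h $ i - h $ j) \<bullet> (h' $ i - h' $ j)))
      = (\<Sum>i\<in>UNIV. \<Sum>j\<in>UNIV. ?g i j + ?g j i)"
  proof (intro sum.cong refl)
    fix i j
    have "dkep (q $ j - q $ i) (h $ j - h $ i) = - dkep (q $ i - q $ j) (h $ i - h $ j)"
      by (simp add: dkep_def norm_minus_commute inner_diff_left inner_diff_right algebra_simps)
    then show "m $ i * m $ j * (dkep (q $ i - q $ j) (h $ i - h $ j) \<bullet> (h' $ i - h' $ j)) = ?g i j + ?g j i"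
      by (simp add: inner_diff_right algebra_simps)
  qed
  also have "\<dots> = 2 * (\<Sum>i\<in>UNIV. \<Sum>j\<in>UNIV. ?g i j)"
    using sum.swap[of "\<lambda>i j. ?g j i" UNIV UNIV] by (simp add: sum.distrib)
  finally show ?thesis
    by (simp add: inner_vec_def[of _ h'] hess_def inner_diff_left inner_sum_left sum_subtractf
        sum_distrib_left mult_ac)
qed

text \<open>A linear isometry commutes with \<open>kep\<close>, and a relabelling that respects the
  masses only permutes the sum.\<close>

lemma grad_reflect:
  fixes \<rho> :: "real^2 \<Rightarrow> real^2" and \<pi> :: "8 \<Rightarrow> 8"
  assumes \<rho>: "linear \<rho>" "\<And>x. norm (\<rho> x) = norm x" and \<pi>: "bij \<pi>"
    and q: "\<And>i. q $ \<pi> i = \<rho> (q $ i)" and m: "\<And>i. m $ \<pi> i = m $ i"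
  shows "grad m l q $ \<pi> i = \<rho> (grad m l q $ i)"
proof -
  have k: "kep (\<rho> x) = \<rho> (kep x)" for x
    by (simp add: kep_def \<rho>(2) linear_cmul[OF \<rho>(1)])
  have "(\<Sum>j\<in>UNIV. (m $ \<pi> i * m $ j) *\<^sub>R kep (q $ \<pi> i - q $ j))
    = (\<Sum>j\<in>UNIV. (m $ \<pi> i * m $ \<pi> j) *\<^sub>R kep (q $ \<pi> i - q $ \<pi> j))"
    by (rule sum.reindex_bij_betw[OF \<pi>, symmetric])
  also have "\<dots> = \<rho> (\<Sum>j\<in>UNIV. (m $ i * m $ j) *\<^sub>R kep (q $ i - q $ j))"
    by (simp add: m q linear_sum[OF \<rho>(1)] linear_cmul[OF \<rho>(1)] k flip: linear_diff[OF \<rho>(1)])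
  finally show ?thesis
    by (simp add: grad_def q m linear_diff[OF \<rho>(1)] linear_cmul[OF \<rho>(1)])
qed

section \<open>Configurations symmetric under a reflection\<close>

definition v2 :: "real \<Rightarrow> real \<Rightarrow> real^2" where "v2 x y = vector [x, y]"

lemma v2_nth [simp]: "v2 x y $ 1 = x" "v2 x y $ 2 = y"
  by (simp_all add: v2_def vector_2)

lemma v2_diff [simp]: "v2 x y - v2 x' y' = v2 (x - x') (y - y')"
  by (simp add: vec_eq_iff forall_2)

lemma v2_inner [simp]: "v2 x y \<bullet> v2 x' y' = x * x' + y * y'"
  by (simp add: inner_vec_def sum_2)

lemma v2_norm [simp]: "norm (v2 x y) = sqrt (x\<^sup>2 + y\<^sup>2)"
  by (simp add: norm_eq_sqrt_inner power2_eq_square)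

text \<open>The power of \<open>Z\<close> with exponent \<open>-n/2\<close>: the argument is a
  squared distance, so that it stays polynomial in the coordinates.\<close>

definition rn :: "real \<Rightarrow> nat \<Rightarrow> real" where "rn Z n = 1 / sqrt Z ^ n"

text \<open>\<open>T1\<close> and \<open>T2\<close> are the parts of the first and second variation,
  up to sign and masses, that stem from one pair of bodies with relative position
  \<open>(x, y)\<close>, relative displacement \<open>(a, b)\<close> and squared distance
  \<open>Z\<close>.\<close>

definition T1 :: "real \<Rightarrow> real \<Rightarrow> real \<Rightarrow> real \<Rightarrow> real \<Rightarrow> real" where
  "T1 x y a b Z = (x * a + y * b) * rn Z 3"

definition T2 :: "real \<Rightarrow> real \<Rightarrow> real \<Rightarrow> real \<Rightarrow> real \<Rightarrow> real" where
  "T2 x y a b Z = (a\<^sup>2 + b\<^sup>2) * rn Z 3 - 3 * (x * a + y * b)\<^sup>2 * rn Z 5"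

lemma pair_terms:
  assumes "q $ i = v2 x y" "q $ j = v2 x' y'" "h $ i = v2 a b" "h $ j = v2 a' b'"
    "(x - x')\<^sup>2 + (y - y')\<^sup>2 = Z"
  shows "kep (q $ i - q $ j) \<bullet> (h $ i - h $ j) = T1 (x - x') (y - y') (a - a') (b - b') Z"
    and "dkep (q $ i - q $ j) (h $ i - h $ j) \<bullet> (h $ i - h $ j) = T2 (x - x') (y - y') (a - a') (b - b') Z"
proof -
  have n: "norm (v2 (x - x') (y - y')) = sqrt Z" using assms(5) by simp
  show "kep (q $ i - q $ j) \<bullet> (h $ i - h $ j) = T1 (x - x') (y - y') (a - a') (b - b') Z"
    unfolding assms(1-4) v2_diff kep_def n by (simp add: T1_def rn_def)
  show "dkep (q $ i - q $ j) (h $ i - h $ j) \<bullet> (h $ i - h $ j) = T2 (x - x') (y - y') (a - a') (b - b') Z"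
    unfolding assms(1-4) v2_diff dkep_def n inner_diff_left inner_scaleR_left v2_inner T2_def rn_def
    by (simp add: power2_eq_square)
qed

text \<open>
  The outer body in the quadrant with signs \<open>(a, b)\<close> is placed at \<open>(f0 + a f1, b (g0 + a g1))\<close>, the
  inner one likewise with capital letters. This is the general symmetric configuration.
\<close>

definition place :: "real \<Rightarrow> real \<Rightarrow> real \<Rightarrow> real \<Rightarrow> real \<Rightarrow> real
      \<Rightarrow> real \<Rightarrow> real \<Rightarrow> real^2^8" where
  "place f0 f1 g0 g1 F0 F1 G0 G1 = vector [
     v2 (f0 - f1) (g1 - g0), v2 (f0 + f1) (-(g0 + g1)),
     v2 (f0 + f1) (g0 + g1), v2 (f0 - f1) (g0 - g1),
     v2 (F0 - F1) (G1 - G0), v2 (F0 + F1) (-(G0 + G1)),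
     v2 (F0 + F1) (G0 + G1), v2 (F0 - F1) (G0 - G1)]"

text \<open>The inner square has half side \<open>k\<close>, that is \<open>k = r / sqrt 2\<close>.\<close>

definition sq :: "real \<Rightarrow> real^2^8" where
  "sq k = place 0 (1/2) (1/2) 0 0 k k 0"

definition mv :: "real \<Rightarrow> real^8" where
  "mv M = vector [M, M, M, M, 1, 1, 1, 1]"

lemma mv_nth [simp]:
  "mv M $ 1 = M" "mv M $ 2 = M" "mv M $ 3 = M" "mv M $ 4 = M"
  "mv M $ 5 = 1" "mv M $ 6 = 1" "mv M $ 7 = 1" "mv M $ 8 = 1"
  unfolding mv_def by (rule vector_8)+

text \<open>The groups are the kinds of pairs at the nested squares: outer, inner, same corner,
  opposite corners, adjacent corners. Each group has its own closed form in
  \<open>quad_form\<close>.\<close>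

lemma sum_symmetric_pairs:
  fixes E :: "8 \<Rightarrow> 8 \<Rightarrow> real"
  assumes "\<And>i j. E i j = E j i" "\<And>i. E i i = 0"
  shows "(\<Sum>i\<in>UNIV. \<Sum>j\<in>UNIV. E i j) / 2 =
     (E 1 2 + E 1 3 + E 1 4 + E 2 3 + E 2 4 + E 3 4) +
     (E 5 6 + E 5 7 + E 5 8 + E 6 7 + E 6 8 + E 7 8) +
     (E 1 5 + E 2 6 + E 3 7 + E 4 8) +
     (E 1 7 + E 2 8 + E 3 5 + E 4 6) +
     (E 1 6 + E 1 8 + E 2 5 + E 2 7 + E 3 6 + E 3 8 + E 4 5 + E 4 7)"
  unfolding sum_8
  by (simp add: assms(2) assms(1)[of 2 1] assms(1)[of 3 1] assms(1)[of 4 1] assms(1)[of 5 1] assms(1)[of 6 1] assms(1)[of 7 1]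
        assms(1)[of 8 1] assms(1)[of 3 2] assms(1)[of 4 2] assms(1)[of 5 2] assms(1)[of 6 2] assms(1)[of 7 2] assms(1)[of 8 2]
        assms(1)[of 4 3] assms(1)[of 5 3] assms(1)[of 6 3] assms(1)[of 7 3] assms(1)[of 8 3] assms(1)[of 5 4] assms(1)[of 6 4]
        assms(1)[of 7 4] assms(1)[of 8 4] assms(1)[of 6 5] assms(1)[of 7 5] assms(1)[of 8 5] assms(1)[of 7 6] assms(1)[of 8 6] assms(1)[of 8 7])

context
  fixes f0 f1 g0 g1 F0 F1 G0 G1 k :: real
begin

lemma place_nth:
    "place f0 f1 g0 g1 F0 F1 G0 G1 $ 1 = v2 (f0 - f1) (g1 - g0)"
    "place f0 f1 g0 g1 F0 F1 G0 G1 $ 2 = v2 (f0 + f1) (-(g0 + g1))"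
    "place f0 f1 g0 g1 F0 F1 G0 G1 $ 3 = v2 (f0 + f1) (g0 + g1)"
    "place f0 f1 g0 g1 F0 F1 G0 G1 $ 4 = v2 (f0 - f1) (g0 - g1)"
    "place f0 f1 g0 g1 F0 F1 G0 G1 $ 5 = v2 (F0 - F1) (G1 - G0)"
    "place f0 f1 g0 g1 F0 F1 G0 G1 $ 6 = v2 (F0 + F1) (-(G0 + G1))"
    "place f0 f1 g0 g1 F0 F1 G0 G1 $ 7 = v2 (F0 + F1) (G0 + G1)"
    "place f0 f1 g0 g1 F0 F1 G0 G1 $ 8 = v2 (F0 - F1) (G0 - G1)"
  unfolding place_def by (rule vector_8)+

lemma sq_nth:
    "sq k $ 1 = v2 (-(1/2)) (-(1/2))"
    "sq k $ 2 = v2 ((1/2)) (-(1/2))"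
    "sq k $ 3 = v2 ((1/2)) ((1/2))"
    "sq k $ 4 = v2 (-(1/2)) ((1/2))"
    "sq k $ 5 = v2 (-k) (-k)"
    "sq k $ 6 = v2 (k) (-k)"
    "sq k $ 7 = v2 (k) (k)"
    "sq k $ 8 = v2 (-k) (k)"
  unfolding sq_def place_def by (simp_all only: vector_8 add_0 diff_0 diff_0_right diff_self minus_zero add_0_right)

lemma sq_dist:
    "(-(1/2) - (1/2) :: real)\<^sup>2 + (-(1/2) - -(1/2))\<^sup>2 = 1"
    "(-(1/2) - (1/2) :: real)\<^sup>2 + (-(1/2) - (1/2))\<^sup>2 = (2::real)"
    "(-(1/2) - -(1/2) :: real)\<^sup>2 + (-(1/2) - (1/2))\<^sup>2 = 1"
    "(-(1/2) - -k :: real)\<^sup>2 + (-(1/2) - -k)\<^sup>2 = (2 * (1/2 - k)\<^sup>2)"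
    "(-(1/2) - k :: real)\<^sup>2 + (-(1/2) - -k)\<^sup>2 = (1/2 + 2 * k\<^sup>2)"
    "(-(1/2) - k :: real)\<^sup>2 + (-(1/2) - k)\<^sup>2 = (2 * (1/2 + k)\<^sup>2)"
    "(-(1/2) - -k :: real)\<^sup>2 + (-(1/2) - k)\<^sup>2 = (1/2 + 2 * k\<^sup>2)"
    "((1/2) - (1/2) :: real)\<^sup>2 + (-(1/2) - (1/2))\<^sup>2 = 1"
    "((1/2) - -(1/2) :: real)\<^sup>2 + (-(1/2) - (1/2))\<^sup>2 = (2::real)"
    "((1/2) - -k :: real)\<^sup>2 + (-(1/2) - -k)\<^sup>2 = (1/2 + 2 * k\<^sup>2)"
    "((1/2) - k :: real)\<^sup>2 + (-(1/2) - -k)\<^sup>2 = (2 * (1/2 - k)\<^sup>2)"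
    "((1/2) - k :: real)\<^sup>2 + (-(1/2) - k)\<^sup>2 = (1/2 + 2 * k\<^sup>2)"
    "((1/2) - -k :: real)\<^sup>2 + (-(1/2) - k)\<^sup>2 = (2 * (1/2 + k)\<^sup>2)"
    "((1/2) - -(1/2) :: real)\<^sup>2 + ((1/2) - (1/2))\<^sup>2 = 1"
    "((1/2) - -k :: real)\<^sup>2 + ((1/2) - -k)\<^sup>2 = (2 * (1/2 + k)\<^sup>2)"
    "((1/2) - k :: real)\<^sup>2 + ((1/2) - -k)\<^sup>2 = (1/2 + 2 * k\<^sup>2)"
    "((1/2) - k :: real)\<^sup>2 + ((1/2) - k)\<^sup>2 = (2 * (1/2 - k)\<^sup>2)"
    "((1/2) - -k :: real)\<^sup>2 + ((1/2) - k)\<^sup>2 = (1/2 + 2 * k\<^sup>2)"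
    "(-(1/2) - -k :: real)\<^sup>2 + ((1/2) - -k)\<^sup>2 = (1/2 + 2 * k\<^sup>2)"
    "(-(1/2) - k :: real)\<^sup>2 + ((1/2) - -k)\<^sup>2 = (2 * (1/2 + k)\<^sup>2)"
    "(-(1/2) - k :: real)\<^sup>2 + ((1/2) - k)\<^sup>2 = (1/2 + 2 * k\<^sup>2)"
    "(-(1/2) - -k :: real)\<^sup>2 + ((1/2) - k)\<^sup>2 = (2 * (1/2 - k)\<^sup>2)"
    "(-k - k :: real)\<^sup>2 + (-k - -k)\<^sup>2 = (4 * k\<^sup>2)"
    "(-k - k :: real)\<^sup>2 + (-k - k)\<^sup>2 = (8 * k\<^sup>2)"
    "(-k - -k :: real)\<^sup>2 + (-k - k)\<^sup>2 = (4 * k\<^sup>2)"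
    "(k - k :: real)\<^sup>2 + (-k - k)\<^sup>2 = (4 * k\<^sup>2)"
    "(k - -k :: real)\<^sup>2 + (-k - k)\<^sup>2 = (8 * k\<^sup>2)"
    "(k - -k :: real)\<^sup>2 + (k - k)\<^sup>2 = (4 * k\<^sup>2)"
  by (simp_all add: power2_eq_square algebra_simps)

lemmas sq_pair_terms =
    pair_terms[OF sq_nth(1) sq_nth(2) place_nth(1) place_nth(2) sq_dist(1)]
    pair_terms[OF sq_nth(1) sq_nth(3) place_nth(1) place_nth(3) sq_dist(2)]
    pair_terms[OF sq_nth(1) sq_nth(4) place_nth(1) place_nth(4) sq_dist(3)]
    pair_terms[OF sq_nth(1) sq_nth(5) place_nth(1) place_nth(5) sq_dist(4)]
    pair_terms[OF sq_nth(1) sq_nth(6) place_nth(1) place_nth(6) sq_dist(5)]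
    pair_terms[OF sq_nth(1) sq_nth(7) place_nth(1) place_nth(7) sq_dist(6)]
    pair_terms[OF sq_nth(1) sq_nth(8) place_nth(1) place_nth(8) sq_dist(7)]
    pair_terms[OF sq_nth(2) sq_nth(3) place_nth(2) place_nth(3) sq_dist(8)]
    pair_terms[OF sq_nth(2) sq_nth(4) place_nth(2) place_nth(4) sq_dist(9)]
    pair_terms[OF sq_nth(2) sq_nth(5) place_nth(2) place_nth(5) sq_dist(10)]
    pair_terms[OF sq_nth(2) sq_nth(6) place_nth(2) place_nth(6) sq_dist(11)]
    pair_terms[OF sq_nth(2) sq_nth(7) place_nth(2) place_nth(7) sq_dist(12)]
    pair_terms[OF sq_nth(2) sq_nth(8) place_nth(2) place_nth(8) sq_dist(13)]
    pair_terms[OF sq_nth(3) sq_nth(4) place_nth(3) place_nth(4) sq_dist(14)]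
    pair_terms[OF sq_nth(3) sq_nth(5) place_nth(3) place_nth(5) sq_dist(15)]
    pair_terms[OF sq_nth(3) sq_nth(6) place_nth(3) place_nth(6) sq_dist(16)]
    pair_terms[OF sq_nth(3) sq_nth(7) place_nth(3) place_nth(7) sq_dist(17)]
    pair_terms[OF sq_nth(3) sq_nth(8) place_nth(3) place_nth(8) sq_dist(18)]
    pair_terms[OF sq_nth(4) sq_nth(5) place_nth(4) place_nth(5) sq_dist(19)]
    pair_terms[OF sq_nth(4) sq_nth(6) place_nth(4) place_nth(6) sq_dist(20)]
    pair_terms[OF sq_nth(4) sq_nth(7) place_nth(4) place_nth(7) sq_dist(21)]
    pair_terms[OF sq_nth(4) sq_nth(8) place_nth(4) place_nth(8) sq_dist(22)]
    pair_terms[OF sq_nth(5) sq_nth(6) place_nth(5) place_nth(6) sq_dist(23)]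
    pair_terms[OF sq_nth(5) sq_nth(7) place_nth(5) place_nth(7) sq_dist(24)]
    pair_terms[OF sq_nth(5) sq_nth(8) place_nth(5) place_nth(8) sq_dist(25)]
    pair_terms[OF sq_nth(6) sq_nth(7) place_nth(6) place_nth(7) sq_dist(26)]
    pair_terms[OF sq_nth(6) sq_nth(8) place_nth(6) place_nth(8) sq_dist(27)]
    pair_terms[OF sq_nth(7) sq_nth(8) place_nth(7) place_nth(8) sq_dist(28)]

end

lemma dkep_minus: "dkep (- x) (- h) = - dkep x h"
  by (simp add: dkep_def)

lemma rn_5: "Z > 0 \<Longrightarrow> Z * rn Z 5 = rn Z 3"
  by (simp add: rn_def numeral_eq_Suc field_simps)

text \<open>The sum of \<open>T2\<close> over four pairs whose joining lines are the diagonals of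
  the squares, without the factor \<open>rn Z 3\<close>.\<close>

definition quad_diag :: "real \<Rightarrow> real \<Rightarrow> real \<Rightarrow> real \<Rightarrow> real" where
  "quad_diag a b c d = 4 * (a\<^sup>2 + b\<^sup>2 + c\<^sup>2 + d\<^sup>2) - 6 * ((b + c)\<^sup>2 + (a + d)\<^sup>2)"

text \<open>The sum of \<open>T2\<close> over the six pairs of one square; \<open>A\<close> and
  \<open>Ad\<close> are the inverse cubes of its side and its diagonal.\<close>

definition quad_ring :: "real \<Rightarrow> real \<Rightarrow> real \<Rightarrow> real \<Rightarrow> real \<Rightarrow> real" where
  "quad_ring A Ad f1 g0 g1 = A * (8 * (g1\<^sup>2 - 2 * f1\<^sup>2) - 16 * (g0\<^sup>2 + g1\<^sup>2))
      + Ad * (8 * (f1\<^sup>2 + g0\<^sup>2) - 12 * (f1 + g0)\<^sup>2)"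

text \<open>
  The squared distances from an outer corner to the inner ones: same corner, opposite corner, and
  adjacent corner.
\<close>

abbreviation "Rs k \<equiv> rn (2 * (1/2 - k)\<^sup>2)"
abbreviation "Ro k \<equiv> rn (2 * (1/2 + k)\<^sup>2)"
abbreviation "Rg k \<equiv> rn (1/2 + 2 * k\<^sup>2)"

definition quad_form :: "real \<Rightarrow> real \<Rightarrow> real \<Rightarrow> real \<Rightarrow> real \<Rightarrow> real
      \<Rightarrow> real \<Rightarrow> real \<Rightarrow> real \<Rightarrow> real \<Rightarrow> real \<Rightarrow> real" where
  "quad_form M l k f0 f1 g0 g1 F0 F1 G0 G1 =
     4 * l * M * (f0\<^sup>2 + f1\<^sup>2 + g0\<^sup>2 + g1\<^sup>2) + 4 * l * (F0\<^sup>2 + F1\<^sup>2 + G0\<^sup>2 + G1\<^sup>2)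
     - (M\<^sup>2 * quad_ring 1 (rn 2 3) f1 g0 g1
      + quad_ring (rn (4 * k\<^sup>2) 3) (rn (8 * k\<^sup>2) 3) F1 G0 G1
      + M * (Rs k 3 * quad_diag (f0 - F0) (f1 - F1) (g0 - G0) (g1 - G1))
      + M * (Ro k 3 * quad_diag (f0 - F0) (f1 + F1) (g0 + G0) (g1 - G1))
      + M * (4 * Rg k 3 * ((f0 - F0)\<^sup>2 + (f1 + F1)\<^sup>2 + (g0 - G0)\<^sup>2 + (g1 + G1)\<^sup>2
           + (f0 - F0)\<^sup>2 + (f1 - F1)\<^sup>2 + (g0 + G0)\<^sup>2 + (g1 + G1)\<^sup>2)
         - 12 * Rg k 5 * (((1/2 + k) * (f1 + F1) + (1/2 - k) * (g0 - G0))\<^sup>2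
           + ((1/2 + k) * (f0 - F0) + (1/2 - k) * (g1 + G1))\<^sup>2
           + ((1/2 - k) * (f1 - F1) + (1/2 + k) * (g0 + G0))\<^sup>2
           + ((1/2 - k) * (f0 - F0) + (1/2 + k) * (g1 + G1))\<^sup>2)))"

definition lin_form :: "real \<Rightarrow> real \<Rightarrow> real \<Rightarrow> real \<Rightarrow> real \<Rightarrow> real \<Rightarrow> real \<Rightarrow> real" where
  "lin_form M l k f1 g0 F1 G0 =
    (2 * l * M - 4 * M\<^sup>2 * (1 + rn 2 3)
      - 4 * M * ((1/2 - k) * Rs k 3 + (1/2 + k) * Ro k 3 + Rg k 3)) * (f1 + g0)
    + (4 * l * k - 8 * k * (rn (4 * k\<^sup>2) 3 + rn (8 * k\<^sup>2) 3)
      - 4 * M * ((1/2 + k) * Ro k 3 - (1/2 - k) * Rs k 3 + 2 * k * Rg k 3)) * (F1 + G0)"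

context
  fixes f0 f1 g0 g1 F0 F1 G0 G1 k M l :: real
begin

abbreviation "disp \<equiv> place f0 f1 g0 g1 F0 F1 G0 G1"

lemma hess_sq:
  assumes k: "0 < k" "k < 1/2"
  shows "hess (mv M) l (sq k) disp \<bullet> disp = quad_form M l k f0 f1 g0 g1 F0 F1 G0 G1"
proof -
  define E where "E i j = mv M $ i * mv M $ j * (dkep (sq k $ i - sq k $ j) (disp $ i - disp $ j) \<bullet> (disp $ i - disp $ j))" for i j
  have sym: "E i j = E j i" for i j
    using dkep_minus[of "sq k $ i - sq k $ j" "disp $ i - disp $ j"]
      inner_minus_right[of "dkep (sq k $ i - sq k $ j) (disp $ i - disp $ j)" "disp $ i - disp $ j"]
    by (simp add: E_def)
  have diag: "E i i = 0" for i by (simp add: E_def)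
  note E = E_def mv_nth sq_pair_terms T2_def
  have r1: "rn 1 n = 1" for n by (simp add: rn_def)
  \<comment> \<open>The inverse cubes are rewritten as polynomial multiples of inverse fifth powers
    here and below, which makes the sums over the groups polynomial identities.\<close>
  have r2: "rn 2 3 = 2 * rn 2 5" by (rule rn_5[symmetric]) simp
  have oo: "E 1 2 + E 1 3 + E 1 4 + E 2 3 + E 2 4 + E 3 4 = M\<^sup>2 * quad_ring 1 (rn 2 3) f1 g0 g1"
    unfolding E quad_ring_def r1 r2 by (simp add: power2_eq_square algebra_simps)
  have r4: "rn (4 * k\<^sup>2) 3 = 4 * k\<^sup>2 * rn (4 * k\<^sup>2) 5" by (rule rn_5[symmetric]) (use k in simp)
  have r8: "rn (8 * k\<^sup>2) 3 = 8 * k\<^sup>2 * rn (8 * k\<^sup>2) 5" by (rule rn_5[symmetric]) (use k in simp)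
  have ii: "E 5 6 + E 5 7 + E 5 8 + E 6 7 + E 6 8 + E 7 8
    = quad_ring (rn (4 * k\<^sup>2) 3) (rn (8 * k\<^sup>2) 3) F1 G0 G1"
    unfolding E quad_ring_def r4 r8 by (simp add: power2_eq_square algebra_simps)
  have rs: "Rs k 3 = 2 * (1/2 - k)\<^sup>2 * Rs k 5" by (rule rn_5[symmetric]) (use k in simp)
  have ss: "E 1 5 + E 2 6 + E 3 7 + E 4 8 = M * (Rs k 3 * quad_diag (f0 - F0) (f1 - F1) (g0 - G0) (g1 - G1))"
    unfolding E quad_diag_def rs by Groebner_Basis.algebra
  have ro: "Ro k 3 = 2 * (1/2 + k)\<^sup>2 * Ro k 5" by (rule rn_5[symmetric]) (use k in simp)
  have os: "E 1 7 + E 2 8 + E 3 5 + E 4 6 = M * (Ro k 3 * quad_diag (f0 - F0) (f1 + F1) (g0 + G0) (g1 - G1))"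
    unfolding E quad_diag_def ro by Groebner_Basis.algebra
  have gs: "E 1 6 + E 1 8 + E 2 5 + E 2 7 + E 3 6 + E 3 8 + E 4 5 + E 4 7
    = M * (4 * Rg k 3 * ((f0 - F0)\<^sup>2 + (f1 + F1)\<^sup>2 + (g0 - G0)\<^sup>2 + (g1 + G1)\<^sup>2
           + (f0 - F0)\<^sup>2 + (f1 - F1)\<^sup>2 + (g0 + G0)\<^sup>2 + (g1 + G1)\<^sup>2)
         - 12 * Rg k 5 * (((1/2 + k) * (f1 + F1) + (1/2 - k) * (g0 - G0))\<^sup>2
           + ((1/2 + k) * (f0 - F0) + (1/2 - k) * (g1 + G1))\<^sup>2
           + ((1/2 - k) * (f1 - F1) + (1/2 + k) * (g0 + G0))\<^sup>2
           + ((1/2 - k) * (f0 - F0) + (1/2 + k) * (g1 + G1))\<^sup>2))"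
    unfolding E by Groebner_Basis.algebra
  have s: "(\<Sum>i\<in>UNIV. mv M $ i * (disp $ i \<bullet> disp $ i))
    = 4 * M * (f0\<^sup>2 + f1\<^sup>2 + g0\<^sup>2 + g1\<^sup>2) + 4 * (F0\<^sup>2 + F1\<^sup>2 + G0\<^sup>2 + G1\<^sup>2)"
    unfolding sum_8 mv_nth place_nth v2_inner by Groebner_Basis.algebra
  have "hess (mv M) l (sq k) disp \<bullet> disp = l * (\<Sum>i\<in>UNIV. mv M $ i * (disp $ i \<bullet> disp $ i)) - (\<Sum>i\<in>UNIV. \<Sum>j\<in>UNIV. E i j) / 2"
    by (simp add: hess_inner E_def)
  then show ?thesis
    unfolding sum_symmetric_pairs[OF sym diag] oo ii ss os gs s quad_form_def by Groebner_Basis.algebra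
qed

lemma grad_sq:
  shows "disp \<bullet> grad (mv M) l (sq k) = lin_form M l k f1 g0 F1 G0"
proof -
  define E where "E i j = mv M $ i * mv M $ j * (kep (sq k $ i - sq k $ j) \<bullet> (disp $ i - disp $ j))" for i j
  have sym: "E i j = E j i" for i j
    by (simp add: E_def kep_def norm_minus_commute inner_diff_left inner_diff_right inner_commute algebra_simps)
  have diag: "E i i = 0" for i by (simp add: E_def)
  have r1: "rn 1 n = 1" for n by (simp add: rn_def)
  have s: "(\<Sum>i\<in>UNIV. mv M $ i * (sq k $ i \<bullet> disp $ i)) = 2 * M * (f1 + g0) + 4 * k * (F1 + G0)"
    unfolding sum_8 mv_nth place_nth sq_nth v2_inner by Groebner_Basis.algebra
  have "disp \<bullet> grad (mv M) l (sq k) = l * (\<Sum>i\<in>UNIV. mv M $ i * (sq k $ i \<bullet> disp $ i)) - (\<Sum>i\<in>UNIV. \<Sum>j\<in>UNIV. E i j) / 2"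
    by (simp add: grad_inner E_def)
  then show ?thesis
    unfolding sum_symmetric_pairs[OF sym diag] s unfolding E_def mv_nth sq_pair_terms T1_def r1 lin_form_def
    by Groebner_Basis.algebra
qed

end

section \<open>Mirror symmetric configurations and symmetric criticality\<close>

definition mirror :: "real^2 \<Rightarrow> real^2" where
  "mirror z = v2 (z $ 1) (- z $ 2)"

lemma linear_mirror: "linear mirror"
  by (rule linearI) (simp_all add: mirror_def vec_eq_iff forall_2)

lemma norm_mirror: "norm (mirror z) = norm z"
proof -
  have "norm z = sqrt ((z $ 1)\<^sup>2 + (z $ 2)\<^sup>2)"
    by (simp add: norm_eq_sqrt_inner inner_vec_def sum_2 power2_eq_square)
  then show ?thesis by (simp add: mirror_def)
qed

lemma mirror_v2 [simp]: "mirror (v2 x y) = v2 x (- y)"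
  by (simp add: mirror_def)

lemma bij_five_minus: "bij (\<lambda>i::8. 5 - i)"
  by (rule involuntory_imp_bij) simp

lemma five_minus:
  "(5::8) - 1 = 4" "(5::8) - 2 = 3" "(5::8) - 3 = 2" "(5::8) - 4 = 1"
  "(5::8) - 5 = 8" "(5::8) - 6 = 7" "(5::8) - 7 = 6" "(5::8) - 8 = 5"
  by simp_all

text \<open>Indices count modulo 8, so \<open>5 - i\<close> swaps 1 with 4, 2 with 3, 5 with 8 and 6
  with 7: one formula serves both squares.\<close>

definition symmetric :: "real^2^8 \<Rightarrow> bool" where
  "symmetric q \<longleftrightarrow> (\<forall>i. q $ (5 - i) = mirror (q $ i))"

lemma symmetric_place: "symmetric (place f0 f1 g0 g1 F0 F1 G0 G1)"
  unfolding symmetric_def forall_8 five_minus place_nth mirror_v2 by (simp add: add.commute)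

lemma symmetric_imp_place:
  assumes "symmetric q"
  shows "\<exists>f0 f1 g0 g1 F0 F1 G0 G1. q = place f0 f1 g0 g1 F0 F1 G0 G1"
proof -
  have s: "q $ 4 = mirror (q $ 1)" "q $ 3 = mirror (q $ 2)" "q $ 8 = mirror (q $ 5)" "q $ 7 = mirror (q $ 6)"
    using assms unfolding symmetric_def forall_8 five_minus by blast+
  have v: "z = v2 x y \<longleftrightarrow> z $ 1 = x \<and> z $ 2 = y" for z x y
    unfolding vec_eq_iff forall_2 v2_nth ..
  have "q = place ((q$2$1 + q$1$1) / 2) ((q$2$1 - q$1$1) / 2) ((- q$2$2 - q$1$2) / 2) ((q$1$2 - q$2$2) / 2)
      ((q$6$1 + q$5$1) / 2) ((q$6$1 - q$5$1) / 2) ((- q$6$2 - q$5$2) / 2) ((q$5$2 - q$6$2) / 2)"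
    unfolding vec_eq_iff[of q] forall_8 place_nth v s mirror_def v2_nth by (simp add: field_simps)
  then show ?thesis by blast
qed

lemma symmetric_grad:
  assumes "symmetric q"
  shows "symmetric (grad (mv M) l q)"
  unfolding symmetric_def
proof
  fix i
  have "\<forall>i. mv M $ (5 - i) = mv M $ i" unfolding forall_8 five_minus mv_nth by simp
  then have m: "mv M $ (5 - i) = mv M $ i" for i by (rule spec)
  have q: "q $ (5 - i) = mirror (q $ i)" for i
    using assms unfolding symmetric_def by (rule spec)
  show "grad (mv M) l q $ (5 - i) = mirror (grad (mv M) l q $ i)"
    by (rule grad_reflect[where \<pi> = "\<lambda>i. 5 - i", OF linear_mirror norm_mirror bij_five_minus q m])
qed

text \<open>The gradient at a symmetric configuration is symmetric, hence itself one of the tested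
  displacements, and so it is orthogonal to itself.\<close>

lemma grad_eq_0_iff:
  assumes "symmetric q"
    and "\<And>f0 f1 g0 g1 F0 F1 G0 G1. place f0 f1 g0 g1 F0 F1 G0 G1 \<bullet> grad (mv M) l q = 0"
  shows "grad (mv M) l q = 0"
proof -
  obtain f0 f1 g0 g1 F0 F1 G0 G1 where "grad (mv M) l q = place f0 f1 g0 g1 F0 F1 G0 G1"
    using symmetric_imp_place[OF symmetric_grad[OF assms(1), of M l]] by blast
  then have "grad (mv M) l q \<bullet> grad (mv M) l q = 0"
    using assms(2)[of f0 f1 g0 g1 F0 F1 G0 G1] by simp
  then show ?thesis by simp
qed

section \<open>The family of nested squares\<close>

definition half :: "real \<Rightarrow> real" where "half r = sqrt 2 / 2 * r"

lemma half_sqrt: "half (sqrt 2 * c) = c"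
  by (simp add: half_def)

lemma half_less: "r < s \<Longrightarrow> half r < half s"
  by (simp add: half_def)

text \<open>
  The radial equilibrium equations of an outer and an inner body are linear in the multiplier and the
  outer mass; \<open>num k / den k\<close> is the resulting mass.
\<close>

definition pull :: "real \<Rightarrow> real" where
  "pull k = (1/2 - k) * Rs k 3 + (1/2 + k) * Ro k 3 + Rg k 3"

definition num :: "real \<Rightarrow> real" where
  "num k = 2 * (rn (4 * k\<^sup>2) 3 + rn (8 * k\<^sup>2) 3) - 2 * pull k"

definition den :: "real \<Rightarrow> real" where
  "den k = 2 * (1 + rn 2 3) - ((1/2 + k) * Ro k 3 - (1/2 - k) * Rs k 3 + 2 * k * Rg k 3) / k"

lemma nested_squares_sq: "nested_squares r = sq (half r)"
  unfolding nested_squares_def sq_def place_def v2_def half_def by simp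

lemma masses_mv: "masses r = mv (outer_mass r)"
  by (simp add: masses_def mv_def)

lemma inv_cube_dist_sq:
  "inv_cube_dist (sq k) 1 2 = rn 1 3" "inv_cube_dist (sq k) 1 3 = rn 2 3"
  "inv_cube_dist (sq k) 1 5 = Rs k 3" "inv_cube_dist (sq k) 1 6 = Rg k 3" "inv_cube_dist (sq k) 1 7 = Ro k 3"
  "inv_cube_dist (sq k) 6 7 = rn (4 * k\<^sup>2) 3" "inv_cube_dist (sq k) 5 7 = rn (8 * k\<^sup>2) 3"
  unfolding inv_cube_dist_def sq_nth v2_diff v2_norm sq_dist rn_def by (simp_all add: power2_eq_square)

lemma coeff_A_eq: "k = half r \<Longrightarrow> k \<noteq> 0 \<Longrightarrow> coeff_A r = k * den k"
  unfolding coeff_A_def Let_def nested_squares_sq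
  by (simp add: inv_cube_dist_sq area_def sq_nth wedge_def den_def rn_def[of 1] field_simps)

lemma coeff_B_eq: "k = half r \<Longrightarrow> coeff_B r = - k * num k"
  unfolding coeff_B_def Let_def nested_squares_sq
  by (simp add: inv_cube_dist_sq area_def sq_nth wedge_def num_def pull_def rn_def[of 1] field_simps)

lemma outer_mass_eq: "half r \<noteq> 0 \<Longrightarrow> outer_mass r = num (half r) / den (half r)"
  by (simp add: outer_mass_def coeff_A_eq coeff_B_eq)

section \<open>Sign of the mass, the multiplier, and bounds for \<open>r0\<close>\<close>

lemma rn_pos: "Z > 0 \<Longrightarrow> rn Z n > 0"
  by (simp add: rn_def)

lemma rn_le:
  assumes "0 < a" "a\<^sup>2 \<le> Z"
  shows "rn Z n \<le> 1 / a ^ n"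
proof -
  have "a \<le> sqrt Z" using assms by (simp add: real_le_rsqrt)
  then have "a ^ n \<le> sqrt Z ^ n" using assms by (intro power_mono) auto
  then show ?thesis using assms by (simp add: rn_def frac_le)
qed

lemma rn_ge:
  assumes "0 < a" "0 < Z" "Z \<le> a\<^sup>2"
  shows "1 / a ^ n \<le> rn Z n"
proof -
  have "sqrt Z \<le> a" using assms by (simp add: real_le_lsqrt)
  then have "sqrt Z ^ n \<le> a ^ n" using assms by (intro power_mono) auto
  then show ?thesis using assms by (simp add: rn_def frac_le)
qed

text \<open>With \<open>e\<close> and \<open>P\<close> the two diagonal terms divided by
  \<open>k\<close> combine to \<open>1 / (2 * sqrt 2) * (2 / (e * P)\<^sup>2)\<close>. As
  \<open>e * P \<le> 1/4\<close>, this is at least 10, while the negative term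
  \<open>- 2 * Rg k 3\<close> is above -6.\<close>

lemma den_pos:
  assumes k: "0 < k" "k < 1/2"
  shows "den k > 0"
proof -
  define e where "e = 1/2 - k"
  define P where "P = 1/2 + k"
  have e: "0 < e" "e \<le> 1/2" and P: "0 < P" and eP: "e + P = 1" "P - e = 2 * k" using k by (auto simp: e_def P_def)
  have cube: "rn (2 * x\<^sup>2) 3 = 1 / (2 * sqrt 2 * x ^ 3)" if "x > 0" for x
    using that by (simp add: rn_def real_sqrt_mult power_mult_distrib numeral_eq_Suc)
  have "x * rn (2 * x\<^sup>2) 3 = 1 / (2 * sqrt 2) * (1 / x\<^sup>2)" if "x > 0" for x
    unfolding cube[OF that] using that by (simp add: power3_eq_cube power2_eq_square)
  then have "(e * rn (2 * e\<^sup>2) 3 - P * rn (2 * P\<^sup>2) 3) / k = 1 / (2 * sqrt 2) * ((1 / e\<^sup>2 - 1 / P\<^sup>2) / k)"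
    using e P by (simp add: right_diff_distrib diff_divide_distrib)
  also have "(1 / e\<^sup>2 - 1 / P\<^sup>2) / k = (P\<^sup>2 - e\<^sup>2) / (e\<^sup>2 * P\<^sup>2 * k)"
    using e P k by (simp add: field_simps)
  also have "P\<^sup>2 - e\<^sup>2 = 2 * k"
    using eP by (metis mult.commute mult.right_neutral square_diff_square_factored power2_eq_square add.commute)
  also have "2 * k / (e\<^sup>2 * P\<^sup>2 * k) = 2 / (e * P)\<^sup>2" using k by (simp add: power_mult_distrib)
  finally have eq: "(e * rn (2 * e\<^sup>2) 3 - P * rn (2 * P\<^sup>2) 3) / k = 1 / (2 * sqrt 2) * (2 / (e * P)\<^sup>2)" .
  have "e * P \<le> 1/4" using zero_le_power2[of k] by (simp add: e_def P_def power2_eq_square algebra_simps)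
  then have "(e * P)\<^sup>2 \<le> (1/4)\<^sup>2" using e P by (intro power_mono) auto
  then have "2 / (e * P)\<^sup>2 \<ge> 2 / (1/4)\<^sup>2" using e P by (intro divide_left_mono) auto
  then have "1 / (2 * sqrt 2) * (2 / (e * P)\<^sup>2) \<ge> 1 / (2 * sqrt 2) * 32" by (intro mult_left_mono) (auto simp: power2_eq_square)
  moreover have "1 / (2 * sqrt 2) * 32 \<ge> 10"
  proof -
    have "sqrt 2 \<le> 3/2" by (rule real_le_lsqrt) (auto simp: power2_eq_square)
    then show ?thesis by (simp add: field_simps)
  qed
  ultimately have "(e * rn (2 * e\<^sup>2) 3 - P * rn (2 * P\<^sup>2) 3) / k \<ge> 10" using eq by linarith
  moreover have "Rg k 3 \<le> 1 / (7/10) ^ 3" by (rule rn_le) (auto simp: power2_eq_square)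
  moreover have "rn 2 3 > 0" by (rule rn_pos) simp
  moreover have "den k = 2 * (1 + rn 2 3) + (e * rn (2 * e\<^sup>2) 3 - P * rn (2 * P\<^sup>2) 3) / k - 2 * Rg k 3"
    using k by (simp add: den_def e_def P_def field_simps)
  ultimately show ?thesis by (simp add: power3_eq_cube)
qed

text \<open>The constant only has to exceed 1/5, the value of \<open>k\<close> at \<open>r3\<close>,
  so that \<open>r3\<close> comes to lie below \<open>r0\<close>; it stays well below the zero of
  \<open>num\<close>, which permits crude estimates.\<close>

lemma num_pos:
  assumes k: "0 < k" "k \<le> 21/100"
  shows "num k > 0"
proof -
  have "1 / (42/100) ^ 3 \<le> rn (4 * k\<^sup>2) 3"
  proof (rule rn_ge)
    have "k\<^sup>2 \<le> (21/100)\<^sup>2" using k by (intro power_mono) auto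
    then show "4 * k\<^sup>2 \<le> (42/100)\<^sup>2" by (simp add: power2_eq_square)
  qed (use k in auto)
  moreover have "rn (8 * k\<^sup>2) 3 > 0" using k by (intro rn_pos) auto
  moreover have "Rg k 3 \<le> 1 / (7/10) ^ 3" by (rule rn_le) (auto simp: power2_eq_square)
  moreover have "(1/2 + k) * Ro k 3 \<le> 71/100 * (1 / (7/10) ^ 3)"
  proof (rule mult_mono)
    show "Ro k 3 \<le> 1 / (7/10) ^ 3"
    proof (rule rn_le)
      have "(1/2)\<^sup>2 \<le> (1/2 + k)\<^sup>2" using k by (intro power_mono) auto
      then show "(7/10)\<^sup>2 \<le> 2 * (1/2 + k)\<^sup>2" by (simp add: power2_eq_square)
    qed simp
    show "0 \<le> Ro k 3" by (simp add: rn_def)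
  qed (use k in auto)
  moreover have "(1/2 - k) * Rs k 3 \<le> 1 / (2 * (29/100)\<^sup>2 * (14/10))"
  proof -
    define e where "e = 1/2 - k"
    have e: "29/100 \<le> e" using k by (simp add: e_def)
    have "e * rn (2 * e\<^sup>2) 3 = 1 / (2 * e\<^sup>2 * sqrt 2)"
      using e by (simp add: rn_def real_sqrt_mult power_mult_distrib numeral_eq_Suc)
    also have "\<dots> \<le> 1 / (2 * (29/100)\<^sup>2 * (14/10))"
    proof (rule divide_left_mono)
      have "14/10 \<le> sqrt 2" by (rule real_le_rsqrt) (simp add: power2_eq_square)
      moreover have "(29/100)\<^sup>2 \<le> e\<^sup>2" using e by (intro power_mono) auto
      ultimately show "2 * (29/100)\<^sup>2 * (14/10) \<le> 2 * e\<^sup>2 * sqrt 2" by (intro mult_mono) auto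
    qed (use e in auto)
    finally show ?thesis by (simp add: e_def)
  qed
  ultimately show ?thesis by (simp add: num_def pull_def power3_eq_cube power2_eq_square)
qed

text \<open>One value below 1/2 with negative mass is enough: it bounds the set whose supremum is
  \<open>r0\<close> and keeps the inner square strictly inside the outer one for all
  parameters.\<close>

lemma num_neg: "num (3/10) < 0"
proof -
  have "rn (4 * (3/10)\<^sup>2) 3 \<le> 1 / (6/10) ^ 3" by (rule rn_le) (auto simp: power2_eq_square)
  moreover have "rn (8 * (3/10)\<^sup>2) 3 \<le> 1 / (84/100) ^ 3" by (rule rn_le) (auto simp: power2_eq_square)
  moreover have "1 / (2829/10000) ^ 3 \<le> Rs (3/10) 3" by (rule rn_ge) (auto simp: power2_eq_square)
  moreover have "Ro (3/10) 3 > 0" "Rg (3/10) 3 > 0" by (auto intro!: rn_pos simp: power2_eq_square)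
  ultimately show ?thesis by (simp add: num_def pull_def power3_eq_cube power2_eq_square)
qed

text \<open>The multiplier obtained from the equilibrium of an outer body once the outer mass is
  \<open>num k / den k\<close>.\<close>

definition lam0 :: "real \<Rightarrow> real" where
  "lam0 k = 2 * (num k / den k) * (1 + rn 2 3) + 2 * pull k"

text \<open>By symmetry only the two coefficients of \<open>lin_form\<close> matter. The outer one
  vanishes by the choice of \<open>lam0\<close>, the inner one by the choice of the mass.\<close>

lemma grad_sq_0:
  assumes k: "0 < k" "k < 1/2"
  shows "grad (mv (num k / den k)) (lam0 k) (sq k) = 0"
proof (rule grad_eq_0_iff)
  show "symmetric (sq k)" by (simp add: sq_def symmetric_place)
  define M where "M = num k / den k"
  have M: "M * den k = num k" using den_pos[OF k] by (simp add: M_def)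
  have l: "lam0 k = 2 * M * (1 + rn 2 3) + 2 * pull k" by (simp add: lam0_def M_def)
  have c1: "2 * lam0 k * M - 4 * M\<^sup>2 * (1 + rn 2 3)
      - 4 * M * ((1/2 - k) * Rs k 3 + (1/2 + k) * Ro k 3 + Rg k 3) = 0"
    unfolding l pull_def by Groebner_Basis.algebra
  have "k * den k = 2 * k * (1 + rn 2 3) - ((1/2 + k) * Ro k 3 - (1/2 - k) * Rs k 3 + 2 * k * Rg k 3)"
    unfolding den_def right_diff_distrib using k by simp
  then have "M * (2 * k * (1 + rn 2 3) - ((1/2 + k) * Ro k 3 - (1/2 - k) * Rs k 3 + 2 * k * Rg k 3)) = k * num k"
    using M by (metis mult.left_commute)
  then have c2: "4 * lam0 k * k - 8 * k * (rn (4 * k\<^sup>2) 3 + rn (8 * k\<^sup>2) 3)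
      - 4 * M * ((1/2 + k) * Ro k 3 - (1/2 - k) * Rs k 3 + 2 * k * Rg k 3) = 0"
    unfolding l num_def by Groebner_Basis.algebra
  show "place f0 f1 g0 g1 F0 F1 G0 G1 \<bullet> grad (mv (num k / den k)) (lam0 k) (sq k) = 0"
    for f0 f1 g0 g1 F0 F1 G0 G1
    unfolding grad_sq lin_form_def M_def[symmetric] c1 c2 by simp
qed

lemma sq_Omega:
  assumes "0 < k" "k < 1/2"
  shows "sq k \<in> Omega"
  unfolding Omega_def mem_Collect_eq forall_8 using assms
  by (auto simp: sq_nth vec_eq_iff forall_2 simp del: One_nat_def)

text \<open>Euler's identity: the potential is homogeneous of degree -1 and the inertia of degree
  2.\<close>

lemma grad_self:
  "q \<bullet> grad m l q = 2 * l * inertia q m - potential q m"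
proof -
  have k: "kep x \<bullet> x = 1 / norm x" for x :: "real^2"
    by (cases "x = 0") (simp_all add: kep_def power2_norm_eq_inner[symmetric] numeral_eq_Suc field_simps)
  show ?thesis
    unfolding grad_inner potential_double_sum inertia_def k
    by (simp add: power2_norm_eq_inner)
qed

text \<open>The gradient vanishes for the multiplier \<open>lam0\<close>; pairing it with the
  configuration itself gives the quotient that defines \<open>lam\<close>.\<close>

lemma lam_eq:
  assumes k: "0 < half r" "half r < 1/2" and M: "outer_mass r > 0"
  shows "lam r = lam0 (half r)"
proof -
  have e: "outer_mass r = num (half r) / den (half r)" by (rule outer_mass_eq) (use k in simp)
  have "grad (masses r) (lam0 (half r)) (nested_squares r) = 0"
    unfolding masses_mv nested_squares_sq e by (rule grad_sq_0[OF k])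
  then have eq: "2 * lam0 (half r) * inertia (nested_squares r) (masses r) = potential (nested_squares r) (masses r)"
    using grad_self[of "nested_squares r" "masses r" "lam0 (half r)"] by simp
  have "inertia (nested_squares r) (masses r) > 0"
  proof -
    have "inertia (sq (half r)) (mv (outer_mass r)) = outer_mass r + 4 * (half r)\<^sup>2"
      unfolding inertia_def sum_8 by (simp add: sq_nth power2_eq_square[of "1/2"])
    then show ?thesis using M by (simp add: masses_mv nested_squares_sq add_pos_nonneg)
  qed
  then show ?thesis unfolding lam_def using eq by (simp add: field_simps)
qed

lemma r0_bounds:
  shows "r0 \<ge> sqrt 2 * (21/100)" "r0 \<le> sqrt 2 * (3/10)"
    and outer_mass_pos: "\<And>r. 0 < r \<Longrightarrow> r < r0 \<Longrightarrow> outer_mass r > 0"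
proof -
  let ?S = "{s. 0 < s \<and> (\<forall>r\<in>{0<..<s}. 0 < outer_mass r)}"
  have in_S: "sqrt 2 * (21/100) \<in> ?S"
  proof -
    have "outer_mass r > 0" if "0 < r" "r < sqrt 2 * (21/100)" for r
    proof -
      have "0 < half r" "half r < 21/100"
        using that half_less[of r "sqrt 2 * (21/100)"] by (simp_all only: half_sqrt) (simp add: half_def)
      then show ?thesis using outer_mass_eq[of r] num_pos[of "half r"] den_pos[of "half r"] by simp
    qed
    then show ?thesis by auto
  qed
  have up: "s \<le> sqrt 2 * (3/10)" if "s \<in> ?S" for s
  proof (rule ccontr)
    assume "\<not> s \<le> sqrt 2 * (3/10)"
    then have "0 < outer_mass (sqrt 2 * (3/10))" using that by auto
    moreover have "outer_mass (sqrt 2 * (3/10)) = num (3/10) / den (3/10)"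
      using outer_mass_eq[of "sqrt 2 * (3/10)"] unfolding half_sqrt by simp
    ultimately show False
      using divide_neg_pos[OF num_neg den_pos[of "3/10"]] by simp
  qed
  have bdd: "bdd_above ?S" using up by (rule bdd_aboveI)
  show "r0 \<ge> sqrt 2 * (21/100)" unfolding r0_def by (rule cSup_upper[OF in_S bdd])
  show "r0 \<le> sqrt 2 * (3/10)" unfolding r0_def by (rule cSup_least) (use in_S up in blast)+
  show "outer_mass r > 0" if r: "0 < r" "r < r0" for r
  proof -
    obtain s where "s \<in> ?S" "r < s"
      using r(2) less_cSup_iff[of ?S r] in_S bdd unfolding r0_def by blast
    then show ?thesis using r(1) by auto
  qed
qed

lemma half_bounds:
  assumes "0 < r" "r < r0"
  shows "0 < half r" "half r < 1/2"
proof -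
  show "0 < half r" using assms by (simp add: half_def)
  have "r < sqrt 2 * (3/10)" using assms r0_bounds by linarith
  then show "half r < 1/2" using half_less[of r "sqrt 2 * (3/10)"] unfolding half_sqrt by simp
qed

lemma continuous_on_rn:
  assumes "continuous_on S f" "\<And>x. x \<in> S \<Longrightarrow> f x > 0"
  shows "continuous_on S (\<lambda>x. rn (f x) n)"
  unfolding rn_def using assms
  by (intro continuous_intros) (auto simp: less_imp_neq[symmetric])

lemma continuous_coefficients:
  shows "continuous_on {0<..<1/2} num" "continuous_on {0<..<1/2} den" "continuous_on {0<..<1/2} pull"
  unfolding num_def den_def pull_def
  by (intro continuous_intros continuous_on_rn; simp add: add_pos_nonneg)+

lemma continuous_masses: "continuous_on {0<..<r0} outer_mass" "continuous_on {0<..<r0} lam"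
proof -
  have h: "continuous_on {0<..<r0} half" "half ` {0<..<r0} \<subseteq> {0<..<1/2}"
    using half_bounds by (auto simp: half_def[abs_def] intro!: continuous_intros)
  have dn: "den k \<noteq> 0" if "k \<in> {0<..<1/2}" for k using den_pos[of k] that by auto
  have "continuous_on {0<..<1/2} (\<lambda>k. num k / den k)" "continuous_on {0<..<1/2} lam0"
    unfolding lam0_def[abs_def] using continuous_coefficients dn by (auto intro!: continuous_intros)
  then have "continuous_on {0<..<r0} (\<lambda>r. num (half r) / den (half r))" "continuous_on {0<..<r0} (\<lambda>r. lam0 (half r))"
    using h by (auto intro: continuous_on_compose2)
  moreover have "num (half r) / den (half r) = outer_mass r" "lam0 (half r) = lam r" if "r \<in> {0<..<r0}" for r
    using that half_bounds[of r] outer_mass_eq[of r] lam_eq[of r] outer_mass_pos[of r] by auto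
  ultimately show "continuous_on {0<..<r0} outer_mass" "continuous_on {0<..<r0} lam"
    by (auto elim: continuous_on_eq)
qed

lemma grad_nested:
  assumes "0 < r" "r < r0"
  shows "grad (masses r) (lam r) (nested_squares r) = 0"
  using grad_sq_0[OF half_bounds[OF assms]] half_bounds[OF assms] outer_mass_pos[OF assms]
  by (simp add: masses_mv nested_squares_sq lam_eq outer_mass_eq)

section \<open>Definiteness of the symmetric second variation\<close>

definition dd_form :: "real \<Rightarrow> real \<Rightarrow> real \<Rightarrow> real \<Rightarrow> real \<Rightarrow> real
      \<Rightarrow> real \<Rightarrow> real \<Rightarrow> real \<Rightarrow> real
    \<Rightarrow> real \<Rightarrow> real \<Rightarrow> real \<Rightarrow> real \<Rightarrow> real" where
  "dd_form a1 a2 a3 a4 b12 b13 b14 b23 b24 b34 y1 y2 y3 y4 =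
     a1 * y1\<^sup>2 + a2 * y2\<^sup>2 + a3 * y3\<^sup>2 + a4 * y4\<^sup>2
     + 2 * (b12 * (y1 * y2) + b13 * (y1 * y3) + b14 * (y1 * y4) + b23 * (y2 * y3) + b24 * (y2 * y4) + b34 * (y3 * y4))"

lemma abs_mult_bound:
  fixes b x y :: real
  assumes "\<bar>b\<bar> \<le> m"
  shows "2 * (b * (x * y)) \<ge> - m * (x\<^sup>2 + y\<^sup>2)"
proof -
  have "2 * \<bar>x * y\<bar> \<le> x\<^sup>2 + y\<^sup>2"
    using sum_squares_bound[of "\<bar>x\<bar>" "\<bar>y\<bar>"] by (simp add: abs_mult)
  then have "\<bar>b\<bar> * (2 * \<bar>x * y\<bar>) \<le> m * (x\<^sup>2 + y\<^sup>2)"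
    using assms by (intro mult_mono) auto
  moreover have "\<bar>2 * (b * (x * y))\<bar> = \<bar>b\<bar> * (2 * \<bar>x * y\<bar>)" by (simp add: abs_mult)
  ultimately show ?thesis by linarith
qed

text \<open>
  Diagonal dominance. Below, a form is first brought close to diagonal by a rational change of variables,
  found numerically from its triangular factorisation.
\<close>

lemma dd_form_pos:
  assumes m: "\<bar>b12\<bar> \<le> mp" "\<bar>b13\<bar> \<le> mq" "\<bar>b14\<bar> \<le> mr" "\<bar>b23\<bar> \<le> ms" "\<bar>b24\<bar> \<le> mt" "\<bar>b34\<bar> \<le> mu"
    and a: "mp + mq + mr < a1" "mp + ms + mt < a2" "mq + ms + mu < a3" "mr + mt + mu < a4"
    and nz: "y1 \<noteq> 0 \<or> y2 \<noteq> 0 \<or> y3 \<noteq> 0 \<or> y4 \<noteq> 0"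
  shows "dd_form a1 a2 a3 a4 b12 b13 b14 b23 b24 b34 y1 y2 y3 y4 > 0"
proof -
  have "dd_form a1 a2 a3 a4 b12 b13 b14 b23 b24 b34 y1 y2 y3 y4 \<ge>
     (a1 - (mp + mq + mr)) * y1\<^sup>2 + (a2 - (mp + ms + mt)) * y2\<^sup>2
     + (a3 - (mq + ms + mu)) * y3\<^sup>2 + (a4 - (mr + mt + mu)) * y4\<^sup>2"
    using abs_mult_bound[OF m(1), of y1 y2] abs_mult_bound[OF m(2), of y1 y3] abs_mult_bound[OF m(3), of y1 y4]
      abs_mult_bound[OF m(4), of y2 y3] abs_mult_bound[OF m(5), of y2 y4] abs_mult_bound[OF m(6), of y3 y4]
    unfolding dd_form_def by (simp add: algebra_simps)
  moreover have "(a1 - (mp + mq + mr)) * y1\<^sup>2 + (a2 - (mp + ms + mt)) * y2\<^sup>2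
     + (a3 - (mq + ms + mu)) * y3\<^sup>2 + (a4 - (mr + mt + mu)) * y4\<^sup>2 > 0" (is "?a + ?b + ?c + ?d > 0")
  proof -
    have "?a \<ge> 0" "?b \<ge> 0" "?c \<ge> 0" "?d \<ge> 0" using a by auto
    moreover have "?a > 0 \<or> ?b > 0 \<or> ?c > 0 \<or> ?d > 0" using a nz by auto
    ultimately show ?thesis by linarith
  qed
  ultimately show ?thesis by linarith
qed

definition dd_form3 :: "real \<Rightarrow> real \<Rightarrow> real \<Rightarrow> real \<Rightarrow> real \<Rightarrow> real
      \<Rightarrow> real \<Rightarrow> real \<Rightarrow> real \<Rightarrow> real" where
  "dd_form3 a1 a2 a3 b12 b13 b23 y1 y2 y3 =
     a1 * y1\<^sup>2 + a2 * y2\<^sup>2 + a3 * y3\<^sup>2 + 2 * (b12 * (y1 * y2) + b13 * (y1 * y3) + b23 * (y2 * y3))"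

lemma dd_form3_pos:
  assumes "\<bar>b12\<bar> \<le> mp" "\<bar>b13\<bar> \<le> mq" "\<bar>b23\<bar> \<le> ms"
    and "mp + mq < a1" "mp + ms < a2" "mq + ms < a3" "y1 \<noteq> 0 \<or> y2 \<noteq> 0 \<or> y3 \<noteq> 0"
  shows "dd_form3 a1 a2 a3 b12 b13 b23 y1 y2 y3 > 0"
  using dd_form_pos[of b12 mp b13 mq 0 0 b23 ms 0 0 0 0 a1 a2 a3 1 y1 y2 y3 0] assms
  by (simp add: dd_form_def dd_form3_def)

definition form2 :: "real \<Rightarrow> real \<Rightarrow> real \<Rightarrow> real \<Rightarrow> real \<Rightarrow> real" where
  "form2 p q r x y = p * x\<^sup>2 + 2 * q * (x * y) + r * y\<^sup>2"

lemma form2_pos: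
  assumes "\<bar>q\<bar> < p" "\<bar>q\<bar> < r" "x \<noteq> 0 \<or> y \<noteq> 0"
  shows "form2 p q r x y > 0"
  using dd_form_pos[of q "\<bar>q\<bar>" 0 0 0 0 0 0 0 0 0 0 p r 1 1 x y 0 0] assms
  by (simp add: dd_form_def form2_def)

text \<open>Block of the shifts \<open>f0\<close>, \<open>F0\<close> and the trapezoidal modes
  \<open>g1\<close>, \<open>G1\<close> of the two squares. \<open>A\<close> and \<open>B\<close>
  couple the trapezoidal modes to the relative shift \<open>f0 - F0\<close>.\<close>

definition E_form :: "real \<Rightarrow> real \<Rightarrow> real \<Rightarrow> real \<Rightarrow> real \<Rightarrow> real \<Rightarrow> real \<Rightarrow> real
    \<Rightarrow> real \<Rightarrow> real \<Rightarrow> real \<Rightarrow> real \<Rightarrow> real" where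
  "E_form ef eg eF eG h hp A B f0 g1 F0 G1 =
     ef * f0\<^sup>2 + eg * g1\<^sup>2 + eF * F0\<^sup>2 + eG * G1\<^sup>2
     + 2 * (A * (f0 * g1 - F0 * g1) + B * (F0 * G1 - f0 * G1) - h * (f0 * F0) - hp * (g1 * G1))"

lemma rn_2_mult_square: "x > 0 \<Longrightarrow> rn (2 * x\<^sup>2) 3 = rn 2 3 / x ^ 3"
  by (simp add: rn_def real_sqrt_mult power_mult_distrib)

lemma rn_2_bounds: "3535533/10000000 \<le> rn 2 3" "rn 2 3 \<le> 1767767/5000000"
proof -
  have "1 / (1414213563/1000000000) ^ 3 \<le> rn 2 3" by (rule rn_ge) (auto simp: power2_eq_square)
  then show "3535533/10000000 \<le> rn 2 3" by (simp add: power3_eq_cube)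
  have "rn 2 3 \<le> 1 / (1414213562/1000000000) ^ 3" by (rule rn_le) (auto simp: power2_eq_square)
  then show "rn 2 3 \<le> 1767767/5000000" by (simp add: power3_eq_cube)
qed

context
  fixes k :: real
  assumes k: "0 < k" "k < 1/2"
begin

lemma rn_inner: "rn (4 * k\<^sup>2) 3 = 1 / (8 * k ^ 3)" "rn (8 * k\<^sup>2) 3 = rn 2 3 / (8 * k ^ 3)"
proof -
  have "rn (4 * k\<^sup>2) 3 = 1 / (2 * k) ^ 3"
    using k by (simp add: rn_def real_sqrt_mult)
  then show "rn (4 * k\<^sup>2) 3 = 1 / (8 * k ^ 3)" by (simp add: power_mult_distrib)
  show "rn (8 * k\<^sup>2) 3 = rn 2 3 / (8 * k ^ 3)"
    using rn_2_mult_square[of "2 * k"] k by (simp add: power_mult_distrib)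
qed

lemma rn_so: "Rs k 3 = rn 2 3 / (1/2 - k) ^ 3" "Ro k 3 = rn 2 3 / (1/2 + k) ^ 3"
  using k by (simp_all only: rn_2_mult_square diff_gt_0_iff_gt add_pos_pos zero_less_divide_1_iff zero_less_numeral)

lemma pull_rn: "pull k = rn 2 3 / (1/2 - k)\<^sup>2 + rn 2 3 / (1/2 + k)\<^sup>2 + Rg k 3"
  unfolding pull_def rn_so using k by (simp add: power3_eq_cube power2_eq_square)

lemma num_rn: "num k = 2 * (1 / (8 * k ^ 3)) * (1 + rn 2 3) - 2 * pull k"
  unfolding num_def rn_inner using k by (simp add: field_simps)

lemma den_rn: "den k = 2 * (1 + rn 2 3) - (rn 2 3 / (1/2 + k)\<^sup>2 - rn 2 3 / (1/2 - k)\<^sup>2) / k - 2 * Rg k 3"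
proof -
  have "(1/2 + k) * Ro k 3 = rn 2 3 / (1/2 + k)\<^sup>2" "(1/2 - k) * Rs k 3 = rn 2 3 / (1/2 - k)\<^sup>2"
    unfolding rn_so using k by (simp_all add: power3_eq_cube power2_eq_square)
  then show ?thesis unfolding den_def using k by (simp add: add_divide_distrib)
qed

lemma rn_g5: "Rg k 5 = Rg k 3 / (1/2 + 2 * k\<^sup>2)"
proof -
  have Z: "1/2 + 2 * k\<^sup>2 > 0" by (simp add: add_pos_nonneg)
  show ?thesis
    unfolding rn_5[OF Z, symmetric] by (rule nonzero_mult_div_cancel_left[symmetric]) (use Z in linarith)
qed

end

lemma mult_bounds:
  fixes a b x y :: real
  assumes "0 \<le> a" "a \<le> x" "x \<le> b" "0 \<le> c" "c \<le> y" "y \<le> e"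
  shows "a * c \<le> x * y" "x * y \<le> b * e"
  using assms by (auto intro: mult_mono)

section \<open>The blocks of the second variation and their signs at half sides 1/7, 1/6 and
  1/5\<close>

definition "mass k = num k / den k"
definition "eh k = 2 * mass k * (Rs k 3 + Ro k 3) + 4 * mass k * Rg k 3"
definition "ehp k = 2 * mass k * (Rs k 3 + Ro k 3) - 4 * mass k * Rg k 3"
definition "eef k = 4 * lam0 k * mass k + eh k"
definition "eeF k = 4 * lam0 k + eh k"
definition "eeg k = 4 * lam0 k * mass k + 8 * mass k * mass k + eh k"
definition "eeG k = 4 * lam0 k + 8 * rn (4 * k\<^sup>2) 3 + eh k"
definition "eA k = 6 * mass k * (Rs k 3 + Ro k 3) + 24 * mass k * (1/4 - k\<^sup>2) * Rg k 5"
definition "eB k = 6 * mass k * (Rs k 3 + Ro k 3) - 24 * mass k * (1/4 - k\<^sup>2) * Rg k 5"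
definition "qA11 k = 8 * lam0 k * mass k + 32 * mass k * mass k * (1 + rn 2 3) + 16 * mass k * (Rs k 3 + Ro k 3)
   - 16 * mass k * Rg k 3 + 24 * mass k * Rg k 5"
definition "qA12 k = 16 * mass k * (Ro k 3 - Rs k 3) + 48 * k * mass k * Rg k 5"
definition "qA22 k = 8 * lam0 k + 32 * (rn (4 * k\<^sup>2) 3 + rn (8 * k\<^sup>2) 3) + 16 * mass k * (Rs k 3 + Ro k 3)
   - 16 * mass k * Rg k 3 + 96 * k\<^sup>2 * mass k * Rg k 5"
definition "qB11 k = 8 * lam0 k * mass k + 32 * mass k * mass k - 16 * mass k * mass k * rn 2 3
   - 8 * mass k * (Rs k 3 + Ro k 3) - 16 * mass k * Rg k 3 + 96 * k\<^sup>2 * mass k * Rg k 5"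
definition "qB12 k = 8 * mass k * (Rs k 3 - Ro k 3) + 48 * k * mass k * Rg k 5"
definition "qB22 k = 8 * lam0 k + 32 * rn (4 * k\<^sup>2) 3 - 16 * rn (8 * k\<^sup>2) 3
   - 8 * mass k * (Rs k 3 + Ro k 3) - 16 * mass k * Rg k 3 + 24 * mass k * Rg k 5"

abbreviation "blockA k \<equiv> form2 (qA11 k) (qA12 k) (qA22 k)"
abbreviation "blockB k \<equiv> form2 (qB11 k) (qB12 k) (qB22 k)"
abbreviation "blockE k \<equiv> E_form (eef k) (eeg k) (eeF k) (eeG k) (eh k) (ehp k) (eA k) (eB k)"

text \<open>The symmetries of the square separate the modes: \<open>c1\<close>, \<open>c2\<close>
  dilate the squares, \<open>a\<close>, \<open>b\<close> stretch them into rectangles, and both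
  kinds are even under the reflection of the first coordinate, while shifts and trapezoidal modes
  are odd. Exchanging the two coordinates distinguishes the first two kinds.\<close>

lemma quad_form_split:
  assumes k: "0 < k" "k < 1/2"
  shows "quad_form (mass k) (lam0 k) k f0 (c1 + a) (c1 - a) g1 F0 (c2 + b) (c2 - b) G1
    = blockA k c1 c2 + blockB k a b
      + blockE k f0 g1 F0 G1"
proof -
  define M where "M = mass k"
  define l where "l = lam0 k"
  define R where "R = Rg k 5"
  have R: "Rg k 3 = (1/2 + 2 * k\<^sup>2) * R"
    unfolding R_def by (rule rn_5[symmetric]) (simp add: add_pos_nonneg)
  show ?thesis
    unfolding quad_form_def quad_ring_def quad_diag_def form2_def E_form_def
      eef_def eeF_def eeg_def eeG_def eh_def ehp_def eA_def eB_def qA11_def qA12_def qA22_def qB11_def qB12_def qB22_def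
      M_def[symmetric] l_def[symmetric] R_def[symmetric] R
    by Groebner_Basis.algebra
qed

lemmas entry_defs = eef_def eeF_def eeg_def eeG_def eh_def ehp_def eA_def eB_def
  qA11_def qA12_def qA22_def qB11_def qB12_def qB22_def mass_def

text \<open>After the change of variables all entries are linear in the eight coefficients, so
  diagonal dominance over the whole box of bounds is a linear check. The values \<open>mp\<close> to
  \<open>mu\<close> are rounded bounds for the off-diagonal entries.\<close>

lemma E_pos_7:
  assumes "8358/5 \<le> ef" "ef \<le> 16719/10"
    and "829/2 \<le> eF" "eF \<le> 2074/5"
    and "23719/10 \<le> eg" "eg \<le> 11861/5"
    and "1515/2 \<le> eG" "eG \<le> 3789/5"
    and "2641/10 \<le> h" "h \<le> 1322/5"
    and "759/10 \<le> hp" "hp \<le> 381/5"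
    and "7499/10 \<le> A" "A \<le> 3751/5"
    and "1353/5 \<le> B" "B \<le> 2709/10"
    and nz: "f0 \<noteq> 0 \<or> g1 \<noteq> 0 \<or> F0 \<noteq> 0 \<or> G1 \<noteq> 0"
  shows "E_form ef eg eF eG h hp A B f0 g1 F0 G1 > 0"
proof -
  have "E_form ef eg eF eG h hp A B f0 g1 F0 G1 = dd_form (ef) (81/400 * ef - 9/10 * A + eg) (9/40000 * ef - 591/1000 * A - 3/100
        * h + 9/100 * eg + eF) (269361/16000000 * ef - 479439/400000 * A + 14013/40000 * h - 5919/2000 * B + 6561/40000 * eg + 81/100 * hp + 729/400 * eF + eG)
      (- 9/20 * ef + A) (3/200 * ef + 3/10 * A - h) (519/4000 * ef - 81/200 * A + 27/20 * h - B) (- 27/4000 * ef - 28/25 * A +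
            9/20 * h + 3/10 * eg) (- 4671/80000 * ef + 831/500 * A - 243/400 * h + 9/20 * B - 81/200 * eg - hp) (1557/800000 * ef
            + 16857/20000 * A - 219/2000 * h + 197/200 * B - 243/2000 * eg - 3/10 * hp - 27/20 * eF)
      (f0 + 9/20 * g1 - 3/20 * F0 - 3/20 * G1) (g1 - 3/10 * F0) (F0 + 27/20 * G1) (G1)"
    unfolding E_form_def dd_form_def by Groebner_Basis.algebra
  also have "\<dots> > 0"
    by (rule dd_form_pos[where mp = 7 and mq = 20 and mr = 5 and ms = 27 and mt = 85 and mu = 7])
       (use assms in \<open>auto simp: abs_le_iff\<close>)
  finally show ?thesis .
qed

text \<open>Positivity is asked only for \<open>F0 = 0\<close>; the direction in
  \<open>E_neg_6\<close> has \<open>F0 \<noteq> 0\<close> and spans a complement, so the two lemmas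
  together give exactly one negative direction of the block.\<close>

lemma E_pos_6:
  assumes "1343/2 \<le> ef" "ef \<le> 3359/5"
    and "517/2 \<le> eF" "eF \<le> 1294/5"
    and "8671/10 \<le> eg" "eg \<le> 4337/5"
    and "949/2 \<le> eG" "eG \<le> 2374/5"
    and "769/5 \<le> h" "h \<le> 1541/10"
    and "583/10 \<le> hp" "hp \<le> 293/5"
    and "4331/10 \<le> A" "A \<le> 2167/5"
    and "1019/5 \<le> B" "B \<le> 2041/10"
    and nz: "f0 \<noteq> 0 \<or> g1 \<noteq> 0 \<or> G1 \<noteq> 0"
  shows "E_form ef eg eF eG h hp A B f0 g1 0 G1 > 0"
proof -
  have "E_form ef eg eF eG h hp A B f0 g1 0 G1 = ef * f0\<^sup>2 + eg * g1\<^sup>2 + eG * G1\<^sup>2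
      + 2 * (A * (f0 * g1) - B * (f0 * G1) - hp * (g1 * G1))"
    by (simp add: E_form_def)
  also have "\<dots> = dd_form3 (ef) (169/400 * ef - 13/10 * A + eg) (5329/40000 * ef - 73/1000 * A - 73/100 * B + 1/100 * eg +
        1/5 * hp + eG) (- 13/20 * ef + A) (73/200 * ef - 1/10 * A - B) (- 949/4000 * ef + 43/100 * A + 13/20 * B - 1/10 * eg - hp)
      (f0 + 13/20 * g1 - 3/10 * G1) (g1 + 1/10 * G1) (G1)"
    unfolding dd_form3_def by Groebner_Basis.algebra
  also have "\<dots> > 0"
    by (rule dd_form3_pos[where mp = 8 and mq = 7 and ms = 20])
       (use assms in \<open>auto simp: abs_le_iff\<close>)
  finally show ?thesis .
qed

text \<open>The integer direction \<open>(2, -4, -5, 2)\<close> in \<open>(f0, g1, F0, G1)\<close>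
  also works in \<open>E_neg_5\<close>, so that one coordinate system serves \<open>r2\<close> and
  \<open>r3\<close>.\<close>

lemma E_neg_6:
  assumes "1343/2 \<le> ef" "ef \<le> 3359/5"
    and "517/2 \<le> eF" "eF \<le> 1294/5"
    and "8671/10 \<le> eg" "eg \<le> 4337/5"
    and "949/2 \<le> eG" "eG \<le> 2374/5"
    and "769/5 \<le> h" "h \<le> 1541/10"
    and "583/10 \<le> hp" "hp \<le> 293/5"
    and "4331/10 \<le> A" "A \<le> 2167/5"
    and "1019/5 \<le> B" "B \<le> 2041/10"
    and "v \<noteq> 0"
  shows "E_form ef eg eF eG h hp A B (2 * v) (- 4 * v) (- 5 * v) (2 * v) < 0"
proof -
  have "E_form ef eg eF eG h hp A B (2 * v) (- 4 * v) (- 5 * v) (2 * v)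
    = (4 * ef + 16 * eg + 25 * eF + 4 * eG + 20 * h + 16 * hp - 56 * A - 28 * B) * v\<^sup>2"
    unfolding E_form_def by (simp add: power2_eq_square algebra_simps)
  also have "\<dots> < 0" using assms by (intro mult_neg_pos) auto
  finally show ?thesis .
qed

lemma E_pos_5:
  assumes "1144/5 \<le> ef" "ef \<le> 2291/10"
    and "758/5 \<le> eF" "eF \<le> 1519/10"
    and "2609/10 \<le> eg" "eg \<le> 1306/5"
    and "1383/5 \<le> eG" "eG \<le> 2769/10"
    and "373/5 \<le> h" "h \<le> 749/10"
    and "383/10 \<le> hp" "hp \<le> 193/5"
    and "209 \<le> A" "A \<le> 2093/10"
    and "651/5 \<le> B" "B \<le> 261/2"
    and nz: "f0 \<noteq> 0 \<or> g1 \<noteq> 0 \<or> G1 \<noteq> 0"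
  shows "E_form ef eg eF eG h hp A B f0 g1 0 G1 > 0"
proof -
  have "E_form ef eg eF eG h hp A B f0 g1 0 G1 = ef * f0\<^sup>2 + eg * g1\<^sup>2 + eG * G1\<^sup>2
      + 2 * (A * (f0 * g1) - B * (f0 * G1) - hp * (g1 * G1))"
    by (simp add: E_form_def)
  also have "\<dots> = dd_form3 (ef) (81/100 * ef - 9/5 * A + eg) (100489/40000 * ef - 7291/2000 * A - 317/100 * B + 529/400 * eg
        + 23/10 * hp + eG) (- 9/10 * ef + A) (317/200 * ef - 23/20 * A - B) (- 2853/2000 * ef + 131/50 * A + 9/10 * B - 23/20 * eg - hp)
      (f0 + 9/10 * g1 - 11/20 * G1) (g1 + 23/20 * G1) (G1)"
    unfolding dd_form3_def by Groebner_Basis.algebra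
  also have "\<dots> > 0"
    by (rule dd_form3_pos[where mp = 8 and mq = 13 and ms = 5])
       (use assms in \<open>auto simp: abs_le_iff\<close>)
  finally show ?thesis .
qed

lemma E_neg_5:
  assumes "1144/5 \<le> ef" "ef \<le> 2291/10"
    and "758/5 \<le> eF" "eF \<le> 1519/10"
    and "2609/10 \<le> eg" "eg \<le> 1306/5"
    and "1383/5 \<le> eG" "eG \<le> 2769/10"
    and "373/5 \<le> h" "h \<le> 749/10"
    and "383/10 \<le> hp" "hp \<le> 193/5"
    and "209 \<le> A" "A \<le> 2093/10"
    and "651/5 \<le> B" "B \<le> 261/2"
    and "v \<noteq> 0"
  shows "E_form ef eg eF eG h hp A B (2 * v) (- 4 * v) (- 5 * v) (2 * v) < 0"
proof -
  have "E_form ef eg eF eG h hp A B (2 * v) (- 4 * v) (- 5 * v) (2 * v)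
    = (4 * ef + 16 * eg + 25 * eF + 4 * eG + 20 * h + 16 * hp - 56 * A - 28 * B) * v\<^sup>2"
    unfolding E_form_def by (simp add: power2_eq_square algebra_simps)
  also have "\<dots> < 0" using assms by (intro mult_neg_pos) auto
  finally show ?thesis .
qed

text \<open>The entries are polynomials in \<open>d\<close>, the inverse cube of
  \<open>sqrt 2\<close>, in \<open>g\<close>, the inverse cube of the distance between adjacent
  corners of the two squares, in the mass \<open>M\<close> and in the multiplier \<open>l\<close>.
  All products that occur are bounded beforehand, which leaves linear arithmetic.\<close>

lemma entries_7:
  shows "8358/5 \<le> eef (1/7)" "eef (1/7) \<le> 16719/10"
    "829/2 \<le> eeF (1/7)" "eeF (1/7) \<le> 2074/5"
    "23719/10 \<le> eeg (1/7)" "eeg (1/7) \<le> 11861/5"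
    "1515/2 \<le> eeG (1/7)" "eeG (1/7) \<le> 3789/5"
    "2641/10 \<le> eh (1/7)" "eh (1/7) \<le> 1322/5"
    "759/10 \<le> ehp (1/7)" "ehp (1/7) \<le> 381/5"
    "7499/10 \<le> eA (1/7)" "eA (1/7) \<le> 3751/5"
    "1353/5 \<le> eB (1/7)" "eB (1/7) \<le> 2709/10"
    "8633 \<le> qA11 (1/7)" "qA11 (1/7) \<le> 8637"
    "-666 \<le> qA12 (1/7)" "qA12 (1/7) \<le> -662"
    "3225 \<le> qA22 (1/7)" "qA22 (1/7) \<le> 3229"
    "41491/10 \<le> qB11 (1/7)" "qB11 (1/7) \<le> 8299/2"
    "3897/5 \<le> qB12 (1/7)" "qB12 (1/7) \<le> 7797/10"
    "7086/5 \<le> qB22 (1/7)" "qB22 (1/7) \<le> 2835/2"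
proof -
  define d where "d = rn 2 3"
  define g where "g = Rg (1/7) 3"
  define M where "M = num (1/7) / den (1/7)"
  define l where "l = lam0 (1/7)"
  have d: "3535533/10000000 \<le> d" "d \<le> 1767767/5000000" unfolding d_def by (rule rn_2_bounds)+
  have g: "1005739/400000 \<le> g" "g \<le> 6285869/2500000"
  proof -
    \<comment> \<open>The fraction is an upper bound for \<open>sqrt (1/2 + 2/49)\<close>, the
      distance that \<open>g\<close> belongs to, at nine decimals; the one below is a lower
      bound.\<close>
    have "1 / (735402153/1000000000) ^ 3 \<le> g" unfolding g_def by (rule rn_ge) (auto simp: power2_eq_square)
    then show "1005739/400000 \<le> g" by (simp add: power3_eq_cube)
    have "g \<le> 1 / (91925269/125000000) ^ 3" unfolding g_def by (rule rn_le) (auto simp: power2_eq_square)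
    then show "g \<le> 6285869/2500000" by (simp add: power3_eq_cube)
  qed
  have n: "num (1/7) = 343/4 + 528367/8100 * d - 2 * g"
    and p: "pull (1/7) = 20776/2025 * d + g"
    and e: "den (1/7) = 2 + 80882/2025 * d - 2 * g"
    by (simp_all add: num_rn pull_rn den_rn d_def g_def power3_eq_cube power2_eq_square field_simps)
  have dp: "den (1/7) > 0" by (rule den_pos) auto
  \<comment> \<open>Comparing \<open>num\<close> with multiples of \<open>den\<close> keeps the
    estimate of the quotient \<open>M\<close> linear in \<open>d\<close> and
    \<open>g\<close>.\<close>
  have "116949/12500 * den (1/7) \<le> num (1/7)" "num (1/7) \<le> 935593/100000 * den (1/7)"
    unfolding n p e using d g by simp_all
  then have M: "116949/12500 \<le> M" "M \<le> 935593/100000"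
    unfolding M_def by (simp_all only: pos_le_divide_eq[OF dp] pos_divide_le_eq[OF dp])
  have Md: "330781/100000 \<le> M * d" "M * d \<le> 330783/100000" using mult_bounds[OF _ M _ d] by simp_all
  have Mg: "2352403/100000 \<le> M * g" "M * g \<le> 2352407/100000" using mult_bounds[OF _ M _ g] by simp_all
  have MM: "218833/2500 \<le> M * M" "M * M \<le> 175067/2000" using mult_bounds[OF _ M _ M] by simp_all
  have MMd: "77369/2500 \<le> M * M * d" "M * M * d \<le> 154739/5000" using mult_bounds[OF _ MM _ d] by simp_all
  have "l = 2 * M + 2 * (M * d) + 2 * pull (1/7)" unfolding l_def lam0_def M_def[symmetric] d_def[symmetric] by (simp add: algebra_simps)
  then have l: "94027/2500 \<le> l" "l \<le> 37611/1000" using M Md p d g by simp_all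
  have lM: "351883/1000 \<le> l * M" "l * M \<le> 175943/500" using mult_bounds[OF _ l _ M] by simp_all
  note b = d g M Md Mg MM MMd l lM
  have r: "Rs (1/7) 3 = 2744/125 * d" "Ro (1/7) 3 = 2744/729 * d"
    "Rg (1/7) 5 = 98/53 * g"
    "rn (4 * (1/7)\<^sup>2) 3 = 343/8" "rn (8 * (1/7)\<^sup>2) 3 = 343/8 * d"
    using rn_so[of "(1/7)"] rn_g5[of "(1/7)"] rn_inner[of "(1/7)"]
    by (simp_all add: d_def g_def power3_eq_cube power2_eq_square)
  show "8358/5 \<le> eef (1/7)" "eef (1/7) \<le> 16719/10"
    "829/2 \<le> eeF (1/7)" "eeF (1/7) \<le> 2074/5"
    "23719/10 \<le> eeg (1/7)" "eeg (1/7) \<le> 11861/5"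
    "1515/2 \<le> eeG (1/7)" "eeG (1/7) \<le> 3789/5"
    "2641/10 \<le> eh (1/7)" "eh (1/7) \<le> 1322/5"
    "759/10 \<le> ehp (1/7)" "ehp (1/7) \<le> 381/5"
    "7499/10 \<le> eA (1/7)" "eA (1/7) \<le> 3751/5"
    "1353/5 \<le> eB (1/7)" "eB (1/7) \<le> 2709/10"
    "8633 \<le> qA11 (1/7)" "qA11 (1/7) \<le> 8637"
    "-666 \<le> qA12 (1/7)" "qA12 (1/7) \<le> -662"
    "3225 \<le> qA22 (1/7)" "qA22 (1/7) \<le> 3229"
    "41491/10 \<le> qB11 (1/7)" "qB11 (1/7) \<le> 8299/2"
    "3897/5 \<le> qB12 (1/7)" "qB12 (1/7) \<le> 7797/10"
    "7086/5 \<le> qB22 (1/7)" "qB22 (1/7) \<le> 2835/2"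
    unfolding entry_defs r M_def[symmetric] l_def[symmetric] g_def[symmetric] d_def[symmetric]
    using b by (simp_all add: algebra_simps power2_eq_square)
qed

lemma entries_6:
  shows "1343/2 \<le> eef (1/6)" "eef (1/6) \<le> 3359/5"
    "517/2 \<le> eeF (1/6)" "eeF (1/6) \<le> 1294/5"
    "8671/10 \<le> eeg (1/6)" "eeg (1/6) \<le> 4337/5"
    "949/2 \<le> eeG (1/6)" "eeG (1/6) \<le> 2374/5"
    "769/5 \<le> eh (1/6)" "eh (1/6) \<le> 1541/10"
    "583/10 \<le> ehp (1/6)" "ehp (1/6) \<le> 293/5"
    "4331/10 \<le> eA (1/6)" "eA (1/6) \<le> 2167/5"
    "1019/5 \<le> eB (1/6)" "eB (1/6) \<le> 2041/10"
    "3266 \<le> qA11 (1/6)" "qA11 (1/6) \<le> 3270"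
    "-490 \<le> qA12 (1/6)" "qA12 (1/6) \<le> -486"
    "2092 \<le> qA22 (1/6)" "qA22 (1/6) \<le> 2096"
    "11207/10 \<le> qB11 (1/6)" "qB11 (1/6) \<le> 1121"
    "2511/5 \<le> qB12 (1/6)" "qB12 (1/6) \<le> 1005/2"
    "1641/2 \<le> qB22 (1/6)" "qB22 (1/6) \<le> 4104/5"
proof -
  define d where "d = rn 2 3"
  define g where "g = Rg (1/6) 3"
  define M where "M = num (1/6) / den (1/6)"
  define l where "l = lam0 (1/6)"
  have d: "3535533/10000000 \<le> d" "d \<le> 1767767/5000000" unfolding d_def by (rule rn_2_bounds)+
  have g: "12074767/5000000 \<le> g" "g \<le> 4829907/2000000"
  proof -
    have "1 / (745355993/1000000000) ^ 3 \<le> g" unfolding g_def by (rule rn_ge) (auto simp: power2_eq_square)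
    then show "12074767/5000000 \<le> g" by (simp add: power3_eq_cube)
    have "g \<le> 1 / (93169499/125000000) ^ 3" unfolding g_def by (rule rn_le) (auto simp: power2_eq_square)
    then show "g \<le> 4829907/2000000" by (simp add: power3_eq_cube)
  qed
  have n: "num (1/6) = 54 + 63/2 * d - 2 * g"
    and p: "pull (1/6) = 45/4 * d + g"
    and e: "den (1/6) = 2 + 85/2 * d - 2 * g"
    by (simp_all add: num_rn pull_rn den_rn d_def g_def power3_eq_cube power2_eq_square field_simps)
  have dp: "den (1/6) > 0" by (rule den_pos) auto
  have "494477/100000 * den (1/6) \<le> num (1/6)" "num (1/6) \<le> 247239/50000 * den (1/6)"
    unfolding n p e using d g by simp_all
  then have M: "494477/100000 \<le> M" "M \<le> 247239/50000"
    unfolding M_def by (simp_all only: pos_le_divide_eq[OF dp] pos_divide_le_eq[OF dp])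
  have Md: "174823/100000 \<le> M * d" "M * d \<le> 6993/4000" using mult_bounds[OF _ M _ d] by simp_all
  have Mg: "597069/50000 \<le> M * g" "M * g \<le> 597071/50000" using mult_bounds[OF _ M _ g] by simp_all
  have MM: "244507/10000 \<le> M * M" "M * M \<le> 244509/10000" using mult_bounds[OF _ M _ M] by simp_all
  have MMd: "43223/5000 \<le> M * M * d" "M * M * d \<le> 86447/10000" using mult_bounds[OF _ MM _ d] by simp_all
  have "l = 2 * M + 2 * (M * d) + 2 * pull (1/6)" unfolding l_def lam0_def M_def[symmetric] d_def[symmetric] by (simp add: algebra_simps)
  then have l: "65427/2500 \<le> l" "l \<le> 26171/1000" using M Md p d g by simp_all
  have lM: "16176/125 \<le> l * M" "l * M \<le> 12941/100" using mult_bounds[OF _ l _ M] by simp_all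
  note b = d g M Md Mg MM MMd l lM
  have r: "Rs (1/6) 3 = 27 * d" "Ro (1/6) 3 = 27/8 * d"
    "Rg (1/6) 5 = 9/5 * g"
    "rn (4 * (1/6)\<^sup>2) 3 = 27" "rn (8 * (1/6)\<^sup>2) 3 = 27 * d"
    using rn_so[of "(1/6)"] rn_g5[of "(1/6)"] rn_inner[of "(1/6)"]
    by (simp_all add: d_def g_def power3_eq_cube power2_eq_square)
  show "1343/2 \<le> eef (1/6)" "eef (1/6) \<le> 3359/5"
    "517/2 \<le> eeF (1/6)" "eeF (1/6) \<le> 1294/5"
    "8671/10 \<le> eeg (1/6)" "eeg (1/6) \<le> 4337/5"
    "949/2 \<le> eeG (1/6)" "eeG (1/6) \<le> 2374/5"
    "769/5 \<le> eh (1/6)" "eh (1/6) \<le> 1541/10"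
    "583/10 \<le> ehp (1/6)" "ehp (1/6) \<le> 293/5"
    "4331/10 \<le> eA (1/6)" "eA (1/6) \<le> 2167/5"
    "1019/5 \<le> eB (1/6)" "eB (1/6) \<le> 2041/10"
    "3266 \<le> qA11 (1/6)" "qA11 (1/6) \<le> 3270"
    "-490 \<le> qA12 (1/6)" "qA12 (1/6) \<le> -486"
    "2092 \<le> qA22 (1/6)" "qA22 (1/6) \<le> 2096"
    "11207/10 \<le> qB11 (1/6)" "qB11 (1/6) \<le> 1121"
    "2511/5 \<le> qB12 (1/6)" "qB12 (1/6) \<le> 1005/2"
    "1641/2 \<le> qB22 (1/6)" "qB22 (1/6) \<le> 4104/5"
    unfolding entry_defs r M_def[symmetric] l_def[symmetric] g_def[symmetric] d_def[symmetric]
    using b by (simp_all add: algebra_simps power2_eq_square)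
qed

text \<open>In contrast to 1/7 and 1/6, the bounds for \<open>qB11\<close>, \<open>qB12\<close> and
  \<open>qB22\<close> make \<open>blockB\<close> indefinite here; this is the second negative
  direction.\<close>

lemma entries_5:
  shows "1144/5 \<le> eef (1/5)" "eef (1/5) \<le> 2291/10"
    "758/5 \<le> eeF (1/5)" "eeF (1/5) \<le> 1519/10"
    "2609/10 \<le> eeg (1/5)" "eeg (1/5) \<le> 1306/5"
    "1383/5 \<le> eeG (1/5)" "eeG (1/5) \<le> 2769/10"
    "373/5 \<le> eh (1/5)" "eh (1/5) \<le> 749/10"
    "383/10 \<le> ehp (1/5)" "ehp (1/5) \<le> 193/5"
    "209 \<le> eA (1/5)" "eA (1/5) \<le> 2093/10"
    "651/5 \<le> eB (1/5)" "eB (1/5) \<le> 261/2"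
    "1048 \<le> qA11 (1/5)" "qA11 (1/5) \<le> 1052"
    "-313 \<le> qA12 (1/5)" "qA12 (1/5) \<le> -309"
    "1238 \<le> qA22 (1/5)" "qA22 (1/5) \<le> 1242"
    "1451/10 \<le> qB11 (1/5)" "qB11 (1/5) \<le> 291/2"
    "1341/5 \<le> qB12 (1/5)" "qB12 (1/5) \<le> 537/2"
    "2271/5 \<le> qB22 (1/5)" "qB22 (1/5) \<le> 909/2"
proof -
  define d where "d = rn 2 3"
  define g where "g = Rg (1/5) 3"
  define M where "M = num (1/5) / den (1/5)"
  define l where "l = lam0 (1/5)"
  have d: "3535533/10000000 \<le> d" "d \<le> 1767767/5000000" unfolding d_def by (rule rn_2_bounds)+
  have g: "70747/31250 \<le> g" "g \<le> 22639041/10000000"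
  proof -
    have "1 / (761577311/1000000000) ^ 3 \<le> g" unfolding g_def by (rule rn_ge) (auto simp: power2_eq_square)
    then show "70747/31250 \<le> g" by (simp add: power3_eq_cube)
    have "g \<le> 1 / (76157731/100000000) ^ 3" unfolding g_def by (rule rn_le) (auto simp: power2_eq_square)
    then show "g \<le> 22639041/10000000" by (simp add: power3_eq_cube)
  qed
  have n: "num (1/5) = 125/4 + 8725/1764 * d - 2 * g"
    and p: "pull (1/5) = 5800/441 * d + g"
    and e: "den (1/5) = 2 + 20882/441 * d - 2 * g"
    by (simp_all add: num_rn pull_rn den_rn d_def g_def power3_eq_cube power2_eq_square field_simps)
  have dp: "den (1/5) > 0" by (rule den_pos) auto
  have "200309/100000 * den (1/5) \<le> num (1/5)" "num (1/5) \<le> 20031/10000 * den (1/5)"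
    unfolding n p e using d g by simp_all
  then have M: "200309/100000 \<le> M" "M \<le> 20031/10000"
    unfolding M_def by (simp_all only: pos_le_divide_eq[OF dp] pos_divide_le_eq[OF dp])
  have Md: "70819/100000 \<le> M * d" "M * d \<le> 70821/100000" using mult_bounds[OF _ M _ d] by simp_all
  have Mg: "11337/2500 \<le> M * g" "M * g \<le> 453483/100000" using mult_bounds[OF _ M _ g] by simp_all
  have MM: "40123/10000 \<le> M * M" "M * M \<le> 321/80" using mult_bounds[OF _ M _ M] by simp_all
  have MMd: "2837/2000 \<le> M * M * d" "M * M * d \<le> 14187/10000" using mult_bounds[OF _ MM _ d] by simp_all
  have "l = 2 * M + 2 * (M * d) + 2 * pull (1/5)" unfolding l_def lam0_def M_def[symmetric] d_def[symmetric] by (simp add: algebra_simps)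
  then have l: "192501/10000 \<le> l" "l \<le> 192503/10000" using M Md p d g by simp_all
  have lM: "38559/1000 \<le> l * M" "l * M \<le> 38561/1000" using mult_bounds[OF _ l _ M] by simp_all
  note b = d g M Md Mg MM MMd l lM
  have r: "Rs (1/5) 3 = 1000/27 * d" "Ro (1/5) 3 = 1000/343 * d"
    "Rg (1/5) 5 = 50/29 * g"
    "rn (4 * (1/5)\<^sup>2) 3 = 125/8" "rn (8 * (1/5)\<^sup>2) 3 = 125/8 * d"
    using rn_so[of "(1/5)"] rn_g5[of "(1/5)"] rn_inner[of "(1/5)"]
    by (simp_all add: d_def g_def power3_eq_cube power2_eq_square)
  show "1144/5 \<le> eef (1/5)" "eef (1/5) \<le> 2291/10"
    "758/5 \<le> eeF (1/5)" "eeF (1/5) \<le> 1519/10"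
    "2609/10 \<le> eeg (1/5)" "eeg (1/5) \<le> 1306/5"
    "1383/5 \<le> eeG (1/5)" "eeG (1/5) \<le> 2769/10"
    "373/5 \<le> eh (1/5)" "eh (1/5) \<le> 749/10"
    "383/10 \<le> ehp (1/5)" "ehp (1/5) \<le> 193/5"
    "209 \<le> eA (1/5)" "eA (1/5) \<le> 2093/10"
    "651/5 \<le> eB (1/5)" "eB (1/5) \<le> 261/2"
    "1048 \<le> qA11 (1/5)" "qA11 (1/5) \<le> 1052"
    "-313 \<le> qA12 (1/5)" "qA12 (1/5) \<le> -309"
    "1238 \<le> qA22 (1/5)" "qA22 (1/5) \<le> 1242"
    "1451/10 \<le> qB11 (1/5)" "qB11 (1/5) \<le> 291/2"
    "1341/5 \<le> qB12 (1/5)" "qB12 (1/5) \<le> 537/2"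
    "2271/5 \<le> qB22 (1/5)" "qB22 (1/5) \<le> 909/2"
    unfolding entry_defs r M_def[symmetric] l_def[symmetric] g_def[symmetric] d_def[symmetric]
    using b by (simp_all add: algebra_simps power2_eq_square)
qed

section \<open>The reduced problem\<close>

lemma place_linear:
  "place (a + a') (b + b') (c + c') (d + d') (e + e') (f + f') (g + g') (h + h')
     = place a b c d e f g h + place a' b' c' d' e' f' g' h'"
  "place (s * a) (s * b) (s * c) (s * d) (s * e) (s * f) (s * g) (s * h) = s *\<^sub>R place a b c d e f g h"
  by (simp_all add: vec_eq_iff forall_8 forall_2 place_nth algebra_simps)

text \<open>
  Besides separating the three blocks of \<open>quad_form_split\<close>, these coordinates are chosen such that the
  8th one runs along the negative direction at \<open>r\<^sub>2\<close> and \<open>r\<^sub>3\<close>, and the 3rd one along the second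
  negative direction at \<open>r\<^sub>3\<close>.
\<close>

definition config :: "real^8 \<Rightarrow> real^2^8" where
  "config x = place (x$5 + 2 * x$8) (x$1 + x$3) (x$1 - x$3) (x$6 - 4 * x$8) (- 5 * x$8)
     (x$2 + (x$4 - 3/5 * x$3)) (x$2 - (x$4 - 3/5 * x$3)) (x$7 + 2 * x$8)"

lemma linear_config: "linear config"
proof (rule linearI)
  show "config (x + y) = config x + config y" for x y
    unfolding config_def place_linear(1)[symmetric] by (simp add: algebra_simps)
  show "config (s *\<^sub>R x) = s *\<^sub>R config x" for s x
    unfolding config_def place_linear(2)[symmetric] by (simp add: algebra_simps)
qed

lemma place_inject:
  "place a b c d e f g h = place a' b' c' d' e' f' g' h' \<longleftrightarrow>
     a = a' \<and> b = b' \<and> c = c' \<and> d = d' \<and> e = e' \<and> f = f' \<and> g = g' \<and> h = h'"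
proof
  assume "place a b c d e f g h = place a' b' c' d' e' f' g' h'"
  then have "\<forall>i k. place a b c d e f g h $ i $ k = place a' b' c' d' e' f' g' h' $ i $ k" by simp
  then show "a = a' \<and> b = b' \<and> c = c' \<and> d = d' \<and> e = e' \<and> f = f' \<and> g = g' \<and> h = h'"
    unfolding forall_8 forall_2 place_nth v2_nth by argo
qed simp

lemma inj_config: "config x = config y \<longleftrightarrow> x = y"
  unfolding config_def place_inject vec_eq_iff[of x y] forall_8 by auto

lemma place_in_range_config: "\<exists>y. place f0 f1 g0 g1 F0 F1 G0 G1 = config y"
proof
  show "place f0 f1 g0 g1 F0 F1 G0 G1 = config (vector [(f1 + g0) / 2, (F1 + G0) / 2, (f1 - g0) / 2,
      (F1 - G0) / 2 + 3/5 * ((f1 - g0) / 2), f0 + 2 * F0 / 5, g1 - 4 * F0 / 5, G1 + 2 * F0 / 5, - F0 / 5])"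
    unfolding config_def vector_8 place_inject by (simp add: field_simps)
qed

lemma symmetric_config: "symmetric (config x)"
  unfolding config_def by (rule symmetric_place)

definition branch :: "real \<Rightarrow> real^8" where
  "branch r = vector [1/2, half r, 0, 0, 0, 0, 0, 0]"

lemma config_branch: "config (branch r) = nested_squares r"
  unfolding config_def branch_def vector_8 nested_squares_sq sq_def by simp

text \<open>By the chain rule this is the gradient of \<open>phi\<close> composed with
  \<open>config\<close> in the eight coordinates.\<close>

definition red_grad :: "(real^8) \<times> real \<Rightarrow> real^8" where
  "red_grad z = (\<chi> k. grad (masses (snd z)) (lam (snd z)) (config (fst z)) \<bullet> config (axis k 1))"

text \<open>The sign condition is open and cannot degenerate inside \<open>Omega\<close>: if the
  coordinate became 0, bodies 1 and 4 would collide.\<close>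

definition red_dom :: "((real^8) \<times> real) set" where
  "red_dom = {z. config (fst z) \<in> Omega \<and> config (fst z) $ 1 $ 2 < 0 \<and> snd z \<in> {0<..<r0}}"

lemma chi_inner_config: "(\<chi> k. c \<bullet> config (axis k 1)) \<bullet> y = c \<bullet> config y"
proof -
  have y: "y = (\<Sum>k\<in>UNIV. y $ k *\<^sub>R axis k 1)"
    using basis_expansion[of y] by (simp add: scalar_mult_eq_scaleR)
  have "config y = (\<Sum>k\<in>UNIV. y $ k *\<^sub>R config (axis k 1))"
    by (subst y) (simp add: linear_sum[OF linear_config] linear_cmul[OF linear_config])
  then show ?thesis by (simp add: inner_vec_def[of _ y] inner_sum_right mult.commute)
qed

lemma red_grad_inner: "red_grad z \<bullet> y = grad (masses (snd z)) (lam (snd z)) (config (fst z)) \<bullet> config y"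
  unfolding red_grad_def by (rule chi_inner_config)

text \<open>The displacements \<open>config y\<close> exhaust the symmetric ones, so symmetric
  criticality turns a zero of the reduced gradient into a critical point of the full
  potential.\<close>

lemma red_grad_eq_0_iff: "red_grad z = 0 \<longleftrightarrow> grad (masses (snd z)) (lam (snd z)) (config (fst z)) = 0"
proof
  assume red_grad: "red_grad z = 0"
  show "grad (masses (snd z)) (lam (snd z)) (config (fst z)) = 0"
    unfolding masses_mv
  proof (rule grad_eq_0_iff[OF symmetric_config])
    fix f0 f1 g0 g1 F0 F1 G0 G1
    obtain y where "place f0 f1 g0 g1 F0 F1 G0 G1 = config y" using place_in_range_config by blast
    then show "place f0 f1 g0 g1 F0 F1 G0 G1 \<bullet> grad (mv (outer_mass (snd z))) (lam (snd z)) (config (fst z)) = 0"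
      using red_grad_inner[of z y] red_grad by (simp add: masses_mv inner_commute)
  qed
next
  assume g: "grad (masses (snd z)) (lam (snd z)) (config (fst z)) = 0"
  show "red_grad z = 0" unfolding red_grad_def g by (simp add: vec_eq_iff)
qed

lemma Omega_open: "open Omega"
proof -
  have eq: "Omega = (\<Inter>i\<in>UNIV. \<Inter>j\<in>UNIV. if i = j then UNIV else {q. q $ i \<noteq> q $ j})"
    by (auto simp: Omega_def)
  show ?thesis unfolding eq
    by (intro open_INT ballI finite_class.finite_UNIV) (auto intro!: open_Collect_neq continuous_intros)
qed

lemma continuous_config: "continuous_on S config"
  using linear_config linear_continuous_on linear_conv_bounded_linear by blast

lemma open_red_dom: "open red_dom"
proof -
  have c: "continuous_on UNIV (\<lambda>z::(real^8) \<times> real. config (fst z))"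
    by (intro continuous_on_compose2[OF continuous_config[of UNIV]] continuous_intros) auto
  have "open ((\<lambda>z::(real^8) \<times> real. config (fst z)) -` Omega)"
    using c Omega_open by (simp add: open_vimage)
  moreover have "open {z::(real^8) \<times> real. config (fst z) $ 1 $ 2 < 0}"
    using c by (intro open_Collect_less continuous_intros) auto
  moreover have "open {z::(real^8) \<times> real. 0 < snd z}" "open {z::(real^8) \<times> real. snd z < r0}"
    by (intro open_Collect_less continuous_intros)+
  moreover have "red_dom = (\<lambda>z. config (fst z)) -` Omega \<inter> {z. config (fst z) $ 1 $ 2 < 0} \<inter> {z. 0 < snd z} \<inter> {z. snd z < r0}"
    by (auto simp: red_dom_def)
  ultimately show ?thesis by (metis open_Int)
qed

lemma branch_in_red_dom:
  assumes "t \<in> {0<..<r0}"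
  shows "(branch t, t) \<in> red_dom"
  using assms sq_Omega[of "half t"] half_bounds[of t]
  by (simp add: red_dom_def config_branch nested_squares_sq sq_nth)

lemma red_grad_branch: "t \<in> {0<..<r0} \<Longrightarrow> red_grad (branch t, t) = 0"
  by (simp add: red_grad_eq_0_iff config_branch grad_nested)

lemma continuous_branch: "continuous_on S branch"
proof -
  have "continuous_on S (\<lambda>t. \<chi> i. branch t $ i)"
  proof (rule continuous_on_vec_lambda)
    have "\<forall>i. continuous_on S (\<lambda>t. branch t $ i)"
      unfolding forall_8 branch_def vector_8 half_def by (intro conjI continuous_intros)
    then show "continuous_on S (\<lambda>t. branch t $ i)" for i by blast
  qed
  then show ?thesis by (simp add: vec_lambda_eta)
qed

lemma continuous_masses_nth: "continuous_on {0<..<r0} (\<lambda>r. masses r $ i)"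
proof -
  have "\<forall>i. continuous_on {0<..<r0} (\<lambda>r. masses r $ i)"
    unfolding forall_8 masses_mv mv_nth using continuous_masses by (auto intro: continuous_intros)
  then show ?thesis by blast
qed

lemma continuous_on_masses_snd:
  assumes "continuous_on S f" "f ` S \<subseteq> {0<..<r0}"
  shows "continuous_on S (\<lambda>z. masses (f z) $ i)" "continuous_on S (\<lambda>z. lam (f z))"
  using continuous_on_compose2[OF continuous_masses_nth assms] continuous_on_compose2[OF continuous_masses(2) assms] by auto

lemma continuous_red_grad: "continuous_on red_dom red_grad"
  unfolding red_grad_def grad_def
proof (intro continuous_on_vec_lambda continuous_on_inner continuous_on_const continuous_on_diff
    continuous_on_sum continuous_on_scaleR continuous_on_mult continuous_on_masses_snd)
  have c: "continuous_on red_dom (\<lambda>z. config (fst z) $ i)" for i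
    by (intro continuous_on_compose2[OF continuous_config[of UNIV]] continuous_intros) auto
  then show "continuous_on red_dom (\<lambda>z. config (fst z) $ i)" for i .
  show "continuous_on red_dom (\<lambda>z. kep (config (fst z) $ i - config (fst z) $ j))" for i j
  proof (cases "i = j")
    case False
    then have "config (fst z) $ i \<noteq> config (fst z) $ j" if "z \<in> red_dom" for z
      using that by (auto simp: red_dom_def Omega_def)
    then show ?thesis unfolding kep_def by (intro continuous_intros c) auto
  qed simp
qed (auto simp: red_dom_def intro: continuous_intros)

text \<open>The mixed terms cancel because the Hessian is symmetric. This reduces the pairing with a
  reflection to the signs of the form on two complementary subspaces.\<close>

lemma hess_bilinear_form:
  assumes "q \<in> Omega"
  shows "hess m l q (p + n) \<bullet> (p - n) = hess m l q p \<bullet> p - hess m l q n \<bullet> n"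
proof -
  have lin: "linear (hess m l q)"
    using has_derivative_grad[OF assms] by (rule has_derivative_linear)
  have "dkep x a \<bullet> b = dkep x b \<bullet> a" for x a b :: "real^2"
    unfolding dkep_def inner_diff_left inner_scaleR_left by (simp add: inner_commute[of b a])
  then have "hess m l q n \<bullet> p = hess m l q p \<bullet> n"
    unfolding hess_inner by (simp add: inner_commute)
  then show ?thesis
    by (simp add: linear_add[OF lin] inner_add_left inner_diff_right)
qed

definition red_hess :: "(real^8) \<times> real \<Rightarrow> real^8 \<Rightarrow> real^8 \<Rightarrow> real" where
  "red_hess z v y = hess (masses (snd z)) (lam (snd z)) (config (fst z)) (config v) \<bullet> config y"

lemma has_derivative_red_grad:
  assumes "config x \<in> Omega"
  shows "((\<lambda>x. red_grad (x, r)) has_derivative (\<lambda>v. \<chi> k. red_hess (x, r) v (axis k 1))) (at x)"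
proof -
  have config: "(config has_derivative config) (at x)"
    using linear_config by (simp add: linear_imp_has_derivative)
  have g: "((\<lambda>x. grad (masses r) (lam r) (config x)) has_derivative (\<lambda>v. hess (masses r) (lam r) (config x) (config v))) (at x)"
    using diff_chain_at[OF config has_derivative_grad[OF assms]] by (simp add: o_def)
  have vec: "((\<lambda>x. \<chi> i. f i x) has_derivative (\<lambda>h. \<chi> i. f' i h)) (at x)"
    if "\<And>i. (f i has_derivative f' i) (at x)" for f f' :: "8 \<Rightarrow> real^8 \<Rightarrow> real"
  proof -
    have eq: "(\<chi> i. g i) = (\<Sum>i\<in>UNIV. g i *\<^sub>R axis i 1)" for g :: "8 \<Rightarrow> real"
      using basis_expansion[of "\<chi> i. g i"] by (simp add: scalar_mult_eq_scaleR)
    show ?thesis unfolding eq by (intro has_derivative_sum has_derivative_scaleR_left that)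
  qed
  show ?thesis
    unfolding red_grad_def red_hess_def fst_conv snd_conv by (intro vec has_derivative_inner_left g)
qed

lemma red_hess_chi: "(\<chi> k. red_hess z v (axis k 1)) \<bullet> y = red_hess z v y"
  unfolding red_hess_def by (rule chi_inner_config)

lemma continuous_on_dkep:
  fixes f g :: "'b::topological_space \<Rightarrow> 'a::real_inner"
  assumes "continuous_on S f" "continuous_on S g" "\<And>x. x \<in> S \<Longrightarrow> f x \<noteq> 0"
  shows "continuous_on S (\<lambda>x. dkep (f x) (g x))"
  unfolding dkep_def by (intro continuous_intros assms) (simp_all add: assms)

lemma continuous_red_hess:
  assumes D: "linear D"
  shows "continuous_on (red_dom \<times> UNIV) (\<lambda>p. red_hess (fst p) (snd p) (D (snd p)))"
proof -
  have JD: "linear (\<lambda>x. config (D x))" using linear_compose[OF D linear_config] by (simp add: o_def)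
  have cJ: "continuous_on (red_dom \<times> UNIV) (\<lambda>p. config (fst (fst p)) $ i)" "continuous_on (red_dom \<times> UNIV) (\<lambda>p. config (snd p) $ i)"
    "continuous_on (red_dom \<times> UNIV) (\<lambda>p. config (D (snd p)) $ i)" for i
    by (intro continuous_on_compose2[OF continuous_config[of UNIV]]
        continuous_on_compose2[OF linear_continuous_on[of "\<lambda>x. config (D x)" UNIV]] continuous_intros;
        use JD linear_conv_bounded_linear in auto)+
  have dk: "continuous_on (red_dom \<times> UNIV) (\<lambda>p. dkep (config (fst (fst p)) $ i - config (fst (fst p)) $ j) (config (snd p) $ i - config (snd p) $ j))" for i j
  proof (cases "i = j")
    case False
    then have "config (fst (fst p)) $ i \<noteq> config (fst (fst p)) $ j" if "p \<in> red_dom \<times> UNIV" for p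
      using that by (auto simp: red_dom_def Omega_def)
    then show ?thesis
      by (intro continuous_on_dkep continuous_on_diff cJ) simp
  qed (simp add: dkep_def)
  show ?thesis
    unfolding red_hess_def hess_inner
    by (intro continuous_on_diff continuous_on_mult continuous_on_sum continuous_on_divide continuous_on_const
        continuous_on_inner continuous_on_masses_snd cJ dk continuous_intros) (auto simp: red_dom_def)
qed

text \<open>On the unit sphere the pairing stays positive near the point by the tube lemma. A zero
  \<open>x\<close> off the branch would contradict the mean value theorem on the segment from
  \<open>branch r\<close> to \<open>x\<close> at its own parameter \<open>r\<close>: both ends are
  zeros, yet \<open>red_grad\<close> paired with \<open>D v\<close> strictly increases.\<close>

lemma isolated_on_branch:
  assumes a: "a \<in> {0<..<r0}" and D: "linear D" and pos: "\<And>v. v \<noteq> 0 \<Longrightarrow> 0 < red_hess (branch a, a) v (D v)"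
  obtains \<epsilon> where "\<epsilon> > 0" "\<And>z. \<lbrakk>z \<in> red_dom; dist z (branch a, a) < \<epsilon>; red_grad z = 0\<rbrakk> \<Longrightarrow> fst z = branch (snd z)"
proof -
  let ?p = "(branch a, a)"
  let ?P = "{p \<in> red_dom \<times> UNIV. 0 < red_hess (fst p) (snd p) (D (snd p))}"
  have pU: "?p \<in> red_dom" by (rule branch_in_red_dom[OF a])
  have openP: "open ?P"
  proof -
    have oU: "open (red_dom \<times> (UNIV :: (real^8) set))" using open_red_dom by (simp add: open_Times)
    have "openin (top_of_set (red_dom \<times> UNIV)) ((red_dom \<times> UNIV) \<inter> (\<lambda>p. red_hess (fst p) (snd p) (D (snd p))) -` {0<..})"
      using continuous_red_hess[OF D] by (rule continuous_openin_preimage_gen) simp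
    then have "open ((red_dom \<times> UNIV) \<inter> (\<lambda>p. red_hess (fst p) (snd p) (D (snd p))) -` {0<..})"
      unfolding openin_open_eq[OF oU] by (rule conjunct1)
    moreover have "(red_dom \<times> UNIV) \<inter> (\<lambda>p. red_hess (fst p) (snd p) (D (snd p))) -` {0<..} = ?P" by auto
    ultimately show ?thesis by (simp only:)
  qed
  have "\<exists>X. open X \<and> ?p \<in> X \<and> X \<times> sphere 0 1 \<subseteq> ?P"
  proof -
    have "(?p, v) \<in> ?P" if "v \<in> sphere 0 1" for v
    proof -
      have "v \<noteq> 0" using that by auto
      then show ?thesis using pU pos[of v] by simp
    qed
    then have "{?p} \<times> sphere 0 1 \<subseteq> ?P" by blast
    then have "\<exists>X0. ?p \<in> X0 \<and> open X0 \<and> X0 \<times> sphere (0 :: real^8) 1 \<subseteq> ?P"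
      using Elementary_Topology.tube_lemma[OF compact_sphere openP] by blast
    then show ?thesis by blast
  qed
  then obtain X where X: "open X" "?p \<in> X" "X \<times> sphere 0 1 \<subseteq> ?P" by blast
  obtain \<delta> where \<delta>: "\<delta> > 0" "ball ?p \<delta> \<subseteq> X" using X open_contains_ball by metis
  have "continuous (at a) branch"
    using continuous_branch[of UNIV] by (simp add: continuous_on_eq_continuous_at)
  then obtain \<eta> where \<eta>: "\<eta> > 0" "\<And>t. dist t a < \<eta> \<Longrightarrow> dist (branch t) (branch a) < \<delta> / 2"
    unfolding continuous_at_eps_delta using \<delta>(1) by (metis half_gt_zero)
  define \<epsilon> where "\<epsilon> = min (\<delta> / 2) \<eta>"
  have red_hess_pos: "0 < red_hess y v (D v)" if "dist y ?p < \<delta>" "v \<noteq> 0" for y v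
  proof -
    have "y \<in> X" using that(1) \<delta>(2) by (auto simp: dist_commute)
    moreover have "v /\<^sub>R norm v \<in> sphere 0 1" using that(2) by simp
    ultimately have "(y, v /\<^sub>R norm v) \<in> ?P" using X(3) by blast
    then have p: "0 < red_hess y (v /\<^sub>R norm v) (D (v /\<^sub>R norm v))" and yU: "y \<in> red_dom" by auto
    have lin: "linear (hess (masses (snd y)) (lam (snd y)) (config (fst y)))"
      using has_derivative_grad yU by (auto simp: red_dom_def intro: has_derivative_linear)
    have "red_hess y (v /\<^sub>R norm v) (D (v /\<^sub>R norm v)) = red_hess y v (D v) / (norm v)\<^sup>2"
      unfolding red_hess_def by (simp add: linear_cmul[OF D] linear_cmul[OF linear_config] linear_cmul[OF lin] power2_eq_square divide_inverse)
    then show ?thesis using p that(2) by (simp add: zero_less_divide_iff)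
  qed
  show thesis
  proof
    show "\<epsilon> > 0" using \<delta> \<eta> by (simp add: \<epsilon>_def)
    fix z assume z: "z \<in> red_dom" "dist z ?p < \<epsilon>" "red_grad z = 0"
    define r where "r = snd z"
    define x where "x = fst z"
    have zx: "z = (x, r)" by (simp add: x_def r_def)
    have dxr: "dist x (branch a) < \<epsilon>" "dist r a < \<epsilon>"
      using z(2) dist_fst_le[of z ?p] dist_snd_le[of z ?p] by (auto simp: x_def r_def)
    have rI: "r \<in> {0<..<r0}" using z(1) by (auto simp: red_dom_def r_def)
    show "fst z = branch (snd z)"
    proof (rule ccontr)
      assume "fst z \<noteq> branch (snd z)"
      then have v: "x - branch r \<noteq> 0" by (simp add: x_def r_def)
      define v where "v = x - branch r"
      define y where "y s = branch r + s *\<^sub>R v" for s :: real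
      have near: "dist (y s, r) ?p < \<delta>" if s: "0 \<le> s" "s \<le> 1" for s
      proof -
        have "y s \<in> closed_segment (branch r) x"
          using s by (auto simp: y_def v_def closed_segment_def algebra_simps)
        moreover have "branch r \<in> ball (branch a) (\<delta> / 2)" "x \<in> ball (branch a) (\<delta> / 2)"
          using \<eta>(2)[of r] dxr by (auto simp: \<epsilon>_def dist_commute)
        ultimately have "y s \<in> ball (branch a) (\<delta> / 2)"
          using closed_segment_subset[OF _ _ convex_ball] by blast
        moreover have "dist r a < \<delta> / 2" using dxr by (simp add: \<epsilon>_def)
        moreover have "dist (y s, r) ?p \<le> dist (y s) (branch a) + dist r a"
          by (simp add: dist_Pair_Pair sqrt_sum_squares_le_sum)
        ultimately show ?thesis by (simp add: dist_commute)
      qed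
      have yU: "config (y s) \<in> Omega" if "0 \<le> s" "s \<le> 1" for s
      proof -
        have "(y s, r) \<in> X" using near[OF that] \<delta>(2) by (auto simp: dist_commute)
        \<comment> \<open>Any unit vector serves: membership in \<open>?P\<close> is only used to
          see that \<open>(y s, r)\<close> lies in \<open>red_dom\<close>.\<close>
        moreover have "axis 1 1 \<in> sphere (0 :: real^8) 1" by simp
        ultimately have "((y s, r), axis 1 1) \<in> ?P" using X(3) by blast
        then show ?thesis by (simp add: red_dom_def)
      qed
      define g where "g s = red_grad (y s, r) \<bullet> D v" for s
      have dg: "(g has_real_derivative red_hess (y s, r) v (D v)) (at s)" if s: "0 \<le> s" "s \<le> 1" for s
      proof -
        have "(y has_derivative (\<lambda>h. h *\<^sub>R v)) (at s)"
          unfolding y_def by (auto intro!: derivative_eq_intros)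
        from diff_chain_at[OF this has_derivative_red_grad[OF yU[OF s], of r]]
        have "((\<lambda>s. red_grad (y s, r)) has_derivative (\<lambda>h. \<chi> k. red_hess (y s, r) (h *\<^sub>R v) (axis k 1))) (at s)"
          by (simp add: o_def)
        from has_derivative_inner_left[OF this, of "D v"]
        have "(g has_derivative (\<lambda>h. red_hess (y s, r) (h *\<^sub>R v) (D v))) (at s)"
          unfolding g_def red_hess_chi .
        moreover have "(\<lambda>h. red_hess (y s, r) (h *\<^sub>R v) (D v)) = (*) (red_hess (y s, r) v (D v))"
        proof -
          have lin: "linear (hess (masses r) (lam r) (config (y s)))"
            using has_derivative_grad[OF yU[OF s]] by (rule has_derivative_linear)
          show ?thesis
            by (simp add: fun_eq_iff red_hess_def linear_cmul[OF linear_config] linear_cmul[OF lin])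
        qed
        ultimately show ?thesis by (simp add: has_field_derivative_def)
      qed
      have "\<exists>s. 0 < s \<and> s < 1 \<and> g 1 - g 0 = (1 - 0) * red_hess (y s, r) v (D v)"
        by (rule MVT2) (use dg in auto)
      then obtain s where s: "0 < s" "s < 1" "g 1 - g 0 = red_hess (y s, r) v (D v)" by auto
      have "g 1 = 0" using z(3) by (simp add: g_def y_def v_def zx)
      moreover have "g 0 = 0" using red_grad_branch[OF rI] by (simp add: g_def y_def)
      moreover have "red_hess (y s, r) v (D v) > 0"
        using near[of s] s v by (intro red_hess_pos) (auto simp: v_def)
      ultimately show False using s by simp
    qed
  qed
qed

lemma red_hess_diagonal:
  assumes "0 < r" "r < r0" "half r = k"
  shows "red_hess (branch r, r) x x = blockA k (x$1) (x$2)
     + blockB k (x$3) (x$4 - 3/5 * x$3)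
     + blockE k (x$5 + 2 * x$8) (x$6 - 4 * x$8) (- 5 * x$8) (x$7 + 2 * x$8)"
proof -
  have k: "0 < k" "k < 1/2" using half_bounds[OF assms(1,2)] assms(3) by auto
  have m: "masses r = mv (mass k)" "lam r = lam0 k"
    using outer_mass_eq[of r] lam_eq[of r] outer_mass_pos[OF assms(1,2)] k assms(3)
    by (simp_all add: masses_mv mass_def)
  show ?thesis
    unfolding red_hess_def fst_conv snd_conv m config_branch nested_squares_sq assms(3) unfolding config_def
    unfolding hess_sq[OF k] by (rule quad_form_split[OF k])
qed

lemma red_hess_split:
  assumes "0 < r" "r < r0"
  shows "red_hess (branch r, r) (p + n) (p - n) = red_hess (branch r, r) p p - red_hess (branch r, r) n n"
proof -
  have O: "config (branch r) \<in> Omega"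
    using branch_in_red_dom[of r] assms by (simp add: red_dom_def)
  show ?thesis
    unfolding red_hess_def fst_conv snd_conv linear_add[OF linear_config] linear_diff[OF linear_config]
    by (rule hess_bilinear_form[OF O])
qed

lemma E_form_zero: "E_form ef eg eF eG h hp A B 0 0 0 0 = 0"
  by (simp add: E_form_def)

lemma form2_zero: "form2 p q r 0 0 = 0"
  by (simp add: form2_def)

lemma vec8_nonzero: "(x :: real^8) \<noteq> 0 \<longleftrightarrow> x$1 \<noteq> 0 \<or> x$2 \<noteq> 0 \<or> x$3 \<noteq> 0
      \<or> x$4 \<noteq> 0 \<or> x$5 \<noteq> 0 \<or> x$6 \<noteq> 0 \<or> x$7 \<noteq> 0 \<or> x$8 \<noteq> (0::real)"
  unfolding vec_eq_iff forall_8 by auto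

lemma sum3_pos:
  fixes a b c :: real
  assumes "P \<Longrightarrow> a > 0" "\<not> P \<Longrightarrow> a = 0" "Q \<Longrightarrow> b > 0" "\<not> Q \<Longrightarrow>
        b = 0" "R \<Longrightarrow> c > 0" "\<not> R \<Longrightarrow> c = 0" "P \<or> Q \<or> R"
  shows "a + b + c > 0"
  using assms by (cases P; cases Q; cases R) auto

lemma root_bounds:
  assumes "5 \<le> (n::real)"
  shows "0 < sqrt 2 / n" "sqrt 2 / n < r0" "half (sqrt 2 / n) = 1 / n"
proof -
  show "0 < sqrt 2 / n" using assms by auto
  have "sqrt 2 * (1/n) \<le> sqrt 2 * (1/5)"
    using assms by (intro mult_left_mono divide_left_mono) auto
  then have "sqrt 2 / n \<le> sqrt 2 * (1/5)" by simp
  also have "\<dots> < sqrt 2 * (21/100)" by simp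
  finally show "sqrt 2 / n < r0" using r0_bounds(1) by linarith
  show "half (sqrt 2 / n) = 1 / n" using half_sqrt[of "1/n"] by simp
qed

lemma red_hess_pos_7:
  assumes "v \<noteq> 0"
  shows "0 < red_hess (branch (sqrt 2 / 7), sqrt 2 / 7) v v"
proof -
  have "5 \<le> (7::real)" by simp
  note b = root_bounds[OF this] and e = entries_7
  show ?thesis
    unfolding red_hess_diagonal[OF b]
  proof (rule sum3_pos[where P = "v$1 \<noteq> 0 \<or> v$2 \<noteq> 0" and Q = "v$3 \<noteq> 0 \<or> v$4 - 3/5 * v$3 \<noteq> 0"
        and R = "v$5 + 2 * v$8 \<noteq> 0 \<or> v$6 - 4 * v$8 \<noteq> 0 \<or> - 5 * v$8 \<noteq> 0 \<or> v$7 + 2 * v$8 \<noteq> 0"])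
    show "blockA (1/7) (v$1) (v$2) > 0" if "v$1 \<noteq> 0 \<or> v$2 \<noteq> 0"
      using that e by (intro form2_pos) auto
    show "blockB (1/7) (v$3) (v$4 - 3/5 * v$3) > 0" if "v$3 \<noteq> 0 \<or> v$4 - 3/5 * v$3 \<noteq> 0"
      using that e by (intro form2_pos) auto
    show "blockE (1/7) (v$5 + 2 * v$8) (v$6 - 4 * v$8) (- 5 * v$8) (v$7 + 2 * v$8) > 0"
      if "v$5 + 2 * v$8 \<noteq> 0 \<or> v$6 - 4 * v$8 \<noteq> 0 \<or> - 5 * v$8 \<noteq> 0 \<or> v$7 + 2 * v$8 \<noteq> 0"
      by (rule E_pos_7[OF e(1-16) that])
    show "(v$1 \<noteq> 0 \<or> v$2 \<noteq> 0) \<or> (v$3 \<noteq> 0 \<or> v$4 - 3/5 * v$3 \<noteq> 0) \<or>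
      (v$5 + 2 * v$8 \<noteq> 0 \<or> v$6 - 4 * v$8 \<noteq> 0 \<or> - 5 * v$8 \<noteq> 0 \<or> v$7 + 2 * v$8 \<noteq> 0)"
      using assms unfolding vec8_nonzero by auto
  qed (auto simp: form2_zero E_form_zero)
qed

abbreviation "flip8 \<equiv> reflect (axis 8 1 :: real^8)"
abbreviation "flip3 \<equiv> reflect (axis 3 1 :: real^8)"

lemma flip_nth:
  "flip8 v $ 1 = v$1" "flip8 v $ 2 = v$2" "flip8 v $ 3 = v$3" "flip8 v $ 4 = v$4"
  "flip8 v $ 5 = v$5" "flip8 v $ 6 = v$6" "flip8 v $ 7 = v$7" "flip8 v $ 8 = - v$8"
  "flip3 v $ 1 = v$1" "flip3 v $ 2 = v$2" "flip3 v $ 3 = - v$3" "flip3 v $ 4 = v$4"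
  "flip3 v $ 5 = v$5" "flip3 v $ 6 = v$6" "flip3 v $ 7 = v$7" "flip3 v $ 8 = v$8"
  unfolding reflect_def inner_axis by (simp_all add: axis_def)

lemma flip8_flip8: "flip8 (flip8 v) = v"
  by (simp add: vec_eq_iff forall_8 flip_nth)

text \<open>\<open>red_hess_split\<close> for the half sum and half difference of \<open>v\<close>
  and \<open>D v\<close>, which are the fixed and the negated part of \<open>v\<close> when
  \<open>D\<close> is an involution.\<close>

lemma red_hess_flip:
  assumes "0 < r" "r < r0" and D: "linear D"
  shows "red_hess (branch r, r) v (D v) = red_hess (branch r, r) ((1/2) *\<^sub>R (v + D v)) ((1/2) *\<^sub>R (v + D v))
     - red_hess (branch r, r) ((1/2) *\<^sub>R (v - D v)) ((1/2) *\<^sub>R (v - D v))"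
proof -
  have "(1/2) *\<^sub>R (v + D v) + (1/2) *\<^sub>R (v - D v) = v" "(1/2) *\<^sub>R (v + D v) - (1/2) *\<^sub>R (v - D v) = D v"
    by (simp_all add: vec_eq_iff algebra_simps)
  then show ?thesis using red_hess_split[OF assms(1,2), of "(1/2) *\<^sub>R (v + D v)" "(1/2) *\<^sub>R (v - D v)"] by simp
qed

lemma sum4_pos:
  fixes a b c d :: real
  assumes "P \<Longrightarrow> a > 0" "\<not> P \<Longrightarrow> a = 0" "Q \<Longrightarrow> b > 0" "\<not> Q \<Longrightarrow>
        b = 0" "R \<Longrightarrow> c > 0" "\<not> R \<Longrightarrow> c = 0"
    "S \<Longrightarrow> d < 0" "\<not> S \<Longrightarrow> d = 0" "P \<or> Q \<or> R \<or> S"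
  shows "a + b + c - d > 0"
  using assms by (cases P; cases Q; cases R; cases S) auto

text \<open>\<open>flip8\<close> negates just the coordinate along which \<open>blockE\<close> is
  negative; on the other seven, where \<open>F0 = 0\<close>, all three blocks are positive.\<close>

lemma red_hess_pos_6:
  assumes "v \<noteq> 0"
  shows "0 < red_hess (branch (sqrt 2 / 6), sqrt 2 / 6) v (flip8 v)"
proof -
  have "5 \<le> (6::real)" by simp
  note b = root_bounds[OF this] and e = entries_6
  have A: "blockA (1/6) (v$1) (v$2) > 0" if "v$1 \<noteq> 0 \<or> v$2 \<noteq> 0"
    using that e by (intro form2_pos) auto
  have B: "blockB (1/6) (v$3) (v$4 - 3/5 * v$3) > 0" if "v$3 \<noteq> 0 \<or> v$4 - 3/5 * v$3 \<noteq> 0"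
    using that e by (intro form2_pos) auto
  have E: "blockE (1/6) (v$5) (v$6) 0 (v$7) > 0" if "v$5 \<noteq> 0 \<or> v$6 \<noteq> 0 \<or> v$7 \<noteq> 0"
    by (rule E_pos_6[OF e(1-16) that])
  have N: "blockE (1/6) (2 * v$8) (- 4 * v$8) (- 5 * v$8) (2 * v$8) < 0" if "v$8 \<noteq> 0"
    by (rule E_neg_6[OF e(1-16) that])
  have "red_hess (branch (sqrt 2 / 6), sqrt 2 / 6) v (flip8 v) =
      blockA (1/6) (v$1) (v$2)
      + blockB (1/6) (v$3) (v$4 - 3/5 * v$3)
      + blockE (1/6) (v$5) (v$6) 0 (v$7)
      - blockE (1/6) (2 * v$8) (- 4 * v$8) (- 5 * v$8) (2 * v$8)"
    unfolding red_hess_flip[OF b(1,2) linear_reflect] red_hess_diagonal[OF b]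
    by (simp add: flip_nth form2_zero)
  also have "\<dots> > 0"
  proof (rule sum4_pos[where P = "v$1 \<noteq> 0 \<or> v$2 \<noteq> 0" and Q = "v$3 \<noteq> 0 \<or> v$4 - 3/5 * v$3 \<noteq> 0"
        and R = "v$5 \<noteq> 0 \<or> v$6 \<noteq> 0 \<or> v$7 \<noteq> 0" and S = "v$8 \<noteq> 0", OF A _ B _ E _ N])
    show "(v$1 \<noteq> 0 \<or> v$2 \<noteq> 0) \<or> (v$3 \<noteq> 0 \<or> v$4 - 3/5 * v$3 \<noteq> 0) \<or> (v$5 \<noteq> 0
          \<or> v$6 \<noteq> 0 \<or> v$7 \<noteq> 0) \<or> v$8 \<noteq> 0"
      using assms unfolding vec8_nonzero by auto
  qed (simp_all add: form2_zero E_form_zero)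
  finally show ?thesis .
qed

lemma sum5_pos:
  fixes a b c d d' :: real
  assumes "P \<Longrightarrow> a > 0" "\<not> P \<Longrightarrow> a = 0" "Q \<Longrightarrow> b > 0" "\<not> Q \<Longrightarrow>
        b = 0" "R \<Longrightarrow> c > 0" "\<not> R \<Longrightarrow> c = 0"
    "S \<Longrightarrow> d < 0" "\<not> S \<Longrightarrow> d = 0" "T \<Longrightarrow> d' < 0" "\<not> T \<Longrightarrow> d' = 0" "P \<or> Q \<or> R \<or> S \<or> T"
  shows "a + b + c - d - d' > 0"
  using assms by (cases P; cases Q; cases R; cases S; cases T) auto

text \<open>The negated coordinates 3 and 8 lie in different blocks, so their negative contributions
  simply add. Along the third, \<open>blockB\<close> is evaluated on \<open>(1, - 3/5)\<close>,
  where it is negative; on the fourth, only \<open>qB22\<close> remains.\<close>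

lemma red_hess_pos_5:
  assumes "v \<noteq> 0"
  shows "0 < red_hess (branch (sqrt 2 / 5), sqrt 2 / 5) v (flip8 (flip3 v))"
proof -
  have "5 \<le> (5::real)" by simp
  note b = root_bounds[OF this] and e = entries_5
  have lin: "linear (\<lambda>v. flip8 (flip3 v))"
    using linear_compose[OF linear_reflect linear_reflect] by (simp add: o_def)
  have A: "blockA (1/5) (v$1) (v$2) > 0" if "v$1 \<noteq> 0 \<or> v$2 \<noteq> 0"
    using that e by (intro form2_pos) auto
  have B: "blockB (1/5) 0 (v$4) > 0" if "v$4 \<noteq> 0"
    using that e by (simp add: form2_def)
  have B': "blockB (1/5) (v$3) (- (3/5 * v$3)) < 0" if "v$3 \<noteq> 0"
  proof -
    have "blockB (1/5) (v$3) (- (3/5 * v$3))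
      = (qB11 (1/5) - 6/5 * qB12 (1/5) + 9/25 * qB22 (1/5)) * (v$3)\<^sup>2"
      by (simp add: form2_def power2_eq_square algebra_simps)
    also have "\<dots> < 0" using that e by (intro mult_neg_pos) auto
    finally show ?thesis .
  qed
  have E: "blockE (1/5) (v$5) (v$6) 0 (v$7) > 0" if "v$5 \<noteq> 0 \<or> v$6 \<noteq> 0 \<or> v$7 \<noteq> 0"
    by (rule E_pos_5[OF e(1-16) that])
  have N: "blockE (1/5) (2 * v$8) (- 4 * v$8) (- 5 * v$8) (2 * v$8) < 0" if "v$8 \<noteq> 0"
    by (rule E_neg_5[OF e(1-16) that])
  have "red_hess (branch (sqrt 2 / 5), sqrt 2 / 5) v (flip8 (flip3 v)) =
      blockA (1/5) (v$1) (v$2)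
      + blockB (1/5) 0 (v$4)
      + blockE (1/5) (v$5) (v$6) 0 (v$7)
      - blockB (1/5) (v$3) (- (3/5 * v$3))
      - blockE (1/5) (2 * v$8) (- 4 * v$8) (- 5 * v$8) (2 * v$8)"
    unfolding red_hess_flip[OF b(1,2) lin] red_hess_diagonal[OF b]
    by (simp add: flip_nth form2_zero)
  also have "\<dots> > 0"
  proof (rule sum5_pos[where P = "v$1 \<noteq> 0 \<or> v$2 \<noteq> 0" and Q = "v$4 \<noteq> 0"
        and R = "v$5 \<noteq> 0 \<or> v$6 \<noteq> 0 \<or> v$7 \<noteq> 0" and S = "v$3 \<noteq> 0" and T = "v$8 \<noteq> 0", OF A _ B _ E _ B' _ N])
    show "(v$1 \<noteq> 0 \<or> v$2 \<noteq> 0) \<or> v$4 \<noteq> 0 \<or> (v$5 \<noteq> 0 \<or> v$6 \<noteq> 0 \<or> v$7 \<noteq> 0) \<or> v$3 \<noteq> 0 \<or> v$8 \<noteq> 0"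
      using assms unfolding vec8_nonzero by auto
  qed (simp_all add: form2_zero E_form_zero)
  finally show ?thesis .
qed

section \<open>Rotation orbits and their intersection with the symmetric configurations\<close>

lemma SO2_orbit_eq:
  "SO2_orbit q = range (\<lambda>t. \<chi> i. v2 (cos t * q$i$1 - sin t * q$i$2) (sin t * q$i$1 + cos t * q$i$2))"
proof -
  define R where "R t = (vector [vector [cos t, - sin t], vector [sin t, cos t]] :: real^2^2)" for t :: real
  have R_mult: "R t *v z = v2 (cos t * z$1 - sin t * z$2) (sin t * z$1 + cos t * z$2)" for t z
    by (simp add: R_def vec_eq_iff forall_2 matrix_vector_mult_def sum_2 v2_nth)
  have 1: "rotation_matrix (R t)" for t
  proof -
    have "transpose (R t) ** R t = mat 1"
      using sin_cos_squared_add3[of t]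
      by (simp add: R_def vec_eq_iff forall_2 matrix_matrix_mult_def transpose_def mat_def sum_2 algebra_simps)
    moreover have "det (R t) = 1"
      using sin_cos_squared_add3[of t] by (simp add: det_2 R_def algebra_simps)
    ultimately show ?thesis by (simp add: rotation_matrix_def orthogonal_matrix)
  qed
  have 2: "\<exists>t. g = R t" if g: "rotation_matrix g" for g :: "real^2^2"
  proof -
    define a b c d where "a = g$1$1" and "b = g$1$2" and "c = g$2$1" and "d = g$2$2"
    have "transpose g ** g = mat 1" "det g = 1"
      using g by (simp_all add: rotation_matrix_def orthogonal_matrix)
    then have e: "a * a + c * c = 1" "a * b + c * d = 0" "b * b + d * d = 1" "a * d - b * c = 1"
      by (simp_all add: vec_eq_iff forall_2 matrix_matrix_mult_def transpose_def mat_def sum_2 det_2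
          a_def b_def c_def d_def)
    have "d = d * (a * a + c * c)" "b = b * (a * a + c * c)" using e by simp_all
    moreover have "d * (a * a + c * c) = a * (a * d - b * c) + c * (a * b + c * d)"
      "b * (a * a + c * c) = a * (a * b + c * d) - c * (a * d - b * c)" by Groebner_Basis.algebra+
    ultimately have bd: "d = a" "b = - c" using e by simp_all
    obtain t where t: "a = cos t" "c = sin t"
      using e(1) sincos_total_2pi[of a c] by (metis power2_eq_square)
    show ?thesis
      using bd t by (intro exI[of _ t]) (simp add: R_def vec_eq_iff forall_2 a_def b_def c_def d_def)
  qed
  have "SO2_orbit q = range (\<lambda>t. \<chi> i. R t *v (q $ i))"
    unfolding SO2_orbit_def using 1 2 by blast
  then show ?thesis unfolding R_mult .
qed

lemma connected_SO2_orbit: "connected (SO2_orbit q)"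
proof -
  have v2: "v2 a b = a *\<^sub>R v2 1 0 + b *\<^sub>R v2 0 1" for a b
    by (simp add: vec_eq_iff forall_2 v2_nth)
  show ?thesis
    unfolding SO2_orbit_eq
    by (subst v2, intro connected_continuous_image connected_UNIV continuous_on_vec_lambda continuous_intros)
qed

lemma SO2_orbit_refl: "q \<in> SO2_orbit q"
  unfolding SO2_orbit_eq
  by (rule image_eqI[of _ _ 0]) (simp_all add: vec_eq_iff forall_2 v2_nth)

text \<open>Mirror symmetry gives bodies 1 and 4 the same first coordinate, which leaves only the
  rotations by 0 and by a half turn; the sign condition in \<open>red_dom\<close> excludes the half
  turn.\<close>

lemma config_in_orbit:
  assumes "(x, r) \<in> red_dom" "config x \<in> SO2_orbit (nested_squares s)"
  shows "x = branch s"
proof -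
  obtain t where t: "config x = (\<chi> i. v2 (cos t * nested_squares s$i$1 - sin t * nested_squares s$i$2)
      (sin t * nested_squares s$i$1 + cos t * nested_squares s$i$2))"
    using assms(2) unfolding SO2_orbit_eq by blast
  have n: "nested_squares s $ 1 $ 1 = - 1/2" "nested_squares s $ 1 $ 2 = - 1/2"
    "nested_squares s $ 4 $ 1 = - 1/2" "nested_squares s $ 4 $ 2 = 1/2"
    by (simp_all add: nested_squares_def vector_8)
  have "config x $ (5 - 1) = mirror (config x $ 1)" using symmetric_config unfolding symmetric_def by blast
  then have "config x $ 4 $ 1 = config x $ 1 $ 1" unfolding five_minus by (simp add: mirror_def v2_nth)
  then have s: "sin t = 0" unfolding t by (simp add: v2_nth n)
  moreover have "config x $ 1 $ 2 < 0" using assms(1) by (simp add: red_dom_def)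
  ultimately have "cos t > 0" unfolding t by (simp add: v2_nth n)
  then have c: "cos t = 1" using s sin_zero_abs_cos_one[of t] by simp
  have "config x = nested_squares s"
    unfolding t s c by (simp add: vec_eq_iff forall_2 v2_nth)
  then show ?thesis unfolding config_branch[symmetric] inj_config .
qed

section \<open>Local and global bifurcation\<close>

definition lift :: "(real^8) \<times> real \<Rightarrow> (real^2^8) \<times> real" where
  "lift z = (config (fst z), snd z)"

lemma SO2_orbit_subset_Omega:
  assumes "q \<in> Omega"
  shows "SO2_orbit q \<subseteq> Omega"
proof -
  have "x = y" if "rotation_matrix g" "g *v x = g *v y" for g :: "real^2^2" and x y
  proof -
    have g: "transpose g ** g = mat 1" using that(1) by (simp add: rotation_matrix_def orthogonal_matrix)
    have "transpose g *v (g *v x) = transpose g *v (g *v y)" using that(2) by simp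
    then show ?thesis by (simp add: matrix_vector_mul_assoc g)
  qed
  then show ?thesis using assms unfolding SO2_orbit_def Omega_def by fastforce
qed

definition red_nontrivial :: "((real^8) \<times> real) set" where
  "red_nontrivial = {z \<in> red_dom. red_grad z = 0 \<and> fst z \<noteq> branch (snd z)}"

definition red_closure :: "((real^8) \<times> real) set" where
  "red_closure = closure red_nontrivial \<inter> red_dom"

lemma continuous_lift: "continuous_on S lift"
  unfolding lift_def
  by (intro continuous_on_Pair continuous_on_compose2[OF continuous_config[of UNIV]] continuous_intros) auto

lemma lift_branch: "lift (branch t, t) = (nested_squares t, t)"
  by (simp add: lift_def config_branch)

lemma in_trivial_family: "(nested_squares t, t) \<in> trivial_family X \<longleftrightarrow> t \<in> X"
  unfolding trivial_family_def using SO2_orbit_refl by auto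

lemma trivial_family_singleton: "trivial_family {t} = SO2_orbit (nested_squares t) \<times> {t}"
  by (simp add: trivial_family_def)

text \<open>By \<open>config_in_orbit\<close> a point of the slice off the branch is off the whole
  trivial family, not only different from the nested squares.\<close>

lemma lift_in_nontrivial:
  assumes "z \<in> red_nontrivial"
  shows "lift z \<in> nontrivial"
proof -
  obtain x r where z: "z = (x, r)" by (cases z)
  have zU: "(x, r) \<in> red_dom" and red_grad: "red_grad (x, r) = 0" and ne: "x \<noteq> branch r" using assms by (auto simp: red_nontrivial_def z)
  have "(config x, r) \<notin> trivial_family {0<..<r0}"
    unfolding trivial_family_def using config_in_orbit[OF zU] ne by auto
  moreover have O: "config x \<in> Omega" "r \<in> {0<..<r0}" using zU by (auto simp: red_dom_def)
  moreover have "GDERIV (\<lambda>q. phi q r) (config x) :> 0"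
    unfolding GDERIV_phi_iff[OF O(1)] using red_grad by (simp add: red_grad_eq_0_iff)
  ultimately show ?thesis by (simp add: nontrivial_def lift_def z)
qed

lemma lift_in_closure:
  assumes "z \<in> closure red_nontrivial"
  shows "lift z \<in> closure nontrivial"
proof -
  have "lift ` closure red_nontrivial \<subseteq> closure nontrivial"
    by (rule image_closure_subset[OF continuous_lift closed_closure])
      (use lift_in_nontrivial closure_subset in blast)
  then show ?thesis using assms by blast
qed

lemma lift_in_nontrivial_closure:
  assumes "z \<in> red_closure"
  shows "lift z \<in> nontrivial_closure"
  using assms lift_in_closure[of z] by (auto simp: red_closure_def nontrivial_closure_def lift_def red_dom_def)

lemma in_BIF:
  assumes "t \<in> {0<..<r0}" "(branch t, t) \<in> red_closure"
  shows "t \<in> BIF"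
proof -
  have "(nested_squares t, t) \<in> closure nontrivial"
    using assms(2) lift_in_closure[of "(branch t, t)"] by (simp add: red_closure_def lift_branch)
  moreover have "(nested_squares t, t) \<notin> nontrivial"
    using assms(1) in_trivial_family[of t "{0<..<r0}"] by (auto simp: nontrivial_def)
  ultimately show ?thesis using assms(1) by (simp add: BIF_def closure_def)
qed

lemma not_in_red_closure:
  assumes "a \<in> {0<..<r0}" "linear D" "\<And>v. v \<noteq> 0 \<Longrightarrow> 0 < red_hess (branch a, a) v (D v)"
  shows "(branch a, a) \<notin> red_closure"
proof
  assume "(branch a, a) \<in> red_closure"
  then have "\<forall>e>0. \<exists>z\<in>red_nontrivial. dist z (branch a, a) < e" by (simp add: red_closure_def closure_approachable)
  moreover obtain e where "e > 0" "\<And>z. \<lbrakk>z \<in> red_dom; dist z (branch a, a) < e; red_grad z = 0\<rbrakk> \<Longrightarrow> fst z = branch (snd z)"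
    using isolated_on_branch[OF assms] by blast
  ultimately show False unfolding red_nontrivial_def by blast
qed

lemma closedin_red_closure: "closedin (top_of_set red_dom) red_closure"
  unfolding red_closure_def by (metis Int_commute closed_closure closedin_closed_Int)

lemma zero_in_red_closure:
  assumes "z \<in> red_dom" "red_grad z = 0"
  shows "z \<in> red_closure \<or> fst z = branch (snd z)"
  using assms closure_subset[of red_nontrivial] by (auto simp: red_closure_def red_nontrivial_def)

text \<open>Since \<open>K\<close> is open in \<open>red_closure\<close>, the rest
  \<open>red_closure - K\<close> is relatively closed in \<open>red_dom\<close> and can play the
  part of the ignored zeros \<open>R\<close>.\<close>

lemma reduced_branch_index_change:
  assumes ab: "a < b" "0 < a" "b < r0" and K: "compact K" "openin (top_of_set red_closure) K"
    and Kw: "\<And>t. \<lbrakk>t \<in> {0<..<r0}; (branch t, t) \<in> K\<rbrakk> \<Longrightarrow> a < t \<and> t < b"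
    and Rw: "\<And>t. \<lbrakk>t \<in> {a..b}; (branch t, t) \<in> red_closure\<rbrakk> \<Longrightarrow> (branch t, t) \<in> K"
    and D: "linear D" "\<And>v. D (D v) = v"
    and pos: "\<And>v. v \<noteq> 0 \<Longrightarrow> 0 < red_hess (branch a, a) v (D v)"
      "\<And>v. v \<noteq> 0 \<Longrightarrow> 0 < red_hess (branch b, b) v (D (reflect (axis i 1) v))"
  shows False
proof (rule branch_index_change[where F = red_grad and U = red_dom and I = "{0<..<r0}" and w = branch and K = K and R = "red_closure - K"
      and a = a and b = b and D = D and u = "axis i 1"])
  have KY: "K \<subseteq> red_closure" using K(2) by (rule openin_imp_subset)
  show "red_dom \<subseteq> UNIV \<times> {0<..<r0}" by (auto simp: red_dom_def)
  show "K \<subseteq> red_dom" using KY by (auto simp: red_closure_def)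
  have "closedin (top_of_set red_closure) (red_closure - K)" using K(2) by (simp add: openin_diff closedin_diff)
  then show "closedin (top_of_set red_dom) (red_closure - K)" using closedin_red_closure by (rule closedin_trans)
  show "z \<in> K \<union> (red_closure - K) \<or> fst z = branch (snd z)" if "z \<in> red_dom" "red_grad z = 0" for z
    using zero_in_red_closure[OF that] by blast
  have "((\<lambda>x. red_grad (x, t)) has_derivative (\<lambda>v. \<chi> k. red_hess (branch t, t) v (axis k 1))) (at (branch t))" if "t \<in> {a, b}" for t
    using branch_in_red_dom[of t] that ab by (intro has_derivative_red_grad) (auto simp: red_dom_def)
  from this[of a] this[of b]
  show "((\<lambda>x. red_grad (x, a)) has_derivative (\<lambda>v. \<chi> k. red_hess (branch a, a) v (axis k 1))) (at (branch a))"
    "((\<lambda>x. red_grad (x, b)) has_derivative (\<lambda>v. \<chi> k. red_hess (branch b, b) v (axis k 1))) (at (branch b))" by simp_all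
qed (use ab K D pos Kw Rw open_red_dom continuous_red_grad continuous_branch branch_in_red_dom red_grad_branch in \<open>auto simp: red_hess_chi axis_in_Basis_iff\<close>)

text \<open>The lifted component is connected and contains a point of the orbit over
  \<open>t\<close>, so it lies in the component which \<open>t \<notin> GLOB a b\<close> makes
  compact and confines to \<open>{a..b}\<close> along the trivial family. Compactness is then pulled
  back along the injective map \<open>config\<close>.\<close>

lemma compact_component_red_closure:
  assumes p: "(branch t, t) \<in> red_closure" and t: "t \<in> {a..b}" and ab: "0 < a" "b < r0" "t \<notin> GLOB a b"
  shows "compact (connected_component_set red_closure (branch t, t))"
    and "\<And>s. \<lbrakk>s \<in> {0<..<r0}; (branch s, s) \<in> connected_component_set red_closure (branch t, t)\<rbrakk> \<Longrightarrow> s \<in> {a..b}"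
proof -
  let ?D = "connected_component_set red_closure (branch t, t)"
  let ?S = "nontrivial_closure \<union> trivial_family {t}"
  let ?C = "connected_component_set ?S (nested_squares t, t)"
  have mem: "(nested_squares t, t) \<in> trivial_family {t}" by (simp add: in_trivial_family)
  have "connected (trivial_family {t})"
    unfolding trivial_family_singleton by (intro connected_Times connected_SO2_orbit) simp
  then have sub: "trivial_family {t} \<subseteq> ?C"
    using mem by (intro connected_component_maximal) auto
  have "?C \<in> components ?S" using mem by (auto simp: components_def)
  then have C: "compact ?C" "(?C - trivial_family {a..b}) \<inter> trivial_family {0<..<r0} = {}"
    using ab(3) t sub unfolding GLOB_def by blast+
  have DY: "?D \<subseteq> red_closure" by (rule connected_component_subset)
  have DC: "lift ` ?D \<subseteq> ?C"
  proof (rule connected_component_maximal)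
    show "(nested_squares t, t) \<in> lift ` ?D" using p lift_branch[of t] by (metis connected_component_refl_eq image_eqI mem_Collect_eq)
    show "connected (lift ` ?D)"
      by (intro connected_continuous_image continuous_lift connected_connected_component)
    show "lift ` ?D \<subseteq> ?S" using DY lift_in_nontrivial_closure by blast
  qed
  show "s \<in> {a..b}" if "s \<in> {0<..<r0}" "(branch s, s) \<in> ?D" for s
  proof -
    have "(nested_squares s, s) \<in> ?C" using DC that(2) lift_branch[of s] by (metis image_subset_iff)
    then show ?thesis using C(2) that(1) in_trivial_family by blast
  qed
  \<comment> \<open>The weak inequality makes \<open>Z\<close> closed. Since \<open>?C\<close> stays
    inside \<open>Omega\<close>, equality is impossible and \<open>Z\<close> still lies in
    \<open>red_dom\<close>.\<close>
  define Z where "Z = lift -` ?C \<inter> {z. config (fst z) $ 1 $ 2 \<le> 0}"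
  have CS: "q \<in> Omega \<and> r \<in> {0<..<r0}" if "(q, r) \<in> ?C" for q r
  proof -
    have "(q, r) \<in> ?S" using that connected_component_subset by blast
    then consider "(q, r) \<in> nontrivial_closure" | "q \<in> SO2_orbit (nested_squares t)" "r = t"
      unfolding trivial_family_singleton by blast
    then show ?thesis
    proof cases
      case 2
      have "(nested_squares t, t) \<in> Omega \<times> {0<..<r0}"
        using lift_in_nontrivial_closure[OF p] by (simp add: nontrivial_closure_def lift_branch)
      then show ?thesis using 2 SO2_orbit_subset_Omega by blast
    qed (simp add: nontrivial_closure_def)
  qed
  have ZU: "Z \<subseteq> red_dom"
  proof
    fix z assume z: "z \<in> Z"
    then have O: "config (fst z) \<in> Omega" "snd z \<in> {0<..<r0}" using CS by (auto simp: Z_def lift_def)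
    have "config (fst z) $ (5 - 1) = mirror (config (fst z) $ 1)" using symmetric_config unfolding symmetric_def by blast
    moreover have "config (fst z) $ 1 \<noteq> config (fst z) $ 4" using O(1) by (simp add: Omega_def)
    ultimately have "config (fst z) $ 1 $ 2 \<noteq> 0"
      unfolding five_minus by (auto simp: mirror_def vec_eq_iff[where 'b = 2] forall_2 v2_nth)
    then show "z \<in> red_dom" using z O by (auto simp: red_dom_def Z_def)
  qed
  have "compact Z"
  proof -
    \<comment> \<open>A linear left inverse of \<open>config\<close> exhibits \<open>Z\<close> as
      part of a continuous image of the compact set \<open>?C\<close>.\<close>
    obtain g where g: "linear g" "g \<circ> config = id"
      using linear_injective_left_inverse[OF linear_config] inj_config by (auto simp: inj_def)
    have "compact ((\<lambda>p. (g (fst p), snd p)) ` ?C)"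
      by (intro compact_continuous_image C(1) continuous_on_Pair continuous_on_snd continuous_on_id
          continuous_on_compose2[OF linear_continuous_on[of g UNIV]] continuous_on_fst)
        (use g linear_conv_bounded_linear in auto)
    moreover have "Z \<subseteq> (\<lambda>p. (g (fst p), snd p)) ` ?C"
    proof
      fix z assume "z \<in> Z"
      then have "lift z \<in> ?C" by (simp add: Z_def)
      moreover have "(g (fst (lift z)), snd (lift z)) = z"
        using g(2) by (simp add: lift_def fun_eq_iff)
      ultimately show "z \<in> (\<lambda>p. (g (fst p), snd p)) ` ?C" by force
    qed
    moreover have "closed Z"
    proof -
      have "closed (lift -` ?C)"
        using continuous_lift[of UNIV] compact_imp_closed[OF C(1)]
        by (intro continuous_closed_vimage) (auto simp: continuous_on_eq_continuous_at)
      moreover have "continuous_on UNIV (\<lambda>z::(real^8) \<times> real. config (fst z))"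
        by (intro continuous_on_compose2[OF continuous_config[of UNIV]] continuous_intros) auto
      then have "closed {z::(real^8) \<times> real. config (fst z) $ 1 $ 2 \<le> 0}"
        by (intro closed_Collect_le continuous_on_component continuous_on_const)
      ultimately show ?thesis unfolding Z_def by (rule closed_Int)
    qed
    ultimately show ?thesis using compact_Int_closed[of "(\<lambda>p. (g (fst p), snd p)) ` ?C" Z] by (simp only: Int_absorb1)
  qed
  moreover have "closedin (top_of_set Z) ?D"
  proof (rule closedin_subset_trans)
    show "closedin (top_of_set red_dom) ?D" by (rule closedin_trans[OF closedin_connected_component closedin_red_closure])
    show "?D \<subseteq> Z" using DC DY by (auto simp: Z_def red_closure_def red_dom_def)
  qed (rule ZU)
  ultimately show "compact ?D" by (meson closedin_compact)
qed

lemma clopen_piece: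
  assumes ab: "0 < a" "b < r0" and ends: "(branch a, a) \<notin> red_closure" "(branch b, b) \<notin> red_closure"
    and p: "(branch t, t) \<in> red_closure" and t: "t \<in> {a..b}" "t \<notin> GLOB a b"
  obtains K where "compact K" "openin (top_of_set red_closure) K" "(branch t, t) \<in> K"
    "\<And>s. \<lbrakk>s \<in> {0<..<r0}; (branch s, s) \<in> K\<rbrakk> \<Longrightarrow> a < s \<and> s < b"
proof -
  let ?D = "connected_component_set red_closure (branch t, t)"
  note D = compact_component_red_closure[OF p t(1) ab t(2)]
  have "locally compact red_closure"
    unfolding red_closure_def by (intro locally_compact_Int closed_imp_locally_compact open_imp_locally_compact open_red_dom) simp
  moreover have "?D \<in> components red_closure" using p by (auto simp: components_def)
  \<comment> \<open>An open neighbourhood of the component that contains no branch point outside the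
    open interval. The clopen set is chosen inside it, which yields the last claim.\<close>
  moreover define O' where "O' = {z \<in> red_dom. fst z \<noteq> branch (snd z)} \<union> {z \<in> red_dom. snd z \<in> {a<..<b}}"
  have "open O'"
  proof -
    have "{z \<in> red_dom. fst z \<noteq> branch (snd z)} = red_dom \<inter> {z. fst z \<noteq> branch (snd z)}"
      "{z \<in> red_dom. snd z \<in> {a<..<b}} = red_dom \<inter> {z. a < snd z} \<inter> {z. snd z < b}" by auto
    then show ?thesis unfolding O'_def
      by (simp only:) (intro open_Un open_Int open_red_dom open_Collect_neq open_Collect_less continuous_intros
          continuous_on_compose2[OF continuous_branch[of UNIV]] subset_UNIV)
  qed
  moreover have "?D \<subseteq> O'"
  proof
    fix z assume z: "z \<in> ?D"
    have zY: "z \<in> red_closure" using z connected_component_subset by blast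
    show "z \<in> O'"
    proof (cases "fst z = branch (snd z)")
      case True
      then have e: "z = (branch (snd z), snd z)" by (simp add: prod_eq_iff)
      have "snd z \<in> {0<..<r0}" using zY by (auto simp: red_closure_def red_dom_def)
      then have "snd z \<in> {a..b}" using D(2) z e by metis
      moreover have "snd z \<noteq> a" "snd z \<noteq> b" using ends zY e by metis+
      ultimately show ?thesis using zY by (auto simp: O'_def red_closure_def)
    qed (use zY in \<open>auto simp: O'_def red_closure_def\<close>)
  qed
  ultimately obtain K where K: "openin (top_of_set red_closure) K" "compact K" "?D \<subseteq> K" "K \<subseteq> O'"
    using Sura_Bura_clopen_subset[of red_closure ?D O'] D(1) by blast
  show thesis
  proof (rule that[OF K(2,1)])
    show "(branch t, t) \<in> K" using K(3) p by (auto simp: connected_component_refl)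
    show "a < s \<and> s < b" if "(branch s, s) \<in> K" for s
      using that K(4) by (auto simp: O'_def)
  qed
qed

theorem theorem4p1:
  fixes r1 r2 r3 :: real
  assumes "r1 = sqrt 2 / 7" and "r2 = sqrt 2 / 6" and "r3 = sqrt 2 / 5"
  shows "{r1<..<r2} \<inter> BIF \<noteq> {} \<and> {r2<..<r3} \<inter> GLOB r2 r3 \<noteq> {}"
proof
  have r: "0 < r1" "r1 < r2" "r2 < r3" "r3 < r0"
    using root_bounds(2)[of 5] by (simp_all add: assms)
  have lin: "linear (\<lambda>v. flip8 (flip3 v))"
    using linear_compose[OF linear_reflect linear_reflect] by (simp add: o_def)
  have e1: "(branch r1, r1) \<notin> red_closure"
    using not_in_red_closure[of r1 "\<lambda>v. v"] red_hess_pos_7 r linear_ident by (simp add: assms(1))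
  have e2: "(branch r2, r2) \<notin> red_closure"
    using not_in_red_closure[OF _ linear_reflect, of r2 "axis 8 1"] red_hess_pos_6 r by (simp add: assms(2))
  have e3: "(branch r3, r3) \<notin> red_closure"
    using not_in_red_closure[OF _ lin, of r3] red_hess_pos_5 r by (simp add: assms(3))
  show "{r1<..<r2} \<inter> BIF \<noteq> {}"
  proof
    assume none: "{r1<..<r2} \<inter> BIF = {}"
    have no: "(branch t, t) \<notin> red_closure" if "t \<in> {r1..r2}" for t
    proof
      assume "(branch t, t) \<in> red_closure"
      then have "t \<in> BIF" "t \<noteq> r1" "t \<noteq> r2" using that e1 e2 in_BIF[of t] r by auto
      then have "t \<in> {r1<..<r2} \<inter> BIF" using that by auto
      then show False using none by blast
    qed
    \<comment> \<open>No zeros accumulate on the branch over the interval, so the enclosing set is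
      empty. The certificates are the identity at \<open>r1\<close> and the reflection of the 8th
      coordinate at \<open>r2\<close>.\<close>
    show False
    proof (rule reduced_branch_index_change[of r1 r2 "{}" "\<lambda>v. v" 8])
      show "0 < red_hess (branch r1, r1) v v" if "v \<noteq> 0" for v using red_hess_pos_7[OF that] by (simp add: assms)
      show "0 < red_hess (branch r2, r2) v (reflect (axis 8 1) v)" if "v \<noteq> 0" for v
        using red_hess_pos_6[OF that] by (simp add: assms)
    qed (use r no linear_ident in auto)
  qed
  show "{r2<..<r3} \<inter> GLOB r2 r3 \<noteq> {}"
  proof
    assume no: "{r2<..<r3} \<inter> GLOB r2 r3 = {}"
    \<comment> \<open>The branch points at which other zeros accumulate. The absolute closure makes
      \<open>T\<close> compact; over \<open>{r2..r3}\<close> the branch lies in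
      \<open>red_dom\<close>, so nothing changes compared with \<open>red_closure\<close>.\<close>
    define T where "T = (\<lambda>t. (branch t, t)) ` {r2..r3} \<inter> closure red_nontrivial"
    have "compact T"
      unfolding T_def
      by (intro compact_Int_closed compact_continuous_image continuous_on_Pair continuous_branch) auto
    have T: "p \<in> T \<longleftrightarrow> (\<exists>t\<in>{r2..r3}. p = (branch t, t) \<and> (branch t, t) \<in> red_closure)" for p
      using branch_in_red_dom r by (auto simp: T_def red_closure_def)
    have "\<exists>K. compact K \<and> openin (top_of_set red_closure) K \<and> p \<in> K \<and>
        (\<forall>s. s \<in> {0<..<r0} \<and> (branch s, s) \<in> K \<longrightarrow> r2 < s \<and> s < r3)" if "p \<in> T" for p
    proof -
      obtain t where t: "t \<in> {r2..r3}" "p = (branch t, t)" "(branch t, t) \<in> red_closure" using \<open>p \<in> T\<close> unfolding T by blast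
      then have "t \<noteq> r2" "t \<noteq> r3" using e2 e3 by auto
      then have "t \<in> {r2<..<r3}" using t(1) by simp
      then have "t \<notin> GLOB r2 r3" using no by blast
      moreover have "0 < r2" using r by simp
      ultimately obtain K where "compact K" "openin (top_of_set red_closure) K" "(branch t, t) \<in> K"
        "\<And>s. \<lbrakk>s \<in> {0<..<r0}; (branch s, s) \<in> K\<rbrakk> \<Longrightarrow> r2 < s \<and> s < r3"
        using clopen_piece[OF _ r(4) e2 e3 t(3,1)] by metis
      then show ?thesis unfolding t(2) by (intro exI[of _ K]) auto
    qed
    then obtain K where K: "\<And>p. p \<in> T \<Longrightarrow> compact (K p)" "\<And>p. p \<in> T \<Longrightarrow> openin (top_of_set red_closure) (K p)"
      "\<And>p. p \<in> T \<Longrightarrow> p \<in> K p"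
      "\<And>p s. \<lbrakk>p \<in> T; s \<in> {0<..<r0}; (branch s, s) \<in> K p\<rbrakk> \<Longrightarrow> r2 < s \<and> s < r3" by metis
    obtain G where G: "\<And>p. p \<in> T \<Longrightarrow> open (G p)" "\<And>p. p \<in> T \<Longrightarrow> K p = red_closure \<inter> G p"
      using K(2) unfolding openin_open by metis
    obtain T' where T': "T' \<subseteq> T" "finite T'" "T \<subseteq> (\<Union>p\<in>T'. G p)"
    proof (rule compactE_image[OF \<open>compact T\<close>, of T G])
      show "open (G p)" if "p \<in> T" for p by (rule G(1)[OF that])
      show "T \<subseteq> (\<Union>p\<in>T. G p)"
      proof
        fix p assume "p \<in> T"
        then show "p \<in> (\<Union>p\<in>T. G p)" using G(2)[of p] K(3)[of p] by auto
      qed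
    qed (rule that)
    show False
    \<comment> \<open>The finite union is again compact and open in \<open>red_closure\<close>, and
      it covers all accumulation points on the branch. \<open>flip8\<close> is common to both ends,
      and the reflection of the 3rd coordinate is the additional sign at \<open>r3\<close>.\<close>
    proof (rule reduced_branch_index_change[of r2 r3 "\<Union>p\<in>T'. K p" flip8 3])
      show "compact (\<Union>p\<in>T'. K p)" using T' K(1) by (intro compact_UN) auto
      show "openin (top_of_set red_closure) (\<Union>p\<in>T'. K p)" using T' K(2) by (intro openin_Union) auto
      show "r2 < t \<and> t < r3" if t: "t \<in> {0<..<r0}" "(branch t, t) \<in> (\<Union>p\<in>T'. K p)" for t
      proof -
        obtain p where "p \<in> T'" "(branch t, t) \<in> K p" using t(2) by (rule UN_E)
        then show ?thesis using K(4)[of p t] T'(1) t(1) by auto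
      qed
      show "(branch t, t) \<in> (\<Union>p\<in>T'. K p)" if t: "t \<in> {r2..r3}" "(branch t, t) \<in> red_closure" for t
      proof -
        have "(branch t, t) \<in> T" unfolding T using t by blast
        then have "(branch t, t) \<in> (\<Union>p\<in>T'. G p)" using T'(3) by (rule rev_subsetD)
        then obtain p where "p \<in> T'" "(branch t, t) \<in> G p" by (rule UN_E)
        moreover have "p \<in> T" using T'(1) \<open>p \<in> T'\<close> by (rule subsetD)
        ultimately show ?thesis using G(2)[of p] t(2) \<open>p \<in> T'\<close> by auto
      qed
      show "0 < red_hess (branch r2, r2) v (flip8 v)" if "v \<noteq> 0" for v using red_hess_pos_6[OF that] by (simp add: assms)
      show "0 < red_hess (branch r3, r3) v (flip8 (reflect (axis 3 1) v))" if "v \<noteq> 0" for v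
        using red_hess_pos_5[OF that] by (simp add: assms)
    qed (use r flip8_flip8 in \<open>auto intro: linear_reflect\<close>)
  qed
qed

end
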